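(* For every real $\epsilon<\frac14$ the bilinear estimate $$\begin{aligned}\|\partial_x(uv)\|_{X_{1,-\frac12}}\le{}& C\|u\|_{X_{1,\frac12}}\Big(\|v\|_{X_{1,\frac12}}+\|v\|_{X_{1,\frac12}}^{1-\epsilon}\|v\|_{Y_{1,0,\frac12}}^{\epsilon}\Big)\\&+C\|v\|_{X_{1,\frac12}}\Big(\|u\|_{X_{1,\frac12}}+\|u\|_{X_{1,\frac12}}^{1-\epsilon}\|u\|_{Y_{1,0,\frac12}}^{\epsilon}\Big)\end{aligned}$$ fails; that is, there is no constant $C>0$ for which it holds for all nonzero $u,v\in X_{1,\frac12}\cap Y_{1,0,\frac12}$.
   Context: $\hat f(\xi,\mu,\tau)$ denotes the Fourier transform of a function $f(x,y,t)$ on $\mathbb{R}^3$. Put $\omega(\xi,\mu)=\xi^3+\mu^2/\xi$ and $w(\xi,\mu)=1+|\xi|+\frac{|\mu|}{|\xi|}$. Cutoffs: $\theta_0(s)=\mathbf 1_{[-1,1]}(s)$ and $\theta_m(s)=\mathbf 1_{[2^{m-1},2^m]}(|s|)$ for integers $m\ge1$; $\rho_1(\xi,\mu)=\mathbf 1_{\{|\xi|\ge\frac12|\mu|/|\xi|\}}$, $\rho_2(\xi,\mu)=\mathbf 1_{\{|\xi|<\frac12|\mu|/|\xi|\}}$; $\chi_0(s)=\mathbf 1_{\{|s|<1\}}$ and $\chi_j(s)=\mathbf 1_{\{2^{j-1}\le|s|<2^j\}}$ for $j\ge1$. The space $X_{s,b}$ is defined by the norm $$\|f\|_{X_{s,b}}=\sum_{j,m\ge0}2^{jb}\Big(\int_{\mathbb{R}^3}\chi_j(\tau-\omega)\rho_1\theta_m(\xi)w^{2s}|\hat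 f|^2d\xi d\mu d\tau\Big)^{1/2}+\sum_{j,n\ge0}2^{jb}\Big(\int_{\mathbb{R}^3}\chi_j(\tau-\omega)\rho_2\theta_n(\mu)w^{2s}|\hat f|^2d\xi d\mu d\tau\Big)^{1/2},$$ and $Y_{s,r,b}=\{f: tf\in X_{s,b},\ yf\in X_{r,b}\}$ with norm $\|f\|_{Y_{s,r,b}}=\|tf\|_{X_{s,b}}+\|yf\|_{X_{r,b}}$. *)

theory Defs
  imports "HOL-Analysis.Analysis"
begin

type_synonym R3 = "real \<times> real \<times> real"

text \<open>
  Schwartz functions and tempered distributions on \<open>R3\<close>. Points are written \<open>(x, y, t)\<close> on the
  physical side and \<open>(\<xi>, \<mu>, \<tau>)\<close> on the frequency side.
\<close>

definition partials :: "R3 list \<Rightarrow> (R3 \<Rightarrow> complex) \<Rightarrow> R3 \<Rightarrow> complex" where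
  "partials bs f = foldr (\<lambda>b g z. frechet_derivative g (at z) b) bs f"

text \<open>Differentiability of every iterated partial derivative is equivalent to \<open>f\<close> being smooth.\<close>

definition schwartz :: "(R3 \<Rightarrow> complex) set" where
  "schwartz = {f. \<forall>bs. set bs \<subseteq> Basis \<longrightarrow>
     (\<forall>z. partials bs f differentiable (at z)) \<and>
     (\<forall>k::nat. bounded (range (\<lambda>z. norm z ^ k *\<^sub>R partials bs f z)))}"

text \<open>
  The sign and the absence of \<open>2 * pi\<close> in the phase match the dispersion relation
  \<open>\<tau> = \<omega>(\<xi>, \<mu>)\<close>; with this convention \<open>\<partial>\<^sub>x\<close> corresponds to multiplication by \<open>\<i> * \<xi>\<close>.
\<close>

definition fourier :: "(R3 \<Rightarrow> complex) \<Rightarrow> R3 \<Rightarrow> complex" where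
  "fourier f \<zeta> = (\<integral>z. exp (- \<i> * complex_of_real (z \<bullet> \<zeta>)) * f z \<partial>lborel)"

text \<open>
  A distribution is a functional of which only the values on \<open>schwartz\<close> matter. Continuity is not
  part of the type: if \<open>f * \<phi>\<close> is integrable for all Schwartz \<open>\<phi>\<close>, then \<open>dist_of f\<close> is
  automatically continuous on \<open>schwartz\<close> (Banach-Steinhaus), and so is every functional whose
  Fourier transform is such a \<open>dist_of g\<close>.
\<close>

type_synonym distribution = "(R3 \<Rightarrow> complex) \<Rightarrow> complex"

definition tempered_fun :: "(R3 \<Rightarrow> complex) \<Rightarrow> bool" where
  "tempered_fun f \<longleftrightarrow> f \<in> borel_measurable borel \<and>
     (\<forall>\<phi>\<in>schwartz. integrable lborel (\<lambda>z. f z * \<phi> z))"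

definition dist_of :: "(R3 \<Rightarrow> complex) \<Rightarrow> distribution" where
  "dist_of f \<phi> = (\<integral>z. f z * \<phi> z \<partial>lborel)"

definition dist_dx :: "distribution \<Rightarrow> distribution" where
  "dist_dx T \<phi> = - T (\<lambda>z. frechet_derivative \<phi> (at z) (1, 0, 0))"

definition dist_mult :: "(R3 \<Rightarrow> complex) \<Rightarrow> distribution \<Rightarrow> distribution" where
  "dist_mult a T \<phi> = T (\<lambda>z. a z * \<phi> z)"

definition coord_y :: "R3 \<Rightarrow> complex" where
  "coord_y = (\<lambda>(x, y, t). complex_of_real y)"

definition coord_t :: "R3 \<Rightarrow> complex" where
  "coord_t = (\<lambda>(x, y, t). complex_of_real t)"

text \<open>The function \<open>g\<close> is determined by \<open>T\<close> up to a null set.\<close>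

definition has_fourier_fun :: "distribution \<Rightarrow> (R3 \<Rightarrow> complex) \<Rightarrow> bool" where
  "has_fourier_fun T g \<longleftrightarrow> tempered_fun g \<and> (\<forall>\<phi>\<in>schwartz. T (fourier \<phi>) = dist_of g \<phi>)"


text \<open>
  Division by \<open>\<xi> = 0\<close> below only concerns a null set.
\<close>

definition omega :: "real \<Rightarrow> real \<Rightarrow> real" where
  "omega \<xi> \<mu> = \<xi> ^ 3 + \<mu>\<^sup>2 / \<xi>"

definition weight :: "real \<Rightarrow> real \<Rightarrow> real" where
  "weight \<xi> \<mu> = 1 + \<bar>\<xi>\<bar> + \<bar>\<mu>\<bar> / \<bar>\<xi>\<bar>"

definition theta :: "nat \<Rightarrow> real \<Rightarrow> real" where
  "theta m s = (if m = 0 then indicator {-1..1} s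
                else indicator {2 ^ (m - 1)..2 ^ m} \<bar>s\<bar>)"

definition rho1 :: "real \<Rightarrow> real \<Rightarrow> real" where
  "rho1 \<xi> \<mu> = (if \<bar>\<xi>\<bar> \<ge> 1 / 2 * (\<bar>\<mu>\<bar> / \<bar>\<xi>\<bar>) then 1 else 0)"

definition rho2 :: "real \<Rightarrow> real \<Rightarrow> real" where
  "rho2 \<xi> \<mu> = (if \<bar>\<xi>\<bar> < 1 / 2 * (\<bar>\<mu>\<bar> / \<bar>\<xi>\<bar>) then 1 else 0)"

definition chi :: "nat \<Rightarrow> real \<Rightarrow> real" where
  "chi j s = (if j = 0 then indicator {..<1} \<bar>s\<bar>
              else indicator {2 ^ (j - 1)..<2 ^ j} \<bar>s\<bar>)"

definition ennsqrt :: "ennreal \<Rightarrow> ennreal" where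
  "ennsqrt a = (if a = \<infinity> then \<infinity> else ennreal (sqrt (enn2real a)))"

definition X_norm_hat :: "real \<Rightarrow> real \<Rightarrow> (R3 \<Rightarrow> complex) \<Rightarrow> ennreal" where
  "X_norm_hat s b g =
     (\<Sum>j. \<Sum>m. ennreal (2 powr (real j * b)) *
        ennsqrt (\<integral>\<^sup>+ (\<xi>, \<mu>, \<tau>). ennreal
          (chi j (\<tau> - omega \<xi> \<mu>) * rho1 \<xi> \<mu> * theta m \<xi> * weight \<xi> \<mu> powr (2 * s)
           * (cmod (g (\<xi>, \<mu>, \<tau>)))\<^sup>2) \<partial>lborel)) +
     (\<Sum>j. \<Sum>n. ennreal (2 powr (real j * b)) *
        ennsqrt (\<integral>\<^sup>+ (\<xi>, \<mu>, \<tau>). ennreal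
          (chi j (\<tau> - omega \<xi> \<mu>) * rho2 \<xi> \<mu> * theta n \<mu> * weight \<xi> \<mu> powr (2 * s)
           * (cmod (g (\<xi>, \<mu>, \<tau>)))\<^sup>2) \<partial>lborel))"

definition X_norm :: "real \<Rightarrow> real \<Rightarrow> distribution \<Rightarrow> ennreal" where
  "X_norm s b T = (if \<exists>g. has_fourier_fun T g
     then X_norm_hat s b (SOME g. has_fourier_fun T g) else \<infinity>)"

definition X_space :: "real \<Rightarrow> real \<Rightarrow> distribution set" where
  "X_space s b = {T. X_norm s b T < \<infinity>}"

definition Y_norm :: "real \<Rightarrow> real \<Rightarrow> real \<Rightarrow> distribution \<Rightarrow> ennreal" where
  "Y_norm s r b T = X_norm s b (dist_mult coord_t T) + X_norm r b (dist_mult coord_y T)"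

definition Y_space :: "real \<Rightarrow> real \<Rightarrow> real \<Rightarrow> distribution set" where
  "Y_space s r b = {T. dist_mult coord_t T \<in> X_space s b \<and> dist_mult coord_y T \<in> X_space r b}"

text \<open>
  A nonzero element of the intersection of the spaces with indices \<open>(1, 1/2)\<close> and \<open>(1, 0, 1/2)\<close>,
  given by a function. Every element of \<open>X_space 1 (1/2)\<close> is the distribution of an \<open>L\<^sup>2\<close>
  function, because \<open>weight \<ge> 1\<close>; hence a product of two such functions is in \<open>L\<^sup>1\<close>.
\<close>

definition admissible :: "(R3 \<Rightarrow> complex) \<Rightarrow> bool" where
  "admissible u \<longleftrightarrow> tempered_fun u \<and> \<not> (AE z in lborel. u z = 0) \<and>
     dist_of u \<in> X_space 1 (1/2) \<inter> Y_space 1 0 (1/2)"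

definition X_real :: "(R3 \<Rightarrow> complex) \<Rightarrow> real" where
  "X_real u = enn2real (X_norm 1 (1/2) (dist_of u))"

definition Y_real :: "(R3 \<Rightarrow> complex) \<Rightarrow> real" where
  "Y_real u = enn2real (Y_norm 1 0 (1/2) (dist_of u))"

end

theory Submission
  imports Defs "HOL-Probability.Probability"
begin

text \<open>
  The counterexample is a resonant interaction of a low and a high frequency. Let \<open>N = 4 ^ k\<close> and
  \<open>\<gamma> = N\<close> to the power \<open>-1/2\<close>. The Fourier transform of \<open>u\<close> is a bump on the box
  \<open>\<xi> \<approx> 2\<gamma> \<plusminus> \<gamma>\<close>, \<open>\<bar>\<mu>\<bar> \<le> \<gamma>\<^sup>2\<close>, \<open>\<bar>\<tau>\<bar> \<le> 1\<close>; that of \<open>v\<close> is its translate by \<open>(N, \<surd>3 N\<^sup>2, 4 N\<^sup>3 + 96)\<close>.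
  At \<open>(N, \<surd>3 N\<^sup>2)\<close> the derivative of \<open>\<omega>\<close> in \<open>\<xi>\<close> vanishes, and \<open>\<omega>\<close> varies by \<open>O(1)\<close> on boxes of size
  \<open>\<gamma> \<times> \<gamma>\<^sup>2\<close>, so that \<open>u\<close>, \<open>v\<close> and \<open>u v\<close> all have modulation \<open>O(1)\<close>. With \<open>S = \<gamma>\<close> to the power \<open>3/2\<close> one
  finds \<open>\<parallel>u\<parallel>\<^sub>X \<sim> 1/S\<close>, \<open>\<parallel>v\<parallel>\<^sub>X \<sim> N/S\<close>, \<open>\<parallel>u\<parallel>\<^sub>Y \<sim> N/S\<close>, \<open>\<parallel>v\<parallel>\<^sub>Y \<sim> N/S\<close>, while the left-hand side is
  \<open>\<sim> N\<^sup>2/S\<close>. Hence the estimate would give \<open>N S \<lesssim> N\<close> to the power \<open>max \<epsilon> 0\<close>, where \<open>N S\<close> is \<open>N\<close> to the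
  power \<open>1/4\<close>.
\<close>

section \<open>Fourier transforms of integrable and Schwartz functions\<close>

text \<open>The packets are normalised in physical space: \<open>u\<close> and \<open>v\<close> are
  products of fixed profiles, stretched by 1/\<gamma> in x and 1/\<gamma>^2 in y, times phases of
  modulus one. Their transforms have height of order \<gamma>^-3 on a box of volume of order
  \<gamma>^3, whence the factor 1/S, and \<open>u v\<close> is again such a packet, so the product
  loses no power of \<gamma>. Multiplication by t costs a constant, multiplication by y costs
  1/\<gamma>^2 = N. For \<open>v\<close> this is no more than its weight N, so its two norms are
  comparable; only the interpolated term of \<open>u\<close> gains, by N to the power \<epsilon>.

  Negative \<epsilon> is included. The power of the Y-norm is then decreasing in that norm, so upper
  bounds do not suffice and a lower bound is proved as well.

  The norms are those of distributions, taken through a chosen Fourier transform. They become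
  computable once this transform is known to be unique almost everywhere. Prescribing compactly
  supported transforms for functions given in physical space is what calls for inversion on the
  line.\<close>

lemma integrable_lborel_pair_mult:
  fixes f :: "'a::euclidean_space \<Rightarrow> complex" and g :: "'b::euclidean_space \<Rightarrow> complex"
  assumes "integrable lborel f" "integrable lborel g"
  shows "integrable lborel (\<lambda>z. f (fst z) * g (snd z))"
    and "(\<integral>z. f (fst z) * g (snd z) \<partial>lborel) = (\<integral>x. f x \<partial>lborel) * (\<integral>y. g y \<partial>lborel)"
proof -
  have [measurable]: "f \<in> borel_measurable borel" "g \<in> borel_measurable borel"
    using assms by auto
  have i: "integrable (lborel \<Otimes>\<^sub>M lborel) (\<lambda>z. f (fst z) * g (snd z))"
  proof (rule lborel_pair.Fubini_integrable)
    show "integrable lborel (\<lambda>x. \<integral>y. norm (f (fst (x, y)) * g (snd (x, y))) \<partial>lborel)"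
      using assms by (simp add: norm_mult)
    show "AE x in lborel. integrable lborel (\<lambda>y. f (fst (x, y)) * g (snd (x, y)))"
      using assms by simp
  qed (simp add: lborel_prod borel_prod[symmetric])
  then show "integrable lborel (\<lambda>z. f (fst z) * g (snd z))" by (simp add: lborel_prod)
  have "(\<integral>z. f (fst z) * g (snd z) \<partial>(lborel \<Otimes>\<^sub>M lborel)) = (\<integral>x. (\<integral>y. f x * g y \<partial>lborel) \<partial>lborel)"
    using lborel_pair.integral_fst'[OF i] by simp
  also have "\<dots> = (\<integral>x. f x \<partial>lborel) * (\<integral>y. g y \<partial>lborel)" by simp
  finally show "(\<integral>z. f (fst z) * g (snd z) \<partial>lborel) = (\<integral>x. f x \<partial>lborel) * (\<integral>y. g y \<partial>lborel)"
    by (simp add: lborel_prod)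
qed

definition tensor :: "(real \<Rightarrow> complex) \<Rightarrow> (real \<Rightarrow> complex) \<Rightarrow> (real \<Rightarrow> complex) \<Rightarrow> R3 \<Rightarrow> complex" where
  "tensor f g h = (\<lambda>(x, y, t). f x * g y * h t)"

lemma integrable_tensor:
  assumes "integrable lborel f" "integrable lborel g" "integrable lborel h"
  shows "integrable lborel (tensor f g h)"
    and "(\<integral>z. tensor f g h z \<partial>lborel) = (\<integral>x. f x \<partial>lborel) * (\<integral>y. g y \<partial>lborel) * (\<integral>t. h t \<partial>lborel)"
proof -
  have eq: "tensor f g h = (\<lambda>z. f (fst z) * (\<lambda>w. g (fst w) * h (snd w)) (snd z))"
    by (auto simp: tensor_def fun_eq_iff)
  note 1 = integrable_lborel_pair_mult[OF assms(2,3)]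
  note 2 = integrable_lborel_pair_mult[OF assms(1) 1(1)]
  show "integrable lborel (tensor f g h)" unfolding eq by (rule 2)
  show "(\<integral>z. tensor f g h z \<partial>lborel) = (\<integral>x. f x \<partial>lborel) * (\<integral>y. g y \<partial>lborel) * (\<integral>t. h t \<partial>lborel)"
    unfolding eq 2(2) 1(2) by simp
qed

lemma integrable_inverse_1_plus_square_complex:
  "integrable lborel (\<lambda>x. complex_of_real (inverse (1 + x\<^sup>2)))"
proof -
  have "integrable lborel (\<lambda>x::real. inverse (1 + x\<^sup>2))"
    using integrable_inverse_1_plus_square by (simp add: set_integrable_def)
  then show ?thesis by (rule integrable_of_real)
qed

text \<open>With r = |z|^2 one has (1+x^2)(1+y^2)(1+t^2) \<le> (1+r)^3 \<le> 4(1+r^3), and r^3 =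
  |z|^6. Decay of order six therefore puts f below a tensor product of three functions of the form
  1/(1+x^2).\<close>

lemma integrable_R3_decay:
  fixes f :: "R3 \<Rightarrow> 'a::{banach, second_countable_topology}"
  assumes [measurable]: "f \<in> borel_measurable borel"
    and C: "\<And>z. norm (f z) \<le> C" "\<And>z. norm z ^ 6 * norm (f z) \<le> C"
  shows "integrable lborel f"
proof -
  let ?q = "\<lambda>x. complex_of_real (inverse (1 + x\<^sup>2))"
  note 1 = integrable_tensor(1)[of ?q ?q ?q, OF integrable_inverse_1_plus_square_complex
      integrable_inverse_1_plus_square_complex integrable_inverse_1_plus_square_complex]
  show ?thesis
  proof (rule Bochner_Integration.integrable_bound[OF integrable_mult_right[OF 1, of "complex_of_real (8 * C)"]])
    show "AE z in lborel. norm (f z) \<le> norm (complex_of_real (8 * C) * tensor ?q ?q ?q z)"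
    proof (rule AE_I2, safe)
      fix x y t :: real
      let ?z = "(x, y, t)" and ?D = "(1 + x\<^sup>2) * (1 + y\<^sup>2) * (1 + t\<^sup>2)"
      define r where "r = (norm ?z)\<^sup>2"
      have r: "r = x\<^sup>2 + y\<^sup>2 + t\<^sup>2" by (simp add: r_def norm_Pair)
      have r0: "r \<ge> 0" by (simp add: r)
      have C0: "C \<ge> 0" using C(1)[of 0] norm_ge_zero order_trans by blast
      have "?D \<le> (1 + r) * (1 + r) * (1 + r)"
        by (intro mult_mono) (auto simp: r)
      also have "\<dots> \<le> 4 * (1 + r ^ 3)"
      proof -
        have "4 * (1 + r ^ 3) - (1 + r) * (1 + r) * (1 + r) = 3 * (r - 1)\<^sup>2 * (r + 1)"
          by (simp add: algebra_simps power2_eq_square power3_eq_cube)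
        moreover have "\<dots> \<ge> 0" using r0 by simp
        ultimately show ?thesis by linarith
      qed
      finally have D: "?D \<le> 4 * (1 + r ^ 3)" .
      have r3: "r ^ 3 = norm ?z ^ 6" by (simp add: r_def flip: power_mult)
      have "?D * norm (f ?z) \<le> 4 * (1 + r ^ 3) * norm (f ?z)"
        using D by (rule mult_right_mono) simp
      also have "\<dots> = 4 * norm (f ?z) + 4 * (norm ?z ^ 6 * norm (f ?z))"
        by (simp add: r3 algebra_simps)
      also have "\<dots> \<le> 8 * C" using C(1)[of ?z] C(2)[of ?z] by linarith
      finally have *: "?D * norm (f ?z) \<le> 8 * C" .
      have Dp: "?D > 0" by (intro mult_pos_pos) (auto simp: add_pos_nonneg)
      have "norm (f ?z) \<le> 8 * C / ?D" using * Dp by (simp add: field_simps)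
      also have "\<dots> = norm (complex_of_real (8 * C) * tensor ?q ?q ?q ?z)"
        using C0 Dp
        by (simp add: tensor_def norm_mult divide_inverse norm_of_real abs_mult add_nonneg_nonneg
             del: of_real_power of_real_add of_real_mult of_real_inverse)
      finally show "norm (f ?z) \<le> norm (complex_of_real (8 * C) * tensor ?q ?q ?q ?z)" .
    qed
  qed simp
qed

lemma integrable_bounded_mult:
  fixes f :: "'a \<Rightarrow> complex"
  assumes f: "integrable M f" and g: "g \<in> borel_measurable M" "\<And>z. norm (g z) \<le> B"
  shows "integrable M (\<lambda>z. g z * f z)"
proof (rule Bochner_Integration.integrable_bound[OF integrable_scaleR_right[OF f, of B]])
  show "AE z in M. norm (g z * f z) \<le> norm (B *\<^sub>R f z)"
  proof (rule AE_I2)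
    fix z
    have "norm (g z) * norm (f z) \<le> \<bar>B\<bar> * norm (f z)"
      using order_trans[OF g(2) abs_ge_self] by (rule mult_right_mono) simp
    then show "norm (g z * f z) \<le> norm (B *\<^sub>R f z)" by (simp add: norm_mult)
  qed
  show "(\<lambda>z. g z * f z) \<in> borel_measurable M"
    using borel_measurable_integrable[OF f] g(1) by (rule borel_measurable_times[rotated])
qed

lemma schwartz_measurable:
  assumes "\<phi> \<in> schwartz"
  shows "\<phi> \<in> borel_measurable borel"
proof -
  have "\<forall>z. \<phi> differentiable (at z)"
    using assms[unfolded schwartz_def] by (auto simp: partials_def dest: spec[of _ "[]"])
  then have "continuous_on UNIV \<phi>"
    by (meson continuous_at_imp_continuous_on differentiable_imp_continuous_within)
  then show ?thesis by (rule borel_measurable_continuous_onI)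
qed

lemma schwartz_decay:
  assumes "\<phi> \<in> schwartz"
  obtains C where "\<And>z. norm z ^ k * norm (\<phi> z) \<le> C"
proof -
  have "bounded (range (\<lambda>z. norm z ^ k *\<^sub>R \<phi> z))"
    using assms[unfolded schwartz_def] by (auto simp: partials_def dest: spec[of _ "[]"])
  then obtain C where "\<And>z. norm (norm z ^ k *\<^sub>R \<phi> z) \<le> C"
    unfolding bounded_iff by auto
  then show ?thesis using that[of C] by simp
qed

lemma schwartz_integrable_power:
  assumes "\<phi> \<in> schwartz"
  shows "integrable lborel (\<lambda>z. norm z ^ k *\<^sub>R \<phi> z)"
proof -
  obtain C where C: "\<And>z. norm z ^ k * norm (\<phi> z) \<le> C" using schwartz_decay[OF assms] by blast
  obtain C' where C': "\<And>z. norm z ^ (6 + k) * norm (\<phi> z) \<le> C'" using schwartz_decay[OF assms] by blast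
  have [measurable]: "\<phi> \<in> borel_measurable borel" by (rule schwartz_measurable[OF assms])
  show ?thesis
  proof (rule integrable_R3_decay[where C = "max C C'"])
    show "norm (norm z ^ k *\<^sub>R \<phi> z) \<le> max C C'" for z using C[of z] by (simp add: max_def)
    show "norm z ^ 6 * norm (norm z ^ k *\<^sub>R \<phi> z) \<le> max C C'" for z
      using C'[of z] by (simp add: max_def power_add mult.assoc)
  qed simp
qed

lemma schwartz_integrable: "\<phi> \<in> schwartz \<Longrightarrow> integrable lborel \<phi>"
  using schwartz_integrable_power[of \<phi> 0] by simp

lemma schwartz_integrable_inner:
  assumes "\<phi> \<in> schwartz"
  shows "integrable lborel (\<lambda>z. complex_of_real (z \<bullet> h) * \<phi> z)"
proof (rule Bochner_Integration.integrable_bound[OF integrable_scaleR_right[OF schwartz_integrable_power[OF assms, of 1], of "norm h"]])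
  have [measurable]: "\<phi> \<in> borel_measurable borel" by (rule schwartz_measurable[OF assms])
  show "(\<lambda>z. complex_of_real (z \<bullet> h) * \<phi> z) \<in> borel_measurable lborel" by simp
  show "AE z in lborel. norm (complex_of_real (z \<bullet> h) * \<phi> z) \<le> norm (norm h *\<^sub>R (norm z ^ 1 *\<^sub>R \<phi> z))"
  proof (rule AE_I2)
    fix z
    have "\<bar>z \<bullet> h\<bar> * norm (\<phi> z) \<le> norm z * norm h * norm (\<phi> z)"
      by (intro mult_right_mono Cauchy_Schwarz_ineq2) simp
    then show "norm (complex_of_real (z \<bullet> h) * \<phi> z) \<le> norm (norm h *\<^sub>R (norm z ^ 1 *\<^sub>R \<phi> z))"
      by (simp add: norm_mult mult_ac)
  qed
qed

lemma fourier_integrable_kernel: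
  assumes "integrable lborel f"
  shows "integrable lborel (\<lambda>z. exp (- \<i> * complex_of_real (z \<bullet> \<zeta>)) * f z)"
  by (rule integrable_bounded_mult[OF assms, where B = 1]) simp_all

lemma norm_fourier_le:
  assumes "integrable lborel f"
  shows "norm (fourier f \<zeta>) \<le> (\<integral>z. norm (f z) \<partial>lborel)"
proof -
  have "norm (fourier f \<zeta>) \<le> (\<integral>z. norm (exp (- \<i> * complex_of_real (z \<bullet> \<zeta>)) * f z) \<partial>lborel)"
    unfolding fourier_def by (rule integral_norm_bound)
  then show ?thesis by (simp add: norm_mult)
qed

lemma fourier_measurable:
  assumes [measurable]: "f \<in> borel_measurable borel"
  shows "fourier f \<in> borel_measurable borel"
  unfolding fourier_def by (rule lborel.borel_measurable_lebesgue_integral) simp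

text \<open>Fubini for a kernel symmetric in both variables. This is the bridge from the transform
  of a distribution, defined by testing against \<open>fourier \<phi>\<close>, to the integral
  \<open>fourier u\<close>.\<close>

lemma fourier_multiplication_formula:
  assumes "integrable lborel f" "integrable lborel g"
  shows "(\<integral>z. f z * fourier g z \<partial>lborel) = (\<integral>\<zeta>. fourier f \<zeta> * g \<zeta> \<partial>lborel)"
proof -
  have [measurable]: "f \<in> borel_measurable borel" "g \<in> borel_measurable borel"
    using assms by auto
  let ?K = "\<lambda>z \<zeta>. exp (- \<i> * complex_of_real (\<zeta> \<bullet> z)) * (f z * g \<zeta>)"
  have "integrable lborel (\<lambda>p. f (fst p) * g (snd p))" 
    by (rule integrable_lborel_pair_mult[OF assms])
  then have "integrable lborel (\<lambda>p. exp (- \<i> * complex_of_real (snd p \<bullet> fst p)) * (f (fst p) * g (snd p)))"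
  proof (rule integrable_bounded_mult[where B = 1])
    have "(\<lambda>p::R3 \<times> R3. exp (- \<i> * complex_of_real (snd p \<bullet> fst p))) \<in> borel_measurable borel"
      by (intro borel_measurable_continuous_onI continuous_intros)
    then show "(\<lambda>p::R3 \<times> R3. exp (- \<i> * complex_of_real (snd p \<bullet> fst p))) \<in> borel_measurable lborel"
      by simp
  qed simp
  then have i: "integrable (lborel \<Otimes>\<^sub>M lborel) (case_prod ?K)"
    unfolding lborel_prod case_prod_unfold .
  have "(\<integral>z. f z * fourier g z \<partial>lborel) = (\<integral>z. \<integral>\<zeta>. ?K z \<zeta> \<partial>lborel \<partial>lborel)"
    unfolding fourier_def integral_mult_right_zero[symmetric]
    by (intro Bochner_Integration.integral_cong refl) (simp add: mult_ac)
  also have "\<dots> = (\<integral>\<zeta>. \<integral>z. ?K z \<zeta> \<partial>lborel \<partial>lborel)"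
    by (rule lborel_pair.Fubini_integral[OF i, symmetric])
  also have "\<dots> = (\<integral>\<zeta>. fourier f \<zeta> * g \<zeta> \<partial>lborel)"
    unfolding fourier_def integral_mult_left_zero[symmetric]
    by (intro Bochner_Integration.integral_cong refl) (simp add: mult_ac inner_commute)
  finally show ?thesis .
qed

lemma norm_iexp_remainder: "norm (exp (\<i> * complex_of_real a) - 1 - \<i> * complex_of_real a) \<le> a\<^sup>2"
proof -
  have "norm (iexp a - (\<Sum>k\<le>1. (\<i> * a) ^ k / fact k)) \<le> \<bar>a\<bar> ^ Suc 1 / fact (Suc 1)"
    by (rule iexp_approx1)
  then have "norm (iexp a - (1 + \<i> * a)) \<le> a\<^sup>2 / 2" by (simp add: power2_eq_square)
  moreover have "a\<^sup>2 / 2 \<le> a\<^sup>2" by simp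
  ultimately show ?thesis unfolding diff_diff_eq by linarith
qed

text \<open>\<open>dist_dx\<close> differentiates the test function \<open>fourier \<phi>\<close>,
  so its derivative is needed explicitly. The second-order bound \<open>norm_iexp_remainder\<close>
  makes the remainder at most M |h|^2, where M is the second absolute moment of \<phi>.\<close>

lemma has_derivative_fourier:
  assumes \<phi>: "\<phi> \<in> schwartz"
  shows "(fourier \<phi> has_derivative (\<lambda>h. fourier (\<lambda>\<zeta>. - \<i> * complex_of_real (\<zeta> \<bullet> h) * \<phi> \<zeta>) z)) (at z)"
proof -
  let ?D = "\<lambda>h. fourier (\<lambda>\<zeta>. - \<i> * complex_of_real (\<zeta> \<bullet> h) * \<phi> \<zeta>) z"
  define M where "M = (\<integral>\<zeta>. norm (norm \<zeta> ^ 2 *\<^sub>R \<phi> \<zeta>) \<partial>lborel)"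
  define M1 where "M1 = (\<integral>\<zeta>. norm (norm \<zeta> ^ 1 *\<^sub>R \<phi> \<zeta>) \<partial>lborel)"
  have [measurable]: "\<phi> \<in> borel_measurable borel" by (rule schwartz_measurable[OF \<phi>])
  have ii: "integrable lborel (\<lambda>\<zeta>. - \<i> * complex_of_real (\<zeta> \<bullet> h) * \<phi> \<zeta>)" for h
    using integrable_mult_right[OF schwartz_integrable_inner[OF \<phi>, of h], of "-\<i>"] by (simp add: mult.assoc)
  note i0 = fourier_integrable_kernel[OF schwartz_integrable[OF \<phi>]]
  note i1 = fourier_integrable_kernel[OF ii]
  have bl: "bounded_linear ?D"
  proof (rule bounded_linear_intro[where K = M1])
    show "?D (x + y) = ?D x + ?D y" for x y
    proof -
      have "?D x + ?D y = (\<integral>\<zeta>. exp (- \<i> * complex_of_real (\<zeta> \<bullet> z)) * (- \<i> * complex_of_real (\<zeta> \<bullet> x) * \<phi> \<zeta>)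
             + exp (- \<i> * complex_of_real (\<zeta> \<bullet> z)) * (- \<i> * complex_of_real (\<zeta> \<bullet> y) * \<phi> \<zeta>) \<partial>lborel)"
        unfolding fourier_def by (rule Bochner_Integration.integral_add[OF i1 i1, symmetric])
      also have "\<dots> = ?D (x + y)" unfolding fourier_def
        by (intro Bochner_Integration.integral_cong refl) (simp add: algebra_simps inner_add_right)
      finally show ?thesis by simp
    qed
    show "?D (r *\<^sub>R x) = r *\<^sub>R ?D x" for r x
      unfolding fourier_def integral_scaleR_right[symmetric]
      by (intro Bochner_Integration.integral_cong refl) (simp add: algebra_simps scaleR_conv_of_real)
    show "norm (?D h) \<le> norm h * M1" for h
    proof -
      have "norm (?D h) \<le> (\<integral>\<zeta>. norm (- \<i> * complex_of_real (\<zeta> \<bullet> h) * \<phi> \<zeta>) \<partial>lborel)"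
        by (rule norm_fourier_le[OF ii])
      also have "\<dots> \<le> (\<integral>\<zeta>. norm h * norm (norm \<zeta> ^ 1 *\<^sub>R \<phi> \<zeta>) \<partial>lborel)"
      proof (rule integral_mono)
        show "integrable lborel (\<lambda>\<zeta>. norm (- \<i> * complex_of_real (\<zeta> \<bullet> h) * \<phi> \<zeta>))"
          by (rule integrable_norm[OF ii])
        show "integrable lborel (\<lambda>\<zeta>. norm h * norm (norm \<zeta> ^ 1 *\<^sub>R \<phi> \<zeta>))"
          by (intro integrable_mult_right integrable_norm schwartz_integrable_power \<phi>)
        fix \<zeta>
        have "\<bar>\<zeta> \<bullet> h\<bar> * norm (\<phi> \<zeta>) \<le> norm \<zeta> * norm h * norm (\<phi> \<zeta>)"
          by (intro mult_right_mono Cauchy_Schwarz_ineq2) simp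
        then show "norm (- \<i> * complex_of_real (\<zeta> \<bullet> h) * \<phi> \<zeta>) \<le> norm h * norm (norm \<zeta> ^ 1 *\<^sub>R \<phi> \<zeta>)"
          by (simp add: norm_mult mult_ac)
      qed
      finally show ?thesis by (simp add: M1_def)
    qed
  qed
  have rem: "norm (fourier \<phi> (z + h) - fourier \<phi> z - ?D h) \<le> M * norm h * norm h" for h
  proof -
    let ?r = "\<lambda>\<zeta>. exp (- \<i> * complex_of_real (\<zeta> \<bullet> z)) *
        ((exp (\<i> * complex_of_real (- (\<zeta> \<bullet> h))) - 1 - \<i> * complex_of_real (- (\<zeta> \<bullet> h))) * \<phi> \<zeta>)"
    have eq: "?r = (\<lambda>\<zeta>. exp (- \<i> * complex_of_real (\<zeta> \<bullet> (z + h))) * \<phi> \<zeta> - exp (- \<i> * complex_of_real (\<zeta> \<bullet> z)) * \<phi> \<zeta>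
        - exp (- \<i> * complex_of_real (\<zeta> \<bullet> z)) * (- \<i> * complex_of_real (\<zeta> \<bullet> h) * \<phi> \<zeta>))"
    proof
      fix \<zeta>
      have "exp (- \<i> * complex_of_real (\<zeta> \<bullet> (z + h)))
          = exp (- \<i> * complex_of_real (\<zeta> \<bullet> z)) * exp (\<i> * complex_of_real (- (\<zeta> \<bullet> h)))"
        unfolding exp_add[symmetric] by (simp add: inner_add_right distrib_left)
      then show "?r \<zeta> = exp (- \<i> * complex_of_real (\<zeta> \<bullet> (z + h))) * \<phi> \<zeta> - exp (- \<i> * complex_of_real (\<zeta> \<bullet> z)) * \<phi> \<zeta>
          - exp (- \<i> * complex_of_real (\<zeta> \<bullet> z)) * (- \<i> * complex_of_real (\<zeta> \<bullet> h) * \<phi> \<zeta>)"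
        by (simp only: of_real_minus) (simp add: algebra_simps)
    qed
    have ir: "integrable lborel ?r"
      unfolding eq by (intro Bochner_Integration.integrable_diff i0 i1)
    have "fourier \<phi> (z + h) - fourier \<phi> z - ?D h = (\<integral>\<zeta>. ?r \<zeta> \<partial>lborel)"
      unfolding eq fourier_def
      by (simp only: Bochner_Integration.integral_diff[OF Bochner_Integration.integrable_diff[OF i0 i0] i1]
          Bochner_Integration.integral_diff[OF i0 i0])
    then have "norm (fourier \<phi> (z + h) - fourier \<phi> z - ?D h) \<le> (\<integral>\<zeta>. norm (?r \<zeta>) \<partial>lborel)"
      by (simp only: integral_norm_bound)
    also have "\<dots> \<le> (\<integral>\<zeta>. (norm h)\<^sup>2 * norm (norm \<zeta> ^ 2 *\<^sub>R \<phi> \<zeta>) \<partial>lborel)"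
    proof (rule integral_mono)
      show "integrable lborel (\<lambda>\<zeta>. norm (?r \<zeta>))" by (rule integrable_norm[OF ir])
      show "integrable lborel (\<lambda>\<zeta>. (norm h)\<^sup>2 * norm (norm \<zeta> ^ 2 *\<^sub>R \<phi> \<zeta>))"
        by (intro integrable_mult_right integrable_norm schwartz_integrable_power \<phi>)
      fix \<zeta>
      have "norm (?r \<zeta>) \<le> (- (\<zeta> \<bullet> h))\<^sup>2 * norm (\<phi> \<zeta>)"
        using mult_right_mono[OF norm_iexp_remainder[of "- (\<zeta> \<bullet> h)"], of "norm (\<phi> \<zeta>)"] by (simp add: norm_mult)
      also have "\<dots> \<le> (norm \<zeta> * norm h)\<^sup>2 * norm (\<phi> \<zeta>)"
        using Cauchy_Schwarz_ineq[of \<zeta> h] by (intro mult_right_mono) (simp_all add: power2_eq_square dot_square_norm mult_ac)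
      finally show "norm (?r \<zeta>) \<le> (norm h)\<^sup>2 * norm (norm \<zeta> ^ 2 *\<^sub>R \<phi> \<zeta>)"
        by (simp add: power_mult_distrib mult_ac)
    qed
    also have "\<dots> = (norm h)\<^sup>2 * M" unfolding M_def by (rule integral_mult_right_zero)
    also have "\<dots> = M * norm h * norm h" by (simp add: power2_eq_square)
    finally show ?thesis .
  qed
  have "((\<lambda>h. norm (fourier \<phi> (z + h) - fourier \<phi> z - ?D h) / norm h) \<longlongrightarrow> 0) (at 0)"
  proof (rule tendsto_sandwich[where f = "\<lambda>_. 0" and h = "\<lambda>h. M * norm h"])
    show "\<forall>\<^sub>F h in at 0. norm (fourier \<phi> (z + h) - fourier \<phi> z - ?D h) / norm h \<le> M * norm h"
    proof (rule always_eventually, rule allI)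
      show "norm (fourier \<phi> (z + h) - fourier \<phi> z - ?D h) / norm h \<le> M * norm h" for h
        using rem[of h] by (cases "h = 0") (simp_all only: norm_zero div_by_0 mult_zero_right order_refl 
            pos_divide_le_eq zero_less_norm_iff not_False_eq_True)
    qed
    have "((\<lambda>h::R3. M * norm h) \<longlongrightarrow> M * norm (0::R3)) (at 0)" by (intro tendsto_intros)
    then show "((\<lambda>h::R3. M * norm h) \<longlongrightarrow> 0) (at 0)" by simp
    show "((\<lambda>h::R3. 0) \<longlongrightarrow> (0::real)) (at 0)" by (rule tendsto_const)
    show "\<forall>\<^sub>F h in at 0. 0 \<le> norm (fourier \<phi> (z + h) - fourier \<phi> z - ?D h) / norm h"
      by (rule always_eventually, rule allI, rule divide_nonneg_nonneg, (rule norm_ge_zero)+)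
  qed
  then show ?thesis by (rule has_derivative_at[THEN iffD2, OF conjI, OF bl])
qed

lemma frechet_derivative_fourier:
  assumes "\<phi> \<in> schwartz"
  shows "frechet_derivative (fourier \<phi>) (at z) h = fourier (\<lambda>\<zeta>. - \<i> * complex_of_real (\<zeta> \<bullet> h) * \<phi> \<zeta>) z"
  by (rule sym[OF fun_cong[OF frechet_derivative_at[OF has_derivative_fourier[OF assms]], of h]])

lemma tempered_fun_bounded:
  assumes "f \<in> borel_measurable borel" "\<And>z. norm (f z) \<le> B"
  shows "tempered_fun f"
  unfolding tempered_fun_def
proof (intro conjI ballI)
  fix \<phi> assume "\<phi> \<in> schwartz"
  then have "integrable lborel \<phi>" by (rule schwartz_integrable)
  moreover have "f \<in> borel_measurable lborel" using assms(1) by simp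
  ultimately show "integrable lborel (\<lambda>z. f z * \<phi> z)"
    using assms(2) by (rule integrable_bounded_mult)
qed (rule assms(1))

lemma has_fourier_fun_dist_of:
  assumes "integrable lborel u"
  shows "has_fourier_fun (dist_of u) (fourier u)"
  unfolding has_fourier_fun_def
proof (intro conjI ballI)
  show "tempered_fun (fourier u)"
    using borel_measurable_integrable[OF assms]
    by (intro tempered_fun_bounded[OF fourier_measurable norm_fourier_le[OF assms]]) simp
  fix \<phi> assume "\<phi> \<in> schwartz"
  then show "dist_of u (fourier \<phi>) = dist_of (fourier u) \<phi>"
    unfolding dist_of_def by (rule fourier_multiplication_formula[OF assms schwartz_integrable])
qed

text \<open>The derivative falls on \<open>fourier \<phi>\<close> and brings down -\<i> \<xi>; the
  multiplication formula then moves the transform over to u. That formula asks only for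
  integrability of \<xi> \<phi>, which the decay of \<phi> supplies.\<close>

lemma has_fourier_fun_dist_dx:
  assumes u: "integrable lborel u"
  shows "has_fourier_fun (dist_dx (dist_of u)) (\<lambda>\<zeta>. \<i> * complex_of_real (fst \<zeta>) * fourier u \<zeta>)"
  unfolding has_fourier_fun_def tempered_fun_def
proof (intro conjI ballI)
  define e :: R3 where "e = (1, 0, 0)"
  have e: "\<zeta> \<bullet> e = fst \<zeta>" for \<zeta> by (cases \<zeta>) (simp add: e_def)
  have u': "fourier u \<in> borel_measurable borel"
    by (rule fourier_measurable) (use u in auto)
  show "(\<lambda>\<zeta>. \<i> * complex_of_real (fst \<zeta>) * fourier u \<zeta>) \<in> borel_measurable borel"
    by (intro borel_measurable_times u' borel_measurable_continuous_onI continuous_intros)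
  fix \<phi> assume \<phi>: "\<phi> \<in> schwartz"
  have i: "integrable lborel (\<lambda>\<zeta>. - \<i> * complex_of_real (\<zeta> \<bullet> e) * \<phi> \<zeta>)"
    using integrable_mult_right[OF schwartz_integrable_inner[OF \<phi>, of e], of "-\<i>"]
    by (simp only: mult.assoc)
  have eq: "- (fourier u \<zeta> * (- \<i> * complex_of_real (\<zeta> \<bullet> e) * \<phi> \<zeta>)) = \<i> * complex_of_real (fst \<zeta>) * fourier u \<zeta> * \<phi> \<zeta>" for \<zeta>
    unfolding e by (simp add: mult_ac)
  have "integrable lborel (\<lambda>\<zeta>. fourier u \<zeta> * (- \<i> * complex_of_real (\<zeta> \<bullet> e) * \<phi> \<zeta>))"
    by (rule integrable_bounded_mult[OF i _ norm_fourier_le[OF u]]) (use u' in simp)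
  from integrable_minus[OF this]
  show "integrable lborel (\<lambda>\<zeta>. \<i> * complex_of_real (fst \<zeta>) * fourier u \<zeta> * \<phi> \<zeta>)"
    unfolding eq .
  have "dist_dx (dist_of u) (fourier \<phi>) = - (\<integral>z. u z * fourier (\<lambda>\<zeta>. - \<i> * complex_of_real (\<zeta> \<bullet> e) * \<phi> \<zeta>) z \<partial>lborel)"
    unfolding dist_dx_def dist_of_def frechet_derivative_fourier[OF \<phi>] e_def ..
  also have "\<dots> = (\<integral>\<zeta>. - (fourier u \<zeta> * (- \<i> * complex_of_real (\<zeta> \<bullet> e) * \<phi> \<zeta>)) \<partial>lborel)"
    unfolding fourier_multiplication_formula[OF u i] by (rule integral_minus[symmetric])
  also have "\<dots> = dist_of (\<lambda>\<zeta>. \<i> * complex_of_real (fst \<zeta>) * fourier u \<zeta>) \<phi>"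
    unfolding dist_of_def eq ..
  finally show "dist_dx (dist_of u) (fourier \<phi>) = dist_of (\<lambda>\<zeta>. \<i> * complex_of_real (fst \<zeta>) * fourier u \<zeta>) \<phi>" .
qed

section \<open>Gaussians with polynomial factors as Schwartz functions\<close>

definition poly_gauss :: "real \<Rightarrow> real \<Rightarrow> real poly \<Rightarrow> real \<Rightarrow> real" where
  "poly_gauss \<alpha> \<beta> P x = poly P x * exp (\<beta> * x - \<alpha> * x\<^sup>2)"

text \<open>The class is closed under differentiation, which is why polynomial factors are carried
  along. The linear term \<beta> x in the exponent yields all translated Gaussians, up to constants,
  without a separate translation argument.\<close>

lemma DERIV_poly_gauss:
  "(poly_gauss \<alpha> \<beta> P has_real_derivative poly_gauss \<alpha> \<beta> (pderiv P + P * [:\<beta>, - 2 * \<alpha>:]) x) (at x)"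
  unfolding poly_gauss_def
  by (rule derivative_eq_intros refl | simp)+ (simp add: algebra_simps)

lemma poly_abs_le_power:
  fixes P :: "real poly"
  shows "\<exists>C\<ge>0. \<exists>m. \<forall>x. \<bar>poly P x\<bar> \<le> C * (1 + \<bar>x\<bar>) ^ m"
proof (induction P)
  case 0
  then show ?case by (auto intro!: exI[of _ 0])
next
  case (pCons a P)
  then obtain C m where C: "C \<ge> 0" "\<And>x. \<bar>poly P x\<bar> \<le> C * (1 + \<bar>x\<bar>) ^ m" by blast
  show ?case
  proof (intro exI[of _ "\<bar>a\<bar> + C"] conjI exI[of _ "Suc m"] allI)
    fix x :: real
    have "\<bar>poly (pCons a P) x\<bar> \<le> \<bar>a\<bar> + \<bar>x\<bar> * \<bar>poly P x\<bar>"
      using abs_triangle_ineq[of a "x * poly P x"] by (simp add: abs_mult)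
    also have "\<dots> \<le> \<bar>a\<bar> * (1 + \<bar>x\<bar>) ^ Suc m + (1 + \<bar>x\<bar>) * (C * (1 + \<bar>x\<bar>) ^ m)"
    proof (intro add_mono)
      show "\<bar>a\<bar> \<le> \<bar>a\<bar> * (1 + \<bar>x\<bar>) ^ Suc m"
        using mult_left_mono[OF one_le_power[of "1 + \<bar>x\<bar>" "Suc m"], of "\<bar>a\<bar>"] by simp
      show "\<bar>x\<bar> * \<bar>poly P x\<bar> \<le> (1 + \<bar>x\<bar>) * (C * (1 + \<bar>x\<bar>) ^ m)"
        using C(2)[of x] by (intro mult_mono) auto
    qed
    also have "\<dots> = (\<bar>a\<bar> + C) * (1 + \<bar>x\<bar>) ^ Suc m" by (simp add: algebra_simps)
    finally show "\<bar>poly (pCons a P) x\<bar> \<le> (\<bar>a\<bar> + C) * (1 + \<bar>x\<bar>) ^ Suc m" .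
  qed (use C in simp)
qed

lemma power_le_const_mult_exp:
  fixes y :: real
  assumes "y \<ge> 0"
  shows "y ^ n \<le> real n ^ n * exp y"
proof (cases "n = 0")
  case False
  have "y / n \<le> exp (y / n)" using exp_ge_add_one_self[of "y / n"] by linarith
  then have "(y / n) ^ n \<le> exp (y / n) ^ n" using assms by (intro power_mono) auto
  then show ?thesis using False by (simp add: power_divide divide_simps mult_ac flip: exp_of_nat_mult)
qed (use assms in simp)

lemma poly_gauss_bounded:
  assumes "\<alpha> > 0"
  shows "\<exists>C\<ge>0. \<forall>x. (1 + \<bar>x\<bar>) ^ k * \<bar>poly_gauss \<alpha> \<beta> P x\<bar> \<le> C"
proof -
  obtain C m where C: "C \<ge> 0" "\<And>x. \<bar>poly P x\<bar> \<le> C * (1 + \<bar>x\<bar>) ^ m"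
    using poly_abs_le_power by blast
  let ?n = "k + m" and ?B = "1 + (1 + \<bar>\<beta>\<bar>)\<^sup>2 / (4 * \<alpha>)"
  have "(1 + \<bar>x\<bar>) ^ k * \<bar>poly_gauss \<alpha> \<beta> P x\<bar> \<le> C * real ?n ^ ?n * exp ?B" for x
  proof -
    have "(1 + \<bar>x\<bar>) ^ k * \<bar>poly_gauss \<alpha> \<beta> P x\<bar>
        = (1 + \<bar>x\<bar>) ^ k * \<bar>poly P x\<bar> * exp (\<beta> * x - \<alpha> * x\<^sup>2)"
      by (simp add: poly_gauss_def abs_mult)
    also have "\<dots> \<le> (1 + \<bar>x\<bar>) ^ k * (C * (1 + \<bar>x\<bar>) ^ m) * exp (\<beta> * x - \<alpha> * x\<^sup>2)"
      by (intro mult_right_mono mult_left_mono C) auto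
    also have "\<dots> = C * (1 + \<bar>x\<bar>) ^ ?n * exp (\<beta> * x - \<alpha> * x\<^sup>2)"
      by (simp add: power_add mult_ac)
    also have "\<dots> \<le> C * (real ?n ^ ?n * exp (1 + \<bar>x\<bar>)) * exp (\<beta> * x - \<alpha> * x\<^sup>2)"
      by (intro mult_right_mono mult_left_mono C power_le_const_mult_exp) auto
    also have "\<dots> = C * real ?n ^ ?n * exp (1 + \<bar>x\<bar> + (\<beta> * x - \<alpha> * x\<^sup>2))"
      by (simp only: exp_add mult_ac)
    also have "\<dots> \<le> C * real ?n ^ ?n * exp ?B"
    proof (intro mult_left_mono)
      \<comment> \<open>Completing the square in |x|. The 1 in 1 + |\<beta>| comes from the factor
        exp(1 + |x|) that has absorbed all powers of 1 + |x|.\<close>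
      have "4 * \<alpha> * ((1 + \<bar>\<beta>\<bar>) * \<bar>x\<bar> - \<alpha> * x\<^sup>2) = (1 + \<bar>\<beta>\<bar>)\<^sup>2 - (2 * \<alpha> * \<bar>x\<bar> - (1 + \<bar>\<beta>\<bar>))\<^sup>2"
        by (simp add: power2_eq_square algebra_simps)
      also have "\<dots> \<le> (1 + \<bar>\<beta>\<bar>)\<^sup>2" by simp
      finally have "(1 + \<bar>\<beta>\<bar>) * \<bar>x\<bar> - \<alpha> * x\<^sup>2 \<le> (1 + \<bar>\<beta>\<bar>)\<^sup>2 / (4 * \<alpha>)"
        using assms by (simp add: pos_le_divide_eq mult_ac)
      moreover have "\<beta> * x \<le> \<bar>\<beta>\<bar> * \<bar>x\<bar>" by (simp flip: abs_mult)
      ultimately show "exp (1 + \<bar>x\<bar> + (\<beta> * x - \<alpha> * x\<^sup>2)) \<le> exp ?B"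
        by (simp add: algebra_simps)
    qed (use C in auto)
    finally show ?thesis .
  qed
  then show ?thesis using C(1) by (intro exI[of _ "C * real ?n ^ ?n * exp ?B"]) auto
qed

definition poly_gauss3 :: "real \<Rightarrow> R3 \<Rightarrow> real poly \<times> real poly \<times> real poly \<Rightarrow> R3 \<Rightarrow> complex" where
  "poly_gauss3 \<alpha> = (\<lambda>(a, b, c) (P, Q, R) (x, y, t).
     complex_of_real (poly_gauss \<alpha> a P x * poly_gauss \<alpha> b Q y * poly_gauss \<alpha> c R t))"

lemma has_derivative_poly_gauss3:
  assumes "f = poly_gauss3 \<alpha> (a, b, c) (P, Q, R)"
  shows "(f has_derivative (\<lambda>h.
      fst h *\<^sub>R poly_gauss3 \<alpha> (a, b, c) (pderiv P + P * [:a, - 2 * \<alpha>:], Q, R) z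
    + fst (snd h) *\<^sub>R poly_gauss3 \<alpha> (a, b, c) (P, pderiv Q + Q * [:b, - 2 * \<alpha>:], R) z
    + snd (snd h) *\<^sub>R poly_gauss3 \<alpha> (a, b, c) (P, Q, pderiv R + R * [:c, - 2 * \<alpha>:]) z)) (at z)"
proof -
  note D = DERIV_poly_gauss[unfolded has_field_derivative_def]
  note sel = has_derivative_ident[THEN has_derivative_fst] has_derivative_ident[THEN has_derivative_snd, THEN has_derivative_fst]
     has_derivative_ident[THEN has_derivative_snd, THEN has_derivative_snd]
  note d = has_derivative_compose[OF sel(1) D] has_derivative_compose[OF sel(2) D] has_derivative_compose[OF sel(3) D]
  have f: "f = (\<lambda>z. complex_of_real (poly_gauss \<alpha> a P (fst z) * poly_gauss \<alpha> b Q (fst (snd z)) * poly_gauss \<alpha> c R (snd (snd z))))"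
    unfolding assms by (auto simp: poly_gauss3_def fun_eq_iff)
  show ?thesis unfolding f
    apply (rule has_derivative_eq_rhs)
     apply (rule bounded_linear.has_derivative[OF bounded_linear_of_real has_derivative_mult[OF has_derivative_mult[OF d(1) d(2)] d(3)]])
    apply (rule ext)
    apply (cases z)
    apply (simp add: poly_gauss3_def scaleR_conv_of_real algebra_simps)
    done
qed

lemma poly_gauss3_decay:
  assumes "\<alpha> > 0"
  shows "\<exists>C. \<forall>z. norm z ^ k * norm (poly_gauss3 \<alpha> (a, b, c) (P, Q, R) z) \<le> C"
proof -
  obtain A where A: "A \<ge> 0" "\<And>x. (1 + \<bar>x\<bar>) ^ k * \<bar>poly_gauss \<alpha> a P x\<bar> \<le> A"
    using poly_gauss_bounded[OF assms] by blast
  obtain B where B: "B \<ge> 0" "\<And>x. (1 + \<bar>x\<bar>) ^ k * \<bar>poly_gauss \<alpha> b Q x\<bar> \<le> B"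
    using poly_gauss_bounded[OF assms] by blast
  obtain D where D: "D \<ge> 0" "\<And>x. (1 + \<bar>x\<bar>) ^ k * \<bar>poly_gauss \<alpha> c R x\<bar> \<le> D"
    using poly_gauss_bounded[OF assms] by blast
  have "norm z ^ k * norm (poly_gauss3 \<alpha> (a, b, c) (P, Q, R) z) \<le> A * B * D" for z
  proof -
    obtain x y t where z: "z = (x, y, t)" by (cases z)
    have "norm z \<le> \<bar>x\<bar> + norm (y, t)" using norm_Pair_le[of x "(y, t)"] by (simp add: z)
    also have "norm (y, t) \<le> \<bar>y\<bar> + \<bar>t\<bar>" using norm_Pair_le[of y t] by simp
    finally have "norm z \<le> \<bar>x\<bar> + \<bar>y\<bar> + \<bar>t\<bar>" by simp
    also have "\<dots> \<le> (1 + \<bar>x\<bar>) * (1 + \<bar>y\<bar>) * (1 + \<bar>t\<bar>)"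
      by (simp add: algebra_simps)
    finally have "norm z ^ k \<le> ((1 + \<bar>x\<bar>) * (1 + \<bar>y\<bar>) * (1 + \<bar>t\<bar>)) ^ k"
      by (intro power_mono) auto
    then have "norm z ^ k * norm (poly_gauss3 \<alpha> (a, b, c) (P, Q, R) z)
        \<le> ((1 + \<bar>x\<bar>) * (1 + \<bar>y\<bar>) * (1 + \<bar>t\<bar>)) ^ k * norm (poly_gauss3 \<alpha> (a, b, c) (P, Q, R) z)"
      by (rule mult_right_mono) simp
    also have "\<dots> = (1 + \<bar>x\<bar>) ^ k * \<bar>poly_gauss \<alpha> a P x\<bar> * ((1 + \<bar>y\<bar>) ^ k * \<bar>poly_gauss \<alpha> b Q y\<bar>)
        * ((1 + \<bar>t\<bar>) ^ k * \<bar>poly_gauss \<alpha> c R t\<bar>)"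
      by (simp add: z poly_gauss3_def norm_mult power_mult_distrib mult_ac)
    also have "\<dots> \<le> A * B * D" by (intro mult_mono A B D) (use A B D in auto)
    finally show ?thesis .
  qed
  then show ?thesis by blast
qed

lemma poly_gauss3_schwartz:
  assumes "\<alpha> > 0"
  shows "poly_gauss3 \<alpha> \<beta> p \<in> schwartz"
proof -
  obtain a b c where \<beta>: "\<beta> = (a, b, c)" by (cases \<beta>)
  have part: "\<exists>P Q R. partials bs (poly_gauss3 \<alpha> \<beta> p) = poly_gauss3 \<alpha> (a, b, c) (P, Q, R)"
    if "set bs \<subseteq> Basis" for bs
    using that
  proof (induction bs)
    case Nil
    then show ?case by (cases p) (auto simp: partials_def \<beta>)
  next
    case (Cons d bs)
    then obtain P Q R where f: "partials bs (poly_gauss3 \<alpha> \<beta> p) = poly_gauss3 \<alpha> (a, b, c) (P, Q, R)"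
      by auto
    have "partials (d # bs) (poly_gauss3 \<alpha> \<beta> p) = (\<lambda>z. frechet_derivative (partials bs (poly_gauss3 \<alpha> \<beta> p)) (at z) d)"
      by (simp add: partials_def)
    also have "\<dots> = (\<lambda>z. fst d *\<^sub>R poly_gauss3 \<alpha> (a, b, c) (pderiv P + P * [:a, - 2 * \<alpha>:], Q, R) z
      + fst (snd d) *\<^sub>R poly_gauss3 \<alpha> (a, b, c) (P, pderiv Q + Q * [:b, - 2 * \<alpha>:], R) z
      + snd (snd d) *\<^sub>R poly_gauss3 \<alpha> (a, b, c) (P, Q, pderiv R + R * [:c, - 2 * \<alpha>:]) z)"
      by (rule ext) (rule sym[OF fun_cong[OF frechet_derivative_at[OF has_derivative_poly_gauss3[OF f]]]])
    finally have eq: "partials (d # bs) (poly_gauss3 \<alpha> \<beta> p) = \<dots>" .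
    \<comment> \<open>A basis vector keeps exactly one of the three summands, so the partial
      derivative is a single member of the class and the induction hypothesis can stay free of
      sums.\<close>
    have "d = (1, 0, 0) \<or> d = (0, 1, 0) \<or> d = (0, 0, 1)"
      using Cons.prems by (auto simp: Basis_prod_def zero_prod_def)
    then show ?case unfolding eq by (elim disjE) (simp_all, blast+)
  qed
  show ?thesis unfolding schwartz_def
  proof (intro CollectI allI impI conjI)
    fix bs z assume "set bs \<subseteq> (Basis :: R3 set)"
    then obtain P Q R where f: "partials bs (poly_gauss3 \<alpha> \<beta> p) = poly_gauss3 \<alpha> (a, b, c) (P, Q, R)"
      using part by blast
    show "partials bs (poly_gauss3 \<alpha> \<beta> p) differentiable (at z)"
      using has_derivative_poly_gauss3[OF f] unfolding differentiable_def by blast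
  next
    fix bs and k :: nat assume "set bs \<subseteq> (Basis :: R3 set)"
    then obtain P Q R where f: "partials bs (poly_gauss3 \<alpha> \<beta> p) = poly_gauss3 \<alpha> (a, b, c) (P, Q, R)"
      using part by blast
    obtain C where "\<And>z. norm z ^ k * norm (poly_gauss3 \<alpha> (a, b, c) (P, Q, R) z) \<le> C"
      using poly_gauss3_decay[OF assms] by blast
    then show "bounded (range (\<lambda>z. norm z ^ k *\<^sub>R partials bs (poly_gauss3 \<alpha> \<beta> p) z))"
      unfolding f bounded_iff by (auto intro!: exI[of _ C])
  qed
qed

lemma exp_norm_square_schwartz:
  fixes p :: R3
  assumes "\<alpha> > 0"
  shows "(\<lambda>z. complex_of_real (exp (- \<alpha> * (norm z)\<^sup>2 + z \<bullet> p))) \<in> schwartz"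
proof -
  have "(\<lambda>z. complex_of_real (exp (- \<alpha> * (norm z)\<^sup>2 + z \<bullet> p))) = poly_gauss3 \<alpha> p (1, 1, 1)"
    by (cases p) (auto simp: fun_eq_iff poly_gauss3_def poly_gauss_def norm_Pair algebra_simps
        simp flip: of_real_mult exp_add)
  then show ?thesis using poly_gauss3_schwartz[OF assms] by simp
qed

section \<open>Uniqueness of the Fourier transform of a distribution\<close>

lemma lborel_integral_affine:
  fixes f :: "'a::euclidean_space \<Rightarrow> 'b::{banach, second_countable_topology}"
  assumes [measurable]: "f \<in> borel_measurable borel" and "c \<noteq> 0"
  shows "(\<integral>x. f x \<partial>lborel) = \<bar>c\<bar> ^ DIM('a) *\<^sub>R (\<integral>x. f (t + c *\<^sub>R x) \<partial>lborel)"
  by (subst lborel_affine[OF \<open>c \<noteq> 0\<close>, of t]) (simp add: integral_density integral_distr)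

definition gauss3 :: "R3 \<Rightarrow> real" where
  "gauss3 s = exp (- (norm s)\<^sup>2)"

lemma gauss3_measurable [measurable]: "gauss3 \<in> borel_measurable borel"
  unfolding gauss3_def[abs_def] by measurable

lemma gauss3_integrable: "integrable lborel gauss3"
proof -
  have "integrable lborel (\<lambda>s. Re (complex_of_real (exp (- 1 * (norm s)\<^sup>2 + s \<bullet> (0::R3)))))"
    by (intro integrable_Re schwartz_integrable exp_norm_square_schwartz) simp
  then show ?thesis by (simp add: gauss3_def[abs_def])
qed

lemma integral_gauss3_pos: "(\<integral>s. gauss3 s \<partial>lborel) > 0"
proof -
  have "(\<integral>s. gauss3 s \<partial>lborel) \<noteq> 0"
    by (subst integral_nonneg_eq_0_iff_AE[OF gauss3_integrable])
       (auto simp: gauss3_def eventually_False ae_filter_eq_bot_iff)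
  moreover have "(\<integral>s. gauss3 s \<partial>lborel) \<ge> 0" by (simp add: gauss3_def)
  ultimately show ?thesis by simp
qed

text \<open>Averaging \<open>k\<close> against the Gaussian of width \<open>1 / n\<close> turns the hypothesis into
  \<open>\<integral> H * (k * G\<^sub>n) = 0\<close> by Fubini; then let \<open>n\<close> tend to infinity.\<close>

lemma integral_eq_0_if_gauss3_integrals_eq_0:
  assumes H: "integrable lborel (H :: R3 \<Rightarrow> complex)"
    and zero: "\<And>c p. c > 0 \<Longrightarrow> (\<integral>z. H z * complex_of_real (gauss3 (c *\<^sub>R (z - p))) \<partial>lborel) = 0"
    and k: "continuous_on UNIV k" "\<And>z. 0 \<le> k z" "\<And>z. k z \<le> (1::real)"
  shows "(\<integral>z. H z * complex_of_real (k z) \<partial>lborel) = 0"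
proof -
  have [measurable]: "H \<in> borel_measurable borel" using H by auto
  have km[measurable]: "k \<in> borel_measurable borel" by (rule borel_measurable_continuous_onI[OF k(1)])
  define A where "A n z = (\<integral>s. k (z - inverse (real (Suc n)) *\<^sub>R s) * gauss3 s \<partial>lborel)" for n z
  have kg_int: "integrable lborel (\<lambda>s. k (z - c *\<^sub>R s) * gauss3 s)" for z c
    by (rule Bochner_Integration.integrable_bound[OF gauss3_integrable])
       (use k in \<open>auto simp: abs_mult gauss3_def intro!: mult_left_le_one_le\<close>)
  have A_bound: "\<bar>A n z\<bar> \<le> (\<integral>s. gauss3 s \<partial>lborel)" for n z
  proof -
    have "A n z \<le> (\<integral>s. gauss3 s \<partial>lborel)" unfolding A_def
      by (intro integral_mono kg_int gauss3_integrable) (use k in \<open>auto simp: gauss3_def intro!: mult_left_le_one_le\<close>)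
    moreover have "A n z \<ge> 0" unfolding A_def using k by (intro Bochner_Integration.integral_nonneg) (simp add: gauss3_def)
    ultimately show ?thesis by simp
  qed
  have A_meas[measurable]: "A n \<in> borel_measurable borel" for n
    unfolding A_def[abs_def] by (rule lborel.borel_measurable_lebesgue_integral) simp
  have A_lim: "(\<lambda>n. A n z) \<longlonglongrightarrow> k z * (\<integral>s. gauss3 s \<partial>lborel)" for z
    unfolding A_def integral_mult_right_zero[symmetric]
  proof (rule integral_dominated_convergence[OF _ _ gauss3_integrable])
    show "AE s in lborel. (\<lambda>n. k (z - inverse (real (Suc n)) *\<^sub>R s) * gauss3 s) \<longlonglongrightarrow> k z * gauss3 s"
    proof (rule AE_I2, rule tendsto_mult_right)
      fix s
      have "(\<lambda>n. z - inverse (real (Suc n)) *\<^sub>R s) \<longlonglongrightarrow> z - 0 *\<^sub>R s"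
        by (intro tendsto_intros LIMSEQ_inverse_real_of_nat)
      then show "(\<lambda>n. k (z - inverse (real (Suc n)) *\<^sub>R s)) \<longlonglongrightarrow> k z"
        using continuous_on_tendsto_compose[OF k(1)] by simp
    qed
    show "AE s in lborel. norm (k (z - inverse (real (Suc n)) *\<^sub>R s) * gauss3 s) \<le> gauss3 s" for n
      using k by (intro AE_I2) (auto simp: abs_mult gauss3_def intro!: mult_left_le_one_le)
  qed simp_all
  have HA: "(\<integral>z. H z * complex_of_real (A n z) \<partial>lborel) = 0" for n
  proof -
    define c where "c = real (Suc n)"
    have c: "c > 0" by (simp add: c_def)
    have sub: "A n z = c ^ 3 * (\<integral>p. k p * gauss3 (c *\<^sub>R (z - p)) \<partial>lborel)" for z
    proof -
      have "A n z = (\<integral>s. k (z - inverse c *\<^sub>R s) * gauss3 s \<partial>lborel)" by (simp add: A_def c_def)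
      also have "\<dots> = \<bar>- c\<bar> ^ DIM(R3) *\<^sub>R (\<integral>p. k (z - inverse c *\<^sub>R (c *\<^sub>R z + (- c) *\<^sub>R p)) * gauss3 (c *\<^sub>R z + (- c) *\<^sub>R p) \<partial>lborel)"
        by (rule lborel_integral_affine) (use c in simp_all)
      also have "\<dots> = c ^ 3 * (\<integral>p. k p * gauss3 (c *\<^sub>R (z - p)) \<partial>lborel)"
        using c by (simp add: scaleR_right_diff_distrib power3_eq_cube)
      finally show ?thesis .
    qed
    have int_p: "integrable lborel (\<lambda>p. k p * gauss3 (c *\<^sub>R (z - p)))" for z
    proof (rule Bochner_Integration.integrable_bound)
      \<comment> \<open>In the variable p the translated Gaussian is, up to the constant exp(-c^2
        |z|^2), a Gaussian with a linear term in the exponent, and those are known to be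
        Schwartz.\<close>
      have "integrable lborel (\<lambda>s. Re (complex_of_real (exp (- c\<^sup>2 * (norm s)\<^sup>2 + s \<bullet> ((2 * c\<^sup>2) *\<^sub>R z)))) * exp (- c\<^sup>2 * (norm z)\<^sup>2))"
        by (intro integrable_mult_left integrable_Re schwartz_integrable exp_norm_square_schwartz) (use c in simp)
      also have "(\<lambda>s. Re (complex_of_real (exp (- c\<^sup>2 * (norm s)\<^sup>2 + s \<bullet> ((2 * c\<^sup>2) *\<^sub>R z)))) * exp (- c\<^sup>2 * (norm z)\<^sup>2))
         = (\<lambda>p. gauss3 (c *\<^sub>R (z - p)))"
        unfolding gauss3_def fun_eq_iff Re_complex_of_real exp_add[symmetric]
        by (auto simp: power_mult_distrib power2_norm_eq_inner inner_diff_left inner_diff_right algebra_simps inner_commute power2_eq_square[of c])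
      finally show "integrable lborel (\<lambda>p. gauss3 (c *\<^sub>R (z - p)))" .
      show "AE p in lborel. norm (k p * gauss3 (c *\<^sub>R (z - p))) \<le> norm (gauss3 (c *\<^sub>R (z - p)))"
        using k by (intro AE_I2) (auto simp: abs_mult gauss3_def intro!: mult_left_le_one_le)
    qed simp
    let ?F = "\<lambda>z p. H z * complex_of_real (k p * gauss3 (c *\<^sub>R (z - p)))"
    have meas: "case_prod ?F \<in> borel_measurable (lborel \<Otimes>\<^sub>M lborel)"
    proof -
      have "(\<lambda>w. H (fst w) * complex_of_real (k (snd w) * gauss3 (c *\<^sub>R (fst w - snd w)))) \<in> borel_measurable (borel \<Otimes>\<^sub>M borel)"
        by measurable
      then show ?thesis by (simp add: case_prod_unfold lborel_prod borel_prod)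
    qed
    have F_int: "integrable (lborel \<Otimes>\<^sub>M lborel) (case_prod ?F)"
    proof (rule lborel_pair.Fubini_integrable[OF meas])
      have "(\<lambda>z. \<integral>p. norm (case (z, p) of (z, p) \<Rightarrow> ?F z p) \<partial>lborel) = (\<lambda>z. norm (H z) * (A n z / c ^ 3))"
        using c k by (auto simp: fun_eq_iff norm_mult abs_mult sub gauss3_def)
      moreover have "integrable lborel (\<lambda>z. norm (H z) * (A n z / c ^ 3))"
      proof (rule Bochner_Integration.integrable_bound)
        show "integrable lborel (\<lambda>z. norm (H z) * ((\<integral>s. gauss3 s \<partial>lborel) / c ^ 3))"
          by (intro integrable_mult_left integrable_norm H)
        show "AE z in lborel. norm (norm (H z) * (A n z / c ^ 3)) \<le> norm (norm (H z) * ((\<integral>s. gauss3 s \<partial>lborel) / c ^ 3))"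
          using A_bound c integral_gauss3_pos
          by (intro AE_I2) (auto simp: abs_mult intro!: mult_left_mono divide_right_mono)
      qed simp
      ultimately show "integrable lborel (\<lambda>z. \<integral>p. norm (case (z, p) of (z, p) \<Rightarrow> ?F z p) \<partial>lborel)" by simp
      show "AE z in lborel. integrable lborel (\<lambda>p. case (z, p) of (z, p) \<Rightarrow> ?F z p)"
        using int_p by (intro AE_I2) (simp only: prod.case, intro integrable_mult_right integrable_of_real int_p)
    qed
    have "(\<integral>z. H z * complex_of_real (A n z) \<partial>lborel) = complex_of_real (c ^ 3) * (\<integral>z. \<integral>p. ?F z p \<partial>lborel \<partial>lborel)"
    proof -
      have "(\<integral>p. ?F z p \<partial>lborel) = H z * complex_of_real (\<integral>p. k p * gauss3 (c *\<^sub>R (z - p)) \<partial>lborel)" for z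
        by (simp only: integral_mult_right_zero integral_complex_of_real)
      then show ?thesis
        by (simp only: sub of_real_mult mult.left_commute[of "H _"] integral_mult_right_zero)
    qed
    also have "(\<integral>z. \<integral>p. ?F z p \<partial>lborel \<partial>lborel) = (\<integral>p. \<integral>z. ?F z p \<partial>lborel \<partial>lborel)"
      by (rule lborel_pair.Fubini_integral[OF F_int, symmetric])
    also have "\<dots> = (\<integral>p. complex_of_real (k p) * (\<integral>z. H z * complex_of_real (gauss3 (c *\<^sub>R (z - p))) \<partial>lborel) \<partial>lborel)"
      unfolding integral_mult_right_zero[symmetric]
      by (intro Bochner_Integration.integral_cong refl) (simp add: mult_ac)
    also have "\<dots> = 0" by (simp only: zero[OF c] mult_zero_right Bochner_Integration.integral_zero)
    finally show ?thesis by simp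
  qed
  have "(\<lambda>n. \<integral>z. H z * complex_of_real (A n z) \<partial>lborel) \<longlonglongrightarrow> (\<integral>z. H z * complex_of_real (k z * (\<integral>s. gauss3 s \<partial>lborel)) \<partial>lborel)"
  proof (rule integral_dominated_convergence)
    show "integrable lborel (\<lambda>z. norm (H z) * (\<integral>s. gauss3 s \<partial>lborel))"
      by (intro integrable_mult_left integrable_norm H)
    show "AE z in lborel. (\<lambda>n. H z * complex_of_real (A n z)) \<longlonglongrightarrow> H z * complex_of_real (k z * (\<integral>s. gauss3 s \<partial>lborel))"
      by (intro AE_I2 tendsto_mult_left tendsto_of_real A_lim)
    show "AE z in lborel. norm (H z * complex_of_real (A n z)) \<le> norm (H z) * (\<integral>s. gauss3 s \<partial>lborel)" for n
      using A_bound by (intro AE_I2) (auto simp: norm_mult intro!: mult_left_mono)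
  qed simp_all
  then have "(\<integral>z. H z * complex_of_real (k z * (\<integral>s. gauss3 s \<partial>lborel)) \<partial>lborel) = 0"
    by (simp only: HA LIMSEQ_const_iff)
  also have "(\<lambda>z. H z * complex_of_real (k z * (\<integral>s. gauss3 s \<partial>lborel))) = (\<lambda>z. H z * complex_of_real (k z) * complex_of_real (\<integral>s. gauss3 s \<partial>lborel))"
    by (simp add: mult_ac)
  finally show ?thesis using integral_gauss3_pos by simp
qed

text \<open>Continuous functions with values in [0, 1] converge pointwise to the indicator of an
  open set, so H has integral 0 over every open set. Open sets are stable under intersection and
  generate the Borel sets, so a Dynkin argument gives integral 0 over every Borel set.\<close>

lemma AE_eq_0_if_gauss3_integrals_eq_0:
  assumes H: "integrable lborel (H :: R3 \<Rightarrow> complex)"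
    and zero: "\<And>c p. c > 0 \<Longrightarrow> (\<integral>z. H z * complex_of_real (gauss3 (c *\<^sub>R (z - p))) \<partial>lborel) = 0"
  shows "AE z in lborel. H z = 0"
proof (rule sigma_finite_measure.density_zero[OF sigma_finite_lborel H])
  have [measurable]: "H \<in> borel_measurable borel" using H by auto
  note k0 = integral_eq_0_if_gauss3_integrals_eq_0[OF H zero]
  have int: "set_integrable lborel A H" if "A \<in> sets borel" for A
    using integrable_mult_indicator[of A lborel H] that H by (simp add: set_integrable_def)
  have total: "(\<integral>z. H z \<partial>lborel) = 0" using k0[of "\<lambda>_. 1"] by simp
  have op: "(LINT z:U|lborel. H z) = 0" if U: "open U" for U
  \<comment> \<open>The whole space is separate because \<open>infdist\<close> to the empty set is 0
    by convention; the approximating functions below would then all vanish.\<close>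
  proof (cases "U = UNIV")
    case True
    then show ?thesis using total by (simp add: set_lebesgue_integral_def)
  next
    case False
    let ?k = "\<lambda>n z. min 1 (real n * infdist z (- U))"
    have "(\<lambda>n. \<integral>z. H z * complex_of_real (?k n z) \<partial>lborel) \<longlonglongrightarrow> (\<integral>z. H z * complex_of_real (indicator U z) \<partial>lborel)"
    proof (rule integral_dominated_convergence)
      show "integrable lborel (\<lambda>z. norm (H z))" by (intro integrable_norm H)
      show "AE z in lborel. (\<lambda>n. H z * complex_of_real (?k n z)) \<longlonglongrightarrow> H z * complex_of_real (indicator U z)"
      proof (intro AE_I2 tendsto_mult_left tendsto_of_real)
        fix z
        show "(\<lambda>n. ?k n z) \<longlonglongrightarrow> indicator U z"
        proof (cases "z \<in> U")
          case True
          then have d: "infdist z (- U) > 0"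
            using False U by (intro infdist_pos_not_in_closed) auto
          have "\<forall>\<^sub>F n in sequentially. ?k n z = 1"
          proof (rule eventually_sequentiallyI)
            fix n assume "n \<ge> nat \<lceil>1 / infdist z (- U)\<rceil>"
            then have "real n \<ge> 1 / infdist z (- U)" by linarith
            then show "?k n z = 1" using d by (simp add: field_simps min_def)
          qed
          then show ?thesis using True by (simp add: tendsto_eventually)
        next
          case False
          then show ?thesis by simp
        qed
      qed
      show "AE z in lborel. norm (H z * complex_of_real (?k n z)) \<le> norm (H z)" for n
        by (intro AE_I2) (auto simp: norm_mult infdist_nonneg abs_of_nonneg intro!: mult_right_le_one_le)
    next
      have "(\<lambda>z. H z * complex_of_real (?k n z)) \<in> borel_measurable borel" for n
        by (rule borel_measurable_times, use H in simp) (intro borel_measurable_continuous_onI continuous_intros)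
      then show "(\<lambda>z. H z * complex_of_real (?k n z)) \<in> borel_measurable lborel" for n by simp
      show "(\<lambda>z. H z * complex_of_real (indicator U z)) \<in> borel_measurable lborel"
        using U by simp
    qed
    moreover have "(\<integral>z. H z * complex_of_real (?k n z) \<partial>lborel) = 0" for n
      by (rule k0) (auto intro!: continuous_intros simp: infdist_nonneg)
    ultimately have "(\<lambda>n. 0) \<longlonglongrightarrow> (\<integral>z. H z * complex_of_real (indicator U z) \<partial>lborel)"
      by (simp only:)
    then have "(\<integral>z. H z * complex_of_real (indicator U z) \<partial>lborel) = 0"
      by (simp only: LIMSEQ_const_iff)
    then show ?thesis
      by (simp add: set_lebesgue_integral_def scaleR_conv_of_real mult.commute)
  qed
  fix A :: "R3 set" assume "A \<in> sets lborel"
  then have A: "A \<in> sigma_sets UNIV (Collect open)"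
    by (simp add: borel_def)
  have "Int_stable (Collect open :: R3 set set)" "Collect open \<subseteq> Pow (UNIV :: R3 set)"
    by (auto simp: Int_stable_def)
  from this A show "(LINT z:A|lborel. H z) = 0"
  proof (induction rule: sigma_sets_induct_disjoint)
    show "(LINT z:{}|lborel. H z) = 0" by (simp add: set_lebesgue_integral_def)
    show "(LINT z:A|lborel. H z) = 0" if "A \<in> Collect open" for A using op that by simp
  next
    fix A :: "R3 set" assume A: "A \<in> sigma_sets UNIV (Collect open)" "(LINT z:A|lborel. H z) = 0"
    then have b: "A \<in> sets borel" by (simp add: borel_def)
    have "(LINT z:UNIV|lborel. H z) = (LINT z:A|lborel. H z) + (LINT z:UNIV - A|lborel. H z)"
      by (subst set_integral_Un[symmetric]) (use b int in \<open>auto simp: Un_absorb1\<close>)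
    then show "(LINT z:UNIV - A|lborel. H z) = 0"
      using A(2) total by (simp add: set_lebesgue_integral_def)
  next
    fix A :: "nat \<Rightarrow> R3 set"
    assume A: "disjoint_family A" "range A \<subseteq> sigma_sets UNIV (Collect open)" "\<And>i. (LINT z:A i|lborel. H z) = 0"
    have b: "A i \<in> sets borel" for i using A(2) by (auto simp: borel_def)
    have "(LINT z:(\<Union>i. A i)|lborel. H z) = (\<Sum>i. (LINT z:A i|lborel. H z))"
      by (rule lebesgue_integral_countable_add) (use b A(1) int in \<open>auto simp: disjoint_family_on_def\<close>)
    then show "(LINT z:(\<Union>i. A i)|lborel. H z) = 0" using A(3) by simp
  qed
qed

text \<open>The difference h of two transforms is only known to be integrable against Schwartz
  functions. Multiplying it by one Gaussian gives an integrable H. A further factor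
  \<open>gauss3 (c *\<^sub>R (z - p))\<close> merges with that Gaussian into a single Schwartz
  function of the form treated above, against which h has integral 0.\<close>

lemma has_fourier_fun_unique:
  assumes "has_fourier_fun T g" "has_fourier_fun T g'"
  shows "AE z in lborel. g z = g' z"
proof -
  define h where "h z = g z - g' z" for z
  have ig: "integrable lborel (\<lambda>z. g z * \<phi> z)" "integrable lborel (\<lambda>z. g' z * \<phi> z)" if "\<phi> \<in> schwartz" for \<phi>
    using assms that by (auto simp: has_fourier_fun_def tempered_fun_def)
  have ih: "integrable lborel (\<lambda>z. h z * \<phi> z)" "(\<integral>z. h z * \<phi> z \<partial>lborel) = 0" if "\<phi> \<in> schwartz" for \<phi>
  proof -
    show "integrable lborel (\<lambda>z. h z * \<phi> z)"
      using Bochner_Integration.integrable_diff[OF ig[OF that]] by (simp add: h_def algebra_simps)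
    have "dist_of g \<phi> = dist_of g' \<phi>" using assms that by (auto simp: has_fourier_fun_def)
    then show "(\<integral>z. h z * \<phi> z \<partial>lborel) = 0"
      using Bochner_Integration.integral_diff[OF ig[OF that]] by (simp add: h_def algebra_simps dist_of_def)
  qed
  define H where "H z = h z * complex_of_real (exp (- 1 * (norm z)\<^sup>2 + z \<bullet> 0))" for z
  have "AE z in lborel. H z = 0"
  proof (rule AE_eq_0_if_gauss3_integrals_eq_0)
    show "integrable lborel H" unfolding H_def
      by (intro ih exp_norm_square_schwartz) simp
    fix c :: real and p :: R3 assume "c > 0"
    have "H z * complex_of_real (gauss3 (c *\<^sub>R (z - p)))
        = (h z * complex_of_real (exp (- (1 + c\<^sup>2) * (norm z)\<^sup>2 + z \<bullet> ((2 * c\<^sup>2) *\<^sub>R p)))) * complex_of_real (exp (- c\<^sup>2 * (norm p)\<^sup>2))" for z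
      unfolding gauss3_def H_def mult.assoc of_real_mult[symmetric] exp_add[symmetric]
      by (auto simp: power_mult_distrib power2_norm_eq_inner inner_diff_left inner_diff_right algebra_simps inner_commute power2_eq_square[of c])
    then show "(\<integral>z. H z * complex_of_real (gauss3 (c *\<^sub>R (z - p))) \<partial>lborel) = 0"
      using ih(2)[OF exp_norm_square_schwartz[of "1 + c\<^sup>2" "(2 * c\<^sup>2) *\<^sub>R p"]] by (simp add: add_pos_nonneg)
  qed
  then show ?thesis by (rule AE_mp) (simp add: H_def h_def)
qed

lemma X_norm_hat_cong_AE:
  assumes "AE z in lborel. g z = g' z"
  shows "X_norm_hat s b g = X_norm_hat s b g'"
proof -
  have "(\<integral>\<^sup>+ z. (case z of (\<xi>, \<mu>, \<tau>) \<Rightarrow> ennreal (F \<xi> \<mu> \<tau> * (cmod (g (\<xi>, \<mu>, \<tau>)))\<^sup>2)) \<partial>lborel)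
      = (\<integral>\<^sup>+ z. (case z of (\<xi>, \<mu>, \<tau>) \<Rightarrow> ennreal (F \<xi> \<mu> \<tau> * (cmod (g' (\<xi>, \<mu>, \<tau>)))\<^sup>2)) \<partial>lborel)"
    for F :: "real \<Rightarrow> real \<Rightarrow> real \<Rightarrow> real"
    by (rule nn_integral_cong_AE, rule AE_mp[OF assms]) auto
  then show ?thesis unfolding X_norm_hat_def by simp
qed

text \<open>The choice operator in \<open>X_norm\<close> picks an unknown transform. By uniqueness
  it agrees almost everywhere with any transform at hand, and the norm does not see null
  sets.\<close>

lemma X_norm_eq:
  assumes "has_fourier_fun T g"
  shows "X_norm s b T = X_norm_hat s b g"
proof -
  have "has_fourier_fun T (SOME g. has_fourier_fun T g)" using someI[of "has_fourier_fun T"] assms by blast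
  from X_norm_hat_cong_AE[OF has_fourier_fun_unique[OF this assms]] show ?thesis
    using assms by (auto simp: X_norm_def)
qed

section \<open>Fourier inversion on the line\<close>

definition ft :: "(real \<Rightarrow> complex) \<Rightarrow> real \<Rightarrow> complex" where
  "ft f \<tau> = (\<integral>t. exp (- \<i> * complex_of_real (t * \<tau>)) * f t \<partial>lborel)"

definition ift :: "(real \<Rightarrow> complex) \<Rightarrow> real \<Rightarrow> complex" where
  "ift G t = ft G (- t) / complex_of_real (2 * pi)"

lemma integrable_exp_mult:
  assumes "integrable lborel f"
  shows "integrable lborel (\<lambda>t::real. exp (- \<i> * complex_of_real (t * \<tau>)) * f t)"
proof (rule integrable_bounded_mult[OF assms, where B = 1])
  have "(\<lambda>t. exp (- \<i> * complex_of_real (t * \<tau>))) \<in> borel_measurable borel"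
    by (intro borel_measurable_continuous_onI continuous_intros)
  then show "(\<lambda>t. exp (- \<i> * complex_of_real (t * \<tau>))) \<in> borel_measurable lborel" by simp
qed simp

lemma fourier_tensor:
  assumes "integrable lborel f" "integrable lborel g" "integrable lborel h"
  shows "fourier (tensor f g h) (\<xi>, \<mu>, \<tau>) = ft f \<xi> * ft g \<mu> * ft h \<tau>"
proof -
  have "fourier (tensor f g h) (\<xi>, \<mu>, \<tau>)
      = (\<integral>z. tensor (\<lambda>x. exp (- \<i> * complex_of_real (x * \<xi>)) * f x) (\<lambda>y. exp (- \<i> * complex_of_real (y * \<mu>)) * g y)
          (\<lambda>t. exp (- \<i> * complex_of_real (t * \<tau>)) * h t) z \<partial>lborel)"
    unfolding fourier_def
  proof (intro Bochner_Integration.integral_cong refl)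
    fix z :: R3
    obtain x y t where z: "z = (x, y, t)" by (cases z)
    have "exp (- \<i> * complex_of_real (z \<bullet> (\<xi>, \<mu>, \<tau>)))
       = exp (- \<i> * complex_of_real (x * \<xi>)) * exp (- \<i> * complex_of_real (y * \<mu>)) * exp (- \<i> * complex_of_real (t * \<tau>))"
      unfolding exp_add[symmetric] by (simp add: z algebra_simps)
    then show "exp (- \<i> * complex_of_real (z \<bullet> (\<xi>, \<mu>, \<tau>))) * tensor f g h z
      = tensor (\<lambda>x. exp (- \<i> * complex_of_real (x * \<xi>)) * f x) (\<lambda>y. exp (- \<i> * complex_of_real (y * \<mu>)) * g y)
          (\<lambda>t. exp (- \<i> * complex_of_real (t * \<tau>)) * h t) z"
      by (simp add: z tensor_def mult_ac)
  qed
  also have "\<dots> = ft f \<xi> * ft g \<mu> * ft h \<tau>"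
    unfolding ft_def by (rule integrable_tensor(2)) (intro integrable_exp_mult assms)+
  finally show ?thesis .
qed

lemma ft_measurable:
  assumes [measurable]: "f \<in> borel_measurable borel"
  shows "ft f \<in> borel_measurable borel"
  unfolding ft_def by (rule lborel.borel_measurable_lebesgue_integral) simp

lemma norm_ft_le:
  "norm (ft f \<tau>) \<le> (\<integral>t. norm (f t) \<partial>lborel)"
proof -
  have "norm (ft f \<tau>) \<le> (\<integral>t. norm (exp (- \<i> * complex_of_real (t * \<tau>)) * f t) \<partial>lborel)"
    unfolding ft_def by (rule integral_norm_bound)
  then show ?thesis by (simp add: norm_mult)
qed

lemma ft_std_normal_density:
  "(\<integral>s. exp (\<i> * complex_of_real (u * s)) * complex_of_real (std_normal_density s) \<partial>lborel) = complex_of_real (exp (- u\<^sup>2 / 2))"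
proof -
  have "complex_of_real (exp (- u\<^sup>2 / 2)) = char std_normal_distribution u"
    by (simp add: char_std_normal_distribution)
  also have "\<dots> = (\<integral>s. std_normal_density s *\<^sub>R exp (\<i> * complex_of_real (u * s)) \<partial>lborel)"
    unfolding char_def by (subst integral_density) auto
  finally show ?thesis by (simp add: scaleR_conv_of_real mult.commute)
qed

lemma std_normal_density_le_1: "std_normal_density x \<le> 1"
proof -
  have "sqrt (2 * pi) \<ge> 1" using pi_ge_two by simp
  moreover have "exp (- x\<^sup>2 / 2) \<le> 1" by simp
  ultimately have "exp (- x\<^sup>2 / 2) \<le> sqrt (2 * pi)" by linarith
  then show ?thesis by (simp add: std_normal_density_def divide_simps)
qed

text \<open>Gaussian summability. A factor \<open>w n\<close> tending to 1 is inserted into the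
  outer integral. By dominated convergence the result tends to \<open>ft (ift G) \<tau>\<close>; by
  Fubini it equals an average of G against a normal density concentrating at \<tau>, which tends to
  \<open>G \<tau>\<close> by continuity.\<close>

lemma Fourier_inversion:
  assumes G: "integrable lborel G" "continuous_on UNIV G" "\<And>x. norm (G x) \<le> B"
    and F: "integrable lborel (ift G)"
  shows "ft (ift G) \<tau> = G \<tau>"
proof -
  have [measurable]: "G \<in> borel_measurable borel" using G by auto
  have Fm[measurable]: "ift G \<in> borel_measurable borel" using F by auto
  \<comment> \<open>The factor sqrt(2 pi) cancels the normalisation of the density, so that
    \<open>w n t\<close> is exp(-(t/(n+1))^2 / 2).\<close>
  define w where "w n t = complex_of_real (sqrt (2 * pi) * std_normal_density (t / real (Suc n)))" for n t
  have wm[measurable]: "w n \<in> borel_measurable borel" for n unfolding w_def[abs_def] by measurable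
  have wn: "norm (w n t) \<le> sqrt (2 * pi)" for n t
    unfolding w_def norm_of_real using std_normal_density_le_1[of "t / real (Suc n)"]
    by (simp add: abs_mult mult_left_le)
  have w_lim: "(\<lambda>n. w n t) \<longlonglongrightarrow> 1" for t
  proof -
    have "(\<lambda>n. t * inverse (real (Suc n))) \<longlonglongrightarrow> t * 0"
      by (intro tendsto_intros LIMSEQ_inverse_real_of_nat)
    then have l: "(\<lambda>n. t / real (Suc n)) \<longlonglongrightarrow> 0" by (simp add: divide_inverse)
    have "(\<lambda>n. exp (- (t / real (Suc n))\<^sup>2 / 2)) \<longlonglongrightarrow> exp (- 0\<^sup>2 / 2)" by (intro tendsto_intros l) simp
    moreover have "w n t = complex_of_real (exp (- (t / real (Suc n))\<^sup>2 / 2))" for n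
      unfolding w_def std_normal_density_def by simp
    ultimately show ?thesis using tendsto_of_real by fastforce
  qed
  have lim1: "(\<lambda>n. \<integral>t. w n t * (exp (- \<i> * complex_of_real (t * \<tau>)) * ift G t) \<partial>lborel) \<longlonglongrightarrow> ft (ift G) \<tau>"
    unfolding ft_def[of "ift G"]
  proof (rule integral_dominated_convergence)
    show "integrable lborel (\<lambda>t. sqrt (2 * pi) * norm (ift G t))" by (intro integrable_mult_right integrable_norm F)
    show "AE t in lborel. (\<lambda>n. w n t * (exp (- \<i> * complex_of_real (t * \<tau>)) * ift G t))
        \<longlonglongrightarrow> exp (- \<i> * complex_of_real (t * \<tau>)) * ift G t"
      using tendsto_mult_right[OF w_lim] by (intro AE_I2) simp
    show "AE t in lborel. norm (w n t * (exp (- \<i> * complex_of_real (t * \<tau>)) * ift G t)) \<le> sqrt (2 * pi) * norm (ift G t)" for n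
      by (intro AE_I2) (auto simp: norm_mult intro!: mult_right_mono wn)
  qed simp_all
  have eq: "(\<integral>t. w n t * (exp (- \<i> * complex_of_real (t * \<tau>)) * ift G t) \<partial>lborel)
      = (\<integral>s. G (\<tau> + inverse (real (Suc n)) * s) * complex_of_real (std_normal_density s) \<partial>lborel)" for n
  proof -
    define c where "c = real (Suc n)"
    have c: "c > 0" by (simp add: c_def)
    let ?K = "\<lambda>t \<sigma>. exp (\<i> * complex_of_real (t * (\<sigma> - \<tau>))) * (w n t * G \<sigma>)"
    have wi: "integrable lborel (w n)"
    proof -
      have "integrable lborel (\<lambda>t. std_normal_density (0 + inverse c * t))"
        using lborel_integrable_real_affine[of std_normal_density "inverse c" 0] c by simp
      from integrable_of_real[OF integrable_mult_right[OF this, of "sqrt (2 * pi)"]]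
      show ?thesis unfolding w_def[abs_def] by (simp add: c_def divide_inverse mult.commute)
    qed
    have "integrable lborel (\<lambda>p. exp (\<i> * complex_of_real (fst p * (snd p - \<tau>))) * (w n (fst p) * G (snd p)))"
    proof (rule integrable_bounded_mult[OF integrable_lborel_pair_mult(1)[OF wi G(1)], where B = 1])
      have "(\<lambda>p::real\<times>real. exp (\<i> * complex_of_real (fst p * (snd p - \<tau>)))) \<in> borel_measurable borel"
        by (intro borel_measurable_continuous_onI continuous_intros)
      then show "(\<lambda>p::real\<times>real. exp (\<i> * complex_of_real (fst p * (snd p - \<tau>)))) \<in> borel_measurable lborel" by simp
    qed simp
    then have Ki: "integrable (lborel \<Otimes>\<^sub>M lborel) (case_prod ?K)"
      unfolding lborel_prod case_prod_unfold .
    have "(\<integral>t. w n t * (exp (- \<i> * complex_of_real (t * \<tau>)) * ift G t) \<partial>lborel)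
        = (\<integral>t. (\<integral>\<sigma>. ?K t \<sigma> \<partial>lborel) / complex_of_real (2 * pi) \<partial>lborel)"
    proof (intro Bochner_Integration.integral_cong refl)
      fix t
      have "?K t \<sigma> = w n t * exp (- \<i> * complex_of_real (t * \<tau>)) * (exp (- \<i> * complex_of_real (\<sigma> * - t)) * G \<sigma>)" for \<sigma>
      proof -
        have "exp (\<i> * complex_of_real (t * (\<sigma> - \<tau>))) = exp (- \<i> * complex_of_real (t * \<tau>)) * exp (- \<i> * complex_of_real (\<sigma> * - t))"
          unfolding exp_add[symmetric] by (simp add: algebra_simps)
        then show ?thesis by (simp add: mult_ac)
      qed
      then have "(\<integral>\<sigma>. ?K t \<sigma> \<partial>lborel) = w n t * exp (- \<i> * complex_of_real (t * \<tau>)) * ft G (- t)"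
        by (simp only: ft_def integral_mult_right_zero)
      then show "w n t * (exp (- \<i> * complex_of_real (t * \<tau>)) * ift G t) = (\<integral>\<sigma>. ?K t \<sigma> \<partial>lborel) / complex_of_real (2 * pi)"
        by (simp add: ift_def)
    qed
    also have "\<dots> = (\<integral>t. \<integral>\<sigma>. ?K t \<sigma> \<partial>lborel \<partial>lborel) / complex_of_real (2 * pi)" by simp
    also have "(\<integral>t. \<integral>\<sigma>. ?K t \<sigma> \<partial>lborel \<partial>lborel) = (\<integral>\<sigma>. \<integral>t. ?K t \<sigma> \<partial>lborel \<partial>lborel)"
      by (rule lborel_pair.Fubini_integral[OF Ki, symmetric])
    also have "\<dots> = (\<integral>\<sigma>. G \<sigma> * complex_of_real (2 * pi * c * std_normal_density (c * (\<sigma> - \<tau>))) \<partial>lborel)"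
    proof (intro Bochner_Integration.integral_cong refl)
      fix \<sigma>
      \<comment> \<open>After the substitution t = c s the inner integral is the characteristic
        function of the standard normal law at c(\<sigma> - \<tau>): again a Gaussian, now of width
        1/c around \<tau>.\<close>
      have "(\<integral>t. ?K t \<sigma> \<partial>lborel) = (\<integral>t. exp (\<i> * complex_of_real (t * (\<sigma> - \<tau>))) * w n t \<partial>lborel) * G \<sigma>"
        unfolding integral_mult_left_zero[symmetric] by (simp only: mult.assoc)
      also have "(\<integral>t. exp (\<i> * complex_of_real (t * (\<sigma> - \<tau>))) * w n t \<partial>lborel)
         = \<bar>c\<bar> *\<^sub>R (\<integral>s. exp (\<i> * complex_of_real ((0 + c * s) * (\<sigma> - \<tau>))) * w n (0 + c * s) \<partial>lborel)"
        by (rule lborel_integral_real_affine) (use c in simp)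
      also have "\<dots> = c *\<^sub>R (\<integral>s. complex_of_real (sqrt (2 * pi)) * (exp (\<i> * complex_of_real ((c * (\<sigma> - \<tau>)) * s)) * complex_of_real (std_normal_density s)) \<partial>lborel)"
      proof -
        have "w n (0 + c * s) = complex_of_real (sqrt (2 * pi)) * complex_of_real (std_normal_density s)" for s
          using c unfolding w_def c_def[symmetric] by simp
        moreover have "(0 + c * s) * (\<sigma> - \<tau>) = c * (\<sigma> - \<tau>) * s" for s by simp
        moreover have "\<bar>c\<bar> = c" using c by simp
        ultimately show ?thesis
          by (simp only: mult.left_commute[of "exp _" "complex_of_real (sqrt (2 * pi))"])
      qed
      also have "\<dots> = complex_of_real (c * sqrt (2 * pi) * exp (- (c * (\<sigma> - \<tau>))\<^sup>2 / 2))"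
        unfolding integral_mult_right_zero ft_std_normal_density by (simp add: scaleR_conv_of_real)
      also have "c * sqrt (2 * pi) * exp (- (c * (\<sigma> - \<tau>))\<^sup>2 / 2) = 2 * pi * c * std_normal_density (c * (\<sigma> - \<tau>))"
        unfolding std_normal_density_def by (simp add: field_simps)
      finally show "(\<integral>t. ?K t \<sigma> \<partial>lborel) = G \<sigma> * complex_of_real (2 * pi * c * std_normal_density (c * (\<sigma> - \<tau>)))"
        by (simp only: mult.commute)
    qed
    also have "\<dots> = \<bar>inverse c\<bar> *\<^sub>R (\<integral>s. G (\<tau> + inverse c * s) * complex_of_real (2 * pi * c * std_normal_density (c * ((\<tau> + inverse c * s) - \<tau>))) \<partial>lborel)"
      by (rule lborel_integral_real_affine) (use c in simp)
    also have "\<dots> = \<bar>inverse c\<bar> *\<^sub>R (\<integral>s. complex_of_real (2 * pi * c) * (G (\<tau> + inverse c * s) * complex_of_real (std_normal_density s)) \<partial>lborel)"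
    proof -
      have "c * ((\<tau> + inverse c * s) - \<tau>) = s" for s using c by simp
      then show ?thesis by (simp only: of_real_mult mult_ac)
    qed
    also have "\<dots> = complex_of_real (2 * pi) * (\<integral>s. G (\<tau> + inverse c * s) * complex_of_real (std_normal_density s) \<partial>lborel)"
      unfolding integral_mult_right_zero using c by (simp add: scaleR_conv_of_real)
    finally show ?thesis by (simp add: c_def)
  qed
  have "(\<lambda>n. \<integral>s. G (\<tau> + inverse (real (Suc n)) * s) * complex_of_real (std_normal_density s) \<partial>lborel)
      \<longlonglongrightarrow> (\<integral>s. G \<tau> * complex_of_real (std_normal_density s) \<partial>lborel)"
  proof (rule integral_dominated_convergence)
    show "integrable lborel (\<lambda>s. B * std_normal_density s)" by (intro integrable_mult_right integrable_normal_density) simp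
    show "AE s in lborel. (\<lambda>n. G (\<tau> + inverse (real (Suc n)) * s) * complex_of_real (std_normal_density s))
       \<longlonglongrightarrow> G \<tau> * complex_of_real (std_normal_density s)"
    proof (intro AE_I2 tendsto_mult_right)
      fix s
      have "(\<lambda>n. \<tau> + inverse (real (Suc n)) * s) \<longlonglongrightarrow> \<tau> + 0 * s"
        by (intro tendsto_intros LIMSEQ_inverse_real_of_nat)
      then show "(\<lambda>n. G (\<tau> + inverse (real (Suc n)) * s)) \<longlonglongrightarrow> G \<tau>"
        using continuous_on_tendsto_compose[OF G(2)] by simp
    qed
    show "AE s in lborel. norm (G (\<tau> + inverse (real (Suc n)) * s) * complex_of_real (std_normal_density s)) \<le> B * std_normal_density s" for n
      by (intro AE_I2) (auto simp: norm_mult intro!: mult_right_mono G(3))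
  qed simp_all
  also have "(\<integral>s. G \<tau> * complex_of_real (std_normal_density s) \<partial>lborel) = G \<tau>"
    by (simp only: integral_mult_right_zero integral_complex_of_real) simp
  finally show ?thesis using lim1 unfolding eq by (rule LIMSEQ_unique[rotated])
qed

section \<open>A compactly supported bump and its inverse transform\<close>

text \<open>Vanishing is demanded already at |s| = 1: this removes the boundary terms of the
  integration by parts in \<open>ft_deriv\<close>.\<close>

definition bump_fun :: "(real \<Rightarrow> complex) \<Rightarrow> bool" where
  "bump_fun G \<longleftrightarrow> continuous_on UNIV G \<and> (\<forall>s. 1 \<le> \<bar>s\<bar> \<longrightarrow> G s = 0)"

lemma bump_fun_indicator: "bump_fun G \<Longrightarrow> indicat_real {-1..1} s *\<^sub>R G s = G s"
  by (cases "\<bar>s\<bar> \<le> 1") (auto simp: bump_fun_def abs_le_iff indicator_def)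

lemma bump_fun_integrable:
  assumes "bump_fun G"
  shows "integrable lborel G"
proof -
  have "set_integrable lborel {-1..1} G"
    using assms by (intro borel_integrable_atLeastAtMost') (auto simp: bump_fun_def intro: continuous_on_subset)
  then show ?thesis
    by (simp add: set_integrable_def bump_fun_indicator[OF assms])
qed

lemma bump_fun_bounded:
  assumes "bump_fun G"
  shows "\<exists>B. \<forall>s. norm (G s) \<le> B"
proof -
  have "compact (G ` {-1..1})"
    using assms by (intro compact_continuous_image) (auto simp: bump_fun_def intro: continuous_on_subset)
  then have "bounded (G ` {-1..1})" by (rule compact_imp_bounded)
  then obtain B where B: "\<And>s. s \<in> {-1..1} \<Longrightarrow> norm (G s) \<le> B"
    unfolding bounded_iff by (meson imageI)
  have "norm (G s) \<le> B" for s
  proof (cases "s \<in> {-1..1}")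
    case False
    then have "G s = 0" using assms by (auto simp: bump_fun_def abs_if)
    moreover have "0 \<le> B" using order_trans[OF norm_ge_zero B[of 0]] by simp
    ultimately show ?thesis by simp
  qed (rule B)
  then show ?thesis by blast
qed

text \<open>Integration by parts, in the form that the derivative of exp(-\<i> s \<tau>) G(s)
  integrates to 0 over [-1, 1].\<close>

lemma ft_deriv:
  assumes G: "bump_fun G" "bump_fun G'" "\<And>s. (G has_vector_derivative G' s) (at s)"
  shows "ft G' \<tau> = \<i> * complex_of_real \<tau> * ft G \<tau>"
proof -
  let ?e = "\<lambda>s. exp (- \<i> * complex_of_real (s * \<tau>))"
  let ?f = "\<lambda>s. ?e s * G' s - \<i> * complex_of_real \<tau> * (?e s * G s)"
  have e: "(?e has_vector_derivative - \<i> * complex_of_real \<tau> * ?e s) (at s)" for s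
  proof -
    have "((\<lambda>z. exp (- \<i> * complex_of_real \<tau> * z)) has_field_derivative
        - \<i> * complex_of_real \<tau> * exp (- \<i> * complex_of_real \<tau> * complex_of_real s)) (at (complex_of_real s))"
      by (auto intro!: derivative_eq_intros)
    from has_vector_derivative_real_field[OF this] show ?thesis
      by (simp add: mult_ac)
  qed
  have d: "((\<lambda>s. ?e s * G s) has_vector_derivative ?f s) (at s)" for s
    by (rule has_vector_derivative_eq_rhs[OF has_vector_derivative_mult[OF e G(3)]]) (simp add: algebra_simps)
  have c: "continuous_on UNIV ?f"
    using G(1,2) unfolding bump_fun_def by (intro continuous_intros) auto
  have "has_bochner_integral lborel (\<lambda>s. indicator {-1..1} s *\<^sub>R ?f s) (?e 1 * G 1 - ?e (-1) * G (-1))"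
    by (rule has_bochner_integral_FTC_Icc)
       (use d c in \<open>auto intro: has_vector_derivative_at_within continuous_on_subset\<close>)
  moreover have "indicat_real {-1..1} s *\<^sub>R ?f s = ?f s" for s
    using bump_fun_indicator[OF G(1), of s] bump_fun_indicator[OF G(2), of s]
    by (cases "s \<in> {-1..1}") auto
  moreover have "G 1 = 0" "G (-1) = 0" using G(1) by (auto simp: bump_fun_def)
  ultimately have "(\<integral>s. ?f s \<partial>lborel) = 0"
    by (simp add: has_bochner_integral_integral_eq)
  also have "(\<integral>s. ?f s \<partial>lborel) = ft G' \<tau> - \<i> * complex_of_real \<tau> * ft G \<tau>"
    unfolding ft_def
    by (subst Bochner_Integration.integral_diff)
       (rule integrable_mult_right integrable_exp_mult bump_fun_integrable G
         | simp only: integral_mult_right_zero)+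
  finally show ?thesis by simp
qed

lemma ift_deriv:
  assumes "bump_fun G" "bump_fun G'" "\<And>s. (G has_vector_derivative G' s) (at s)"
  shows "complex_of_real t * ift G t = \<i> * ift G' t"
  by (simp add: ift_def ft_deriv[OF assms] mult.assoc)

lemma norm_ift_le: "norm (ift G t) \<le> (\<integral>s. norm (G s) \<partial>lborel)"
proof -
  have "norm (ift G t) = norm (ft G (- t)) / (2 * pi)" by (simp add: ift_def norm_divide)
  also have "\<dots> \<le> norm (ft G (- t)) / 1" using pi_ge_two by (intro divide_left_mono) auto
  finally show ?thesis using norm_ft_le[of G "- t"] by simp
qed

lemma ift_measurable:
  assumes "bump_fun G"
  shows "ift G \<in> borel_measurable borel"
proof -
  have "G \<in> borel_measurable borel"
    using assms by (intro borel_measurable_continuous_onI) (simp add: bump_fun_def)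
  from measurable_compose[OF borel_measurable_uminus[OF measurable_ident] ft_measurable[OF this]]
  show ?thesis unfolding ift_def[abs_def] by simp
qed

text \<open>Two integrations by parts turn t^2 \<open>ift G t\<close> into
  \<open>- ift G'' t\<close>, which is bounded. Hence \<open>ift G\<close> decays like
  1/(1+t^2).\<close>

lemma ift_integrable:
  assumes G: "bump_fun G" "bump_fun G'" "bump_fun G''"
    "\<And>s. (G has_vector_derivative G' s) (at s)" "\<And>s. (G' has_vector_derivative G'' s) (at s)"
  shows "integrable lborel (ift G)"
proof -
  let ?C = "(\<integral>s. norm (G s) \<partial>lborel) + (\<integral>s. norm (G'' s) \<partial>lborel)"
  have m: "ift G \<in> borel_measurable borel" by (rule ift_measurable[OF G(1)])
  have "norm (ift G t) \<le> norm (complex_of_real ?C * complex_of_real (inverse (1 + t\<^sup>2)))" for t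
  proof -
    have "complex_of_real t * (complex_of_real t * ift G t) = - ift G'' t"
    proof -
      have "complex_of_real t * (complex_of_real t * ift G t) = \<i> * (complex_of_real t * ift G' t)"
        by (simp only: ift_deriv[OF G(1,2,4)] mult.left_commute)
      also have "\<dots> = \<i> * (\<i> * ift G'' t)" by (simp only: ift_deriv[OF G(2,3,5)])
      finally show ?thesis by simp
    qed
    then have "norm (complex_of_real t * (complex_of_real t * ift G t)) = norm (ift G'' t)"
      by (simp only: norm_minus_cancel)
    then have "t\<^sup>2 * norm (ift G t) = norm (ift G'' t)"
      by (simp only: norm_mult norm_of_real mult.assoc[symmetric] abs_mult_self_eq power2_eq_square)
    then have "(1 + t\<^sup>2) * norm (ift G t) \<le> ?C"
      using norm_ift_le[of G t] norm_ift_le[of G'' t] by (simp add: algebra_simps)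
    moreover have "1 + t\<^sup>2 > 0" by (simp add: add_pos_nonneg)
    ultimately have "norm (ift G t) \<le> ?C / (1 + t\<^sup>2)"
      by (simp only: pos_le_divide_eq mult.commute)
    then have "norm (ift G t) \<le> ?C * inverse (1 + t\<^sup>2)" by (simp only: divide_inverse)
    also have "\<dots> \<le> norm (complex_of_real ?C * complex_of_real (inverse (1 + t\<^sup>2)))"
      unfolding of_real_mult[symmetric] norm_of_real by (rule abs_ge_self)
    finally show ?thesis .
  qed
  then have "AE t in lborel. norm (ift G t) \<le> norm (complex_of_real ?C * complex_of_real (inverse (1 + t\<^sup>2)))"
    by (rule AE_I2)
  moreover have "ift G \<in> borel_measurable lborel" using m by simp
  ultimately show ?thesis
    by (rule Bochner_Integration.integrable_bound[OF integrable_mult_right[OF integrable_inverse_1_plus_square_complex, of "complex_of_real ?C"], rotated])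
qed

lemma ft_ift:
  assumes G: "bump_fun G" and F: "integrable lborel (ift G)"
  shows "ft (ift G) = G"
proof -
  obtain B where "\<And>s. norm (G s) \<le> B" using bump_fun_bounded[OF G] by blast
  note Fourier_inversion[OF bump_fun_integrable[OF G] _ this F]
  moreover have "continuous_on UNIV G" using G by (simp add: bump_fun_def)
  ultimately show ?thesis by (intro ext)
qed

text \<open>Modulation and dilation. On the Fourier side the profile is centred at a, stretched to
  width c and multiplied by 1/c.\<close>

definition modscale :: "real \<Rightarrow> real \<Rightarrow> (real \<Rightarrow> complex) \<Rightarrow> real \<Rightarrow> complex" where
  "modscale a c f x = exp (\<i> * complex_of_real (a * x)) * f (c * x)"

lemma modscale_integrable:
  assumes "integrable lborel f" "c > 0"
  shows "integrable lborel (modscale a c f)"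
proof -
  have "integrable lborel (\<lambda>x. f (0 + c * x))"
    using lborel_integrable_real_affine[OF assms(1), of c 0] assms(2) by simp
  from integrable_exp_mult[OF this, of "- a"] show ?thesis
    by (simp add: modscale_def[abs_def] mult.commute)
qed

lemma ft_modscale:
  assumes "f \<in> borel_measurable borel" "c > 0"
  shows "ft (modscale a c f) \<xi> = ft f ((\<xi> - a) / c) / complex_of_real c"
proof -
  have [measurable]: "f \<in> borel_measurable borel" by (rule assms)
  have "ft f ((\<xi> - a) / c) = \<bar>c\<bar> *\<^sub>R (\<integral>x. exp (- \<i> * complex_of_real ((0 + c * x) * ((\<xi> - a) / c))) * f (0 + c * x) \<partial>lborel)"
    unfolding ft_def by (rule lborel_integral_real_affine) (use assms in simp)
  also have "(\<integral>x. exp (- \<i> * complex_of_real ((0 + c * x) * ((\<xi> - a) / c))) * f (0 + c * x) \<partial>lborel) = ft (modscale a c f) \<xi>"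
    unfolding ft_def
  proof (intro Bochner_Integration.integral_cong refl)
    fix x
    have "exp (- \<i> * complex_of_real ((0 + c * x) * ((\<xi> - a) / c))) = exp (- \<i> * complex_of_real (x * \<xi>)) * exp (\<i> * complex_of_real (a * x))"
    proof -
      have eq: "(0 + c * x) * ((\<xi> - a) / c) = x * \<xi> - a * x" using assms(2) by (simp add: field_simps)
      show ?thesis unfolding exp_add[symmetric] eq by (simp add: algebra_simps)
    qed
    then show "exp (- \<i> * complex_of_real ((0 + c * x) * ((\<xi> - a) / c))) * f (0 + c * x) = exp (- \<i> * complex_of_real (x * \<xi>)) * modscale a c f x"
      by (simp add: modscale_def mult_ac)
  qed
  finally show ?thesis using assms(2) by (simp add: scaleR_conv_of_real)
qed

lemma modscale_mult: "modscale a c f x * modscale b c g x = modscale (a + b) c (\<lambda>x. f x * g x) x"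
  by (simp add: modscale_def exp_add algebra_simps)

lemma ift_square_integrable:
  assumes "bump_fun G" "integrable lborel (ift G)"
  shows "integrable lborel (\<lambda>t. ift G t * ift G t)"
  by (rule integrable_bounded_mult[OF assms(2) _ norm_ift_le]) (use ift_measurable[OF assms(1)] in simp)

text \<open>Convolution theorem. One factor \<open>ift G\<close> is written out as an integral over
  \<sigma>; after Fubini the other one is transformed at \<tau> - \<sigma>, where inversion returns
  G.\<close>

lemma ft_ift_square:
  assumes G: "bump_fun G" and F: "integrable lborel (ift G)"
  shows "ft (\<lambda>t. ift G t * ift G t) \<tau> = (\<integral>\<sigma>. G \<sigma> * G (\<tau> - \<sigma>) \<partial>lborel) / complex_of_real (2 * pi)"
proof -
  let ?F = "ift G"
  let ?K = "\<lambda>t \<sigma>. exp (- \<i> * complex_of_real (t * (\<tau> - \<sigma>))) * (?F t * G \<sigma>)"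
  have "integrable lborel (\<lambda>p. exp (- \<i> * complex_of_real (fst p * (\<tau> - snd p))) * (?F (fst p) * G (snd p)))"
  proof (rule integrable_bounded_mult[OF integrable_lborel_pair_mult(1)[OF F bump_fun_integrable[OF G]], where B = 1])
    have "(\<lambda>p::real\<times>real. exp (- \<i> * complex_of_real (fst p * (\<tau> - snd p)))) \<in> borel_measurable borel"
      by (intro borel_measurable_continuous_onI continuous_intros)
    then show "(\<lambda>p::real\<times>real. exp (- \<i> * complex_of_real (fst p * (\<tau> - snd p)))) \<in> borel_measurable lborel" by simp
  qed simp
  then have Ki: "integrable (lborel \<Otimes>\<^sub>M lborel) (case_prod ?K)"
    unfolding lborel_prod case_prod_unfold .
  have "ft (\<lambda>t. ?F t * ?F t) \<tau> = (\<integral>t. (\<integral>\<sigma>. ?K t \<sigma> \<partial>lborel) / complex_of_real (2 * pi) \<partial>lborel)"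
    unfolding ft_def[of "\<lambda>t. ?F t * ?F t"]
  proof (intro Bochner_Integration.integral_cong refl)
    fix t
    have "?K t \<sigma> = (exp (- \<i> * complex_of_real (t * \<tau>)) * ?F t) * (exp (- \<i> * complex_of_real (\<sigma> * - t)) * G \<sigma>)" for \<sigma>
    proof -
      have "exp (- \<i> * complex_of_real (t * (\<tau> - \<sigma>))) = exp (- \<i> * complex_of_real (t * \<tau>)) * exp (- \<i> * complex_of_real (\<sigma> * - t))"
        unfolding exp_add[symmetric] by (simp add: algebra_simps)
      then show ?thesis by (simp add: mult_ac)
    qed
    then have "(\<integral>\<sigma>. ?K t \<sigma> \<partial>lborel) = exp (- \<i> * complex_of_real (t * \<tau>)) * ?F t * ft G (- t)"
      by (simp only: ft_def integral_mult_right_zero)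
    then show "exp (- \<i> * complex_of_real (t * \<tau>)) * (?F t * ?F t) = (\<integral>\<sigma>. ?K t \<sigma> \<partial>lborel) / complex_of_real (2 * pi)"
      by (simp add: ift_def)
  qed
  also have "\<dots> = (\<integral>t. \<integral>\<sigma>. ?K t \<sigma> \<partial>lborel \<partial>lborel) / complex_of_real (2 * pi)" by simp
  also have "(\<integral>t. \<integral>\<sigma>. ?K t \<sigma> \<partial>lborel \<partial>lborel) = (\<integral>\<sigma>. \<integral>t. ?K t \<sigma> \<partial>lborel \<partial>lborel)"
    by (rule lborel_pair.Fubini_integral[OF Ki, symmetric])
  also have "\<dots> = (\<integral>\<sigma>. G \<sigma> * ft ?F (\<tau> - \<sigma>) \<partial>lborel)"
    unfolding ft_def integral_mult_right_zero[symmetric]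
    by (intro Bochner_Integration.integral_cong refl) (simp only: mult_ac)
  also have "\<dots> = (\<integral>\<sigma>. G \<sigma> * G (\<tau> - \<sigma>) \<partial>lborel)" by (simp only: ft_ift[OF G F])
  finally show ?thesis .
qed

section \<open>The concrete bump and its derivatives\<close>

definition trunc_parabola :: "nat \<Rightarrow> real \<Rightarrow> real" where
  "trunc_parabola k s = max 0 (1 - s\<^sup>2) ^ k"

text \<open>The exponent k + 2 ensures differentiability at 0, where the difference quotient is
  bounded by the power k + 1 and tends to 0.\<close>

lemma DERIV_max_power: "((\<lambda>x. max 0 x ^ (k + 2)) has_real_derivative real (k + 2) * max 0 x ^ (k + 1)) (at x)"
proof -
  consider "x > 0" | "x < 0" | "x = 0" by linarith
  then show ?thesis
  proof cases
    case 1
    have "((\<lambda>x. x ^ (k + 2)) has_real_derivative real (k + 2) * max 0 x ^ (k + 1)) (at x)"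
      using DERIV_pow[of "k + 2" x] 1 by (simp add: max_def)
    then show ?thesis
      by (rule has_field_derivative_transform_within_open[where S = "{0<..}"]) (use 1 in auto)
  next
    case 2
    have "((\<lambda>x. 0) has_real_derivative real (k + 2) * max 0 x ^ (k + 1)) (at x)"
      using 2 by (auto intro!: derivative_eq_intros simp: max_def)
    then show ?thesis
      by (rule has_field_derivative_transform_within_open[where S = "{..<0}"]) (use 2 in auto)
  next
    case 3
    have "(\<lambda>h::real. max 0 h ^ (k + 2) / h) \<midarrow>0\<rightarrow> 0"
    proof (rule Lim_null_comparison)
      show "\<forall>\<^sub>F h in at 0. norm (max 0 h ^ (k + 2) / h) \<le> \<bar>max 0 h ^ (k + 1)\<bar>"
        by (auto simp: eventually_at_filter max_def)
      have "((\<lambda>h::real. \<bar>max 0 h ^ (k + 1)\<bar>) \<longlongrightarrow> \<bar>max 0 0 ^ (k + 1)\<bar>) (at 0)" by (intro tendsto_intros)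
      then show "((\<lambda>h::real. \<bar>max 0 h ^ (k + 1)\<bar>) \<longlongrightarrow> 0) (at 0)" by simp
    qed
    then show ?thesis using 3 by (simp add: DERIV_def)
  qed
qed

lemma DERIV_trunc_parabola:
  "(trunc_parabola (k + 2) has_real_derivative - 2 * real (k + 2) * s * trunc_parabola (k + 1) s) (at s)"
proof -
  have "((\<lambda>s::real. 1 - s\<^sup>2) has_real_derivative - 2 * s) (at s)"
    by (auto intro!: derivative_eq_intros)
  from DERIV_chain2[OF DERIV_max_power this, of k] show ?thesis
    unfolding trunc_parabola_def[abs_def] by (rule DERIV_cong) (simp only: mult_ac)
qed

text \<open>The exponent 4 makes \<open>bump'\<close> twice continuously differentiable, so that its inverse transform,
  which is \<open>t\<close> times that of \<open>bump\<close> up to a constant, is still integrable.\<close>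

definition bump :: "real \<Rightarrow> real" where "bump = trunc_parabola 4"
definition bump' :: "real \<Rightarrow> real" where "bump' s = - 8 * s * trunc_parabola 3 s"
definition bump'' :: "real \<Rightarrow> real" where
  "bump'' s = - 8 * trunc_parabola 3 s + 48 * s\<^sup>2 * trunc_parabola 2 s"
definition bump''' :: "real \<Rightarrow> real" where
  "bump''' s = 144 * s * trunc_parabola 2 s - 192 * s ^ 3 * trunc_parabola 1 s"

lemma DERIV_bump: "(bump has_real_derivative bump' s) (at s)"
  using DERIV_trunc_parabola[of 2 s] by (simp add: bump_def bump'_def)

lemma DERIV_bump': "(bump' has_real_derivative bump'' s) (at s)"
proof -
  have d: "(trunc_parabola 3 has_real_derivative - 6 * s * trunc_parabola 2 s) (at s)"
    using DERIV_trunc_parabola[of 1 s] by (simp add: eval_nat_numeral)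
  show ?thesis unfolding bump'_def[abs_def] bump''_def
    by (rule derivative_eq_intros d refl)+ (simp add: power2_eq_square)
qed

lemma DERIV_bump'': "(bump'' has_real_derivative bump''' s) (at s)"
proof -
  have d: "(trunc_parabola 3 has_real_derivative - 6 * s * trunc_parabola 2 s) (at s)"
    using DERIV_trunc_parabola[of 1 s] by (simp add: eval_nat_numeral)
  have d2: "(trunc_parabola 2 has_real_derivative - 4 * s * trunc_parabola 1 s) (at s)"
    using DERIV_trunc_parabola[of 0 s] by (simp add: eval_nat_numeral)
  show ?thesis unfolding bump''_def[abs_def] bump'''_def
    by (rule derivative_eq_intros d d2 refl)+ (simp add: power2_eq_square power3_eq_cube)
qed

lemma trunc_parabola_eq_0: "1 \<le> \<bar>s\<bar> \<Longrightarrow> k > 0 \<Longrightarrow> trunc_parabola k s = 0"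
  using abs_le_square_iff[of 1 s] by (simp add: trunc_parabola_def max_def)

lemma bump_fun_bump:
  "bump_fun (\<lambda>s. complex_of_real (bump s))" "bump_fun (\<lambda>s. complex_of_real (bump' s))"
  "bump_fun (\<lambda>s. complex_of_real (bump'' s))" "bump_fun (\<lambda>s. complex_of_real (bump''' s))"
proof -
  have [continuous_intros]: "continuous_on UNIV (trunc_parabola k)" for k
    unfolding trunc_parabola_def[abs_def] by (intro continuous_intros)
  show "bump_fun (\<lambda>s. complex_of_real (bump s))" "bump_fun (\<lambda>s. complex_of_real (bump' s))"
    "bump_fun (\<lambda>s. complex_of_real (bump'' s))" "bump_fun (\<lambda>s. complex_of_real (bump''' s))"
    unfolding bump_fun_def bump_def bump'_def bump''_def bump'''_def
    by (auto simp: trunc_parabola_eq_0 intro!: continuous_intros)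
qed

lemma has_vector_derivative_of_real':
  "(f has_real_derivative D) (at s) \<Longrightarrow> ((\<lambda>s. complex_of_real (f s)) has_vector_derivative complex_of_real D) (at s)"
  by (rule has_vector_derivative_of_real) (simp add: has_real_derivative_iff_has_vector_derivative)

definition kern :: "real \<Rightarrow> complex" where "kern = ift (\<lambda>s. complex_of_real (bump s))"
definition kern_t :: "real \<Rightarrow> complex" where "kern_t t = complex_of_real t * kern t"

lemma kern_t_eq: "kern_t = (\<lambda>t. \<i> * ift (\<lambda>s. complex_of_real (bump' s)) t)"
  unfolding kern_t_def[abs_def] kern_def
  by (intro ext ift_deriv bump_fun_bump has_vector_derivative_of_real' DERIV_bump)

lemma kern_integrable: "integrable lborel kern"
  unfolding kern_def
  by (rule ift_integrable) (rule bump_fun_bump has_vector_derivative_of_real' DERIV_bump DERIV_bump')+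

lemma ift_bump'_integrable: "integrable lborel (ift (\<lambda>s. complex_of_real (bump' s)))"
  by (rule ift_integrable) (rule bump_fun_bump has_vector_derivative_of_real' DERIV_bump' DERIV_bump'')+

lemma kern_t_integrable: "integrable lborel kern_t"
  unfolding kern_t_eq by (intro integrable_mult_right ift_bump'_integrable)

lemma ft_kern: "ft kern \<tau> = complex_of_real (bump \<tau>)"
  using ft_ift[OF bump_fun_bump(1)] kern_integrable by (simp add: kern_def)

lemma ft_kern_t: "ft kern_t \<tau> = \<i> * complex_of_real (bump' \<tau>)"
proof -
  have "ft kern_t \<tau> = \<i> * ft (ift (\<lambda>s. complex_of_real (bump' s))) \<tau>"
    unfolding kern_t_eq ft_def integral_mult_right_zero[symmetric]
    by (intro Bochner_Integration.integral_cong refl) (simp only: mult_ac)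
  then show ?thesis by (simp add: ft_ift[OF bump_fun_bump(2) ift_bump'_integrable])
qed

section \<open>Norms of functions concentrated on a box\<close>

lemma ennsqrt_mono: "a \<le> b \<Longrightarrow> ennsqrt a \<le> ennsqrt b"
  by (cases a; cases b)
     (auto simp: ennsqrt_def top_unique ennreal_leI)

lemma ennsqrt_ennreal: "0 \<le> x \<Longrightarrow> ennsqrt (ennreal x) = ennreal (sqrt x)"
  by (simp add: ennsqrt_def)

lemma chi_bounds: "0 \<le> chi j s" "chi j s \<le> 1" by (auto simp: chi_def indicator_def)
lemma rho1_bounds: "0 \<le> rho1 \<xi> \<mu>" "rho1 \<xi> \<mu> \<le> 1" by (auto simp: rho1_def)
lemma theta_bounds: "0 \<le> theta m s" "theta m s \<le> 1" by (auto simp: theta_def indicator_def)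
lemma weight_ge_1: "1 \<le> weight \<xi> \<mu>" by (simp add: weight_def)

lemma square_powr_sqrt:
  assumes "0 < W" "0 \<le> c" "0 \<le> V"
  shows "sqrt (W powr (2 * s) * c\<^sup>2 * V) = W powr s * c * sqrt V"
proof -
  have "W powr (2 * s) = (W powr s)\<^sup>2"
    using assms by (simp add: power2_eq_square flip: powr_add)
  then show ?thesis using assms by (simp add: real_sqrt_mult)
qed

text \<open>All terms of the norm are nonnegative, so the one with indices j and m in the first sum
  is a lower bound, and its integral may be restricted to Q.\<close>

lemma X_norm_hat_lower:
  assumes Q: "Q \<in> sets borel" "emeasure lborel Q = ennreal V" "0 \<le> V"
    and s: "0 \<le> s" and W: "0 < W" and c: "0 \<le> c"
    and on: "\<And>\<xi> \<mu> \<tau>. (\<xi>, \<mu>, \<tau>) \<in> Q \<Longrightarrow> chi j (\<tau> - omega \<xi> \<mu>) = 1 \<and> rho1 \<xi> \<mu> = 1 \<and> theta m \<xi> = 1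
      \<and> W \<le> weight \<xi> \<mu> \<and> c \<le> cmod (g (\<xi>, \<mu>, \<tau>))"
  shows "ennreal (2 powr (real j * b) * (W powr s * c * sqrt V)) \<le> X_norm_hat s b g"
proof -
  let ?I = "\<lambda>j m. \<integral>\<^sup>+ (\<xi>, \<mu>, \<tau>). ennreal (chi j (\<tau> - omega \<xi> \<mu>) * rho1 \<xi> \<mu> * theta m \<xi> * weight \<xi> \<mu> powr (2 * s)
           * (cmod (g (\<xi>, \<mu>, \<tau>)))\<^sup>2) \<partial>lborel"
  have "ennreal (W powr (2 * s) * c\<^sup>2 * V) = ennreal (W powr (2 * s) * c\<^sup>2) * emeasure lborel Q"
    using Q by (simp add: ennreal_mult)
  also have "\<dots> = (\<integral>\<^sup>+ z. ennreal (W powr (2 * s) * c\<^sup>2) * indicator Q z \<partial>lborel)"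
    using Q by (simp add: nn_integral_cmult_indicator)
  also have "\<dots> \<le> ?I j m"
  proof (rule nn_integral_mono, safe)
    fix \<xi> \<mu> \<tau>
    show "ennreal (W powr (2 * s) * c\<^sup>2) * indicator Q (\<xi>, \<mu>, \<tau>)
      \<le> ennreal (chi j (\<tau> - omega \<xi> \<mu>) * rho1 \<xi> \<mu> * theta m \<xi> * weight \<xi> \<mu> powr (2 * s) * (cmod (g (\<xi>, \<mu>, \<tau>)))\<^sup>2)"
    proof (cases "(\<xi>, \<mu>, \<tau>) \<in> Q")
      case True
      have "W powr (2 * s) * c\<^sup>2 \<le> weight \<xi> \<mu> powr (2 * s) * (cmod (g (\<xi>, \<mu>, \<tau>)))\<^sup>2"
        using on[OF True] s W c by (intro mult_mono powr_mono2 power_mono) auto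
      then show ?thesis using on[OF True] True by (simp add: ennreal_leI)
    qed simp
  qed
  finally have "ennreal (W powr s * c * sqrt V) \<le> ennsqrt (?I j m)"
    using ennsqrt_mono[of "ennreal (W powr (2 * s) * c\<^sup>2 * V)"] Q(3) W c
    by (simp add: ennsqrt_ennreal square_powr_sqrt)
  then have "ennreal (2 powr (real j * b)) * ennreal (W powr s * c * sqrt V)
      \<le> ennreal (2 powr (real j * b)) * ennsqrt (?I j m)"
    by (rule mult_left_mono) simp
  also have "\<dots> \<le> (\<Sum>m. ennreal (2 powr (real j * b)) * ennsqrt (?I j m))"
    using sum_le_suminf[of "\<lambda>m. ennreal (2 powr (real j * b)) * ennsqrt (?I j m)" "{m}"] by simp
  also have "\<dots> \<le> (\<Sum>j. \<Sum>m. ennreal (2 powr (real j * b)) * ennsqrt (?I j m))"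
    using sum_le_suminf[of "\<lambda>j. \<Sum>m. ennreal (2 powr (real j * b)) * ennsqrt (?I j m)" "{j}"] by simp
  also have "\<dots> \<le> X_norm_hat s b g" unfolding X_norm_hat_def by simp
  finally show ?thesis using W c Q(3) by (simp add: ennreal_mult)
qed

text \<open>The norm is a double series of square roots, so a bound on g alone does not control it.
  Here the support lies outside the \<rho>2-region and meets only one dyadic shell in \<xi> and J
  shells of modulation, so at most J terms survive.\<close>

lemma X_norm_hat_upper:
  assumes Q: "Q \<in> sets borel" "emeasure lborel Q = ennreal V" "0 \<le> V"
    and s: "0 \<le> s" and W: "0 < W" and c: "0 \<le> c"
    and off: "\<And>z. z \<notin> Q \<Longrightarrow> g z = 0"
    and on: "\<And>\<xi> \<mu> \<tau>. (\<xi>, \<mu>, \<tau>) \<in> Q \<Longrightarrow> (\<forall>j\<ge>J. chi j (\<tau> - omega \<xi> \<mu>) = 0) \<and> rho2 \<xi> \<mu> = 0 \<and> (\<forall>m'. m' \<noteq> m \<longrightarrow> theta m' \<xi> = 0)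
      \<and> weight \<xi> \<mu> \<le> W \<and> cmod (g (\<xi>, \<mu>, \<tau>)) \<le> c"
  shows "X_norm_hat s b g \<le> ennreal ((\<Sum>j<J. 2 powr (real j * b)) * (W powr s * c * sqrt V))"
proof -
  let ?I = "\<lambda>j m. \<integral>\<^sup>+ (\<xi>, \<mu>, \<tau>). ennreal (chi j (\<tau> - omega \<xi> \<mu>) * rho1 \<xi> \<mu> * theta m \<xi> * weight \<xi> \<mu> powr (2 * s)
           * (cmod (g (\<xi>, \<mu>, \<tau>)))\<^sup>2) \<partial>lborel"
  let ?I2 = "\<lambda>j n. \<integral>\<^sup>+ (\<xi>, \<mu>, \<tau>). ennreal (chi j (\<tau> - omega \<xi> \<mu>) * rho2 \<xi> \<mu> * theta n \<mu> * weight \<xi> \<mu> powr (2 * s)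
           * (cmod (g (\<xi>, \<mu>, \<tau>)))\<^sup>2) \<partial>lborel"
  let ?M = "W powr s * c * sqrt V"
  have z2: "?I2 j n = 0" for j n
  proof -
    have "?I2 j n = (\<integral>\<^sup>+ z. 0 \<partial>(lborel :: R3 measure))"
    proof (rule nn_integral_cong, safe)
      fix \<xi> \<mu> \<tau>
      show "ennreal (chi j (\<tau> - omega \<xi> \<mu>) * rho2 \<xi> \<mu> * theta n \<mu> * weight \<xi> \<mu> powr (2 * s) * (cmod (g (\<xi>, \<mu>, \<tau>)))\<^sup>2) = 0"
        using on[of \<xi> \<mu> \<tau>] off[of "(\<xi>, \<mu>, \<tau>)"] by (cases "(\<xi>, \<mu>, \<tau>) \<in> Q") auto
    qed
    then show ?thesis by simp
  qed
  have z1: "?I j m' = 0" if "j \<ge> J \<or> m' \<noteq> m" for j m'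
  proof -
    have "?I j m' = (\<integral>\<^sup>+ z. 0 \<partial>(lborel :: R3 measure))"
    proof (rule nn_integral_cong, safe)
      fix \<xi> \<mu> \<tau>
      show "ennreal (chi j (\<tau> - omega \<xi> \<mu>) * rho1 \<xi> \<mu> * theta m' \<xi> * weight \<xi> \<mu> powr (2 * s) * (cmod (g (\<xi>, \<mu>, \<tau>)))\<^sup>2) = 0"
        using on[of \<xi> \<mu> \<tau>] off[of "(\<xi>, \<mu>, \<tau>)"] that by (cases "(\<xi>, \<mu>, \<tau>) \<in> Q") auto
    qed
    then show ?thesis by simp
  qed
  have b1: "ennsqrt (?I j m) \<le> ennreal ?M" for j
  proof -
    have "?I j m \<le> (\<integral>\<^sup>+ z. ennreal (W powr (2 * s) * c\<^sup>2) * indicator Q z \<partial>lborel)"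
    proof (rule nn_integral_mono, safe)
      fix \<xi> \<mu> \<tau>
      show "ennreal (chi j (\<tau> - omega \<xi> \<mu>) * rho1 \<xi> \<mu> * theta m \<xi> * weight \<xi> \<mu> powr (2 * s) * (cmod (g (\<xi>, \<mu>, \<tau>)))\<^sup>2)
        \<le> ennreal (W powr (2 * s) * c\<^sup>2) * indicator Q (\<xi>, \<mu>, \<tau>)"
      proof (cases "(\<xi>, \<mu>, \<tau>) \<in> Q")
        case True
        have "chi j (\<tau> - omega \<xi> \<mu>) * rho1 \<xi> \<mu> * theta m \<xi> * weight \<xi> \<mu> powr (2 * s) * (cmod (g (\<xi>, \<mu>, \<tau>)))\<^sup>2
          \<le> 1 * 1 * 1 * W powr (2 * s) * c\<^sup>2"
          using on[OF True] s c weight_ge_1[of \<xi> \<mu>]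
          by (intro mult_mono powr_mono2 power_mono) (auto simp: chi_bounds rho1_bounds theta_bounds)
        then show ?thesis using True by (simp add: ennreal_leI)
      qed (simp add: off)
    qed
    also have "\<dots> = ennreal (W powr (2 * s) * c\<^sup>2) * emeasure lborel Q"
      using Q by (simp add: nn_integral_cmult_indicator)
    also have "\<dots> = ennreal (W powr (2 * s) * c\<^sup>2 * V)"
      using Q by (simp add: ennreal_mult)
    finally have "ennsqrt (?I j m) \<le> ennsqrt (ennreal (W powr (2 * s) * c\<^sup>2 * V))" by (rule ennsqrt_mono)
    then show ?thesis using Q(3) W c by (simp add: ennsqrt_ennreal square_powr_sqrt)
  qed
  have s0: "ennsqrt 0 = 0" using ennsqrt_ennreal[of 0] by simp
  have "X_norm_hat s b g = (\<Sum>j. \<Sum>m. ennreal (2 powr (real j * b)) * ennsqrt (?I j m))"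
    unfolding X_norm_hat_def z2 s0 by simp
  also have "\<dots> = (\<Sum>j. ennreal (2 powr (real j * b)) * ennsqrt (?I j m))"
  proof (rule arg_cong[where f = suminf], rule ext)
    fix j
    have "(\<Sum>m. ennreal (2 powr (real j * b)) * ennsqrt (?I j m)) = (\<Sum>m\<in>{m}. ennreal (2 powr (real j * b)) * ennsqrt (?I j m))"
      by (rule suminf_finite) (auto simp: z1 s0)
    then show "(\<Sum>m. ennreal (2 powr (real j * b)) * ennsqrt (?I j m)) = ennreal (2 powr (real j * b)) * ennsqrt (?I j m)" by simp
  qed
  also have "\<dots> = (\<Sum>j<J. ennreal (2 powr (real j * b)) * ennsqrt (?I j m))"
    by (rule suminf_finite) (auto simp: z1 s0 not_less)
  also have "\<dots> \<le> (\<Sum>j<J. ennreal (2 powr (real j * b)) * ennreal ?M)"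
    by (intro sum_mono mult_left_mono b1) simp
  also have "\<dots> = (\<Sum>j<J. ennreal (2 powr (real j * b) * ?M))"
    using W c Q(3) by (intro sum.cong refl) (simp add: ennreal_mult)
  also have "\<dots> = ennreal ((\<Sum>j<J. 2 powr (real j * b)) * ?M)"
    using W c Q(3) by (subst sum_ennreal) (simp_all add: sum_distrib_right)
  finally show ?thesis .
qed

lemma emeasure_box3:
  fixes x1 x2 y1 y2 t1 t2 :: real
  assumes "x1 \<le> x2" "y1 \<le> y2" "t1 \<le> t2"
  shows "{x1..x2} \<times> {y1..y2} \<times> {t1..t2} \<in> sets borel"
    and "emeasure lborel ({x1..x2} \<times> {y1..y2} \<times> {t1..t2}) = ennreal ((x2 - x1) * (y2 - y1) * (t2 - t1))"
proof -
  show "{x1..x2} \<times> {y1..y2} \<times> {t1..t2} \<in> sets borel"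
    by (intro borel_closed closed_Times) auto
  have b: "{y1..y2} \<times> {t1..t2} \<in> sets borel" by (intro borel_closed closed_Times) auto
  have "emeasure lborel ({x1..x2} \<times> {y1..y2} \<times> {t1..t2}) = emeasure (lborel \<Otimes>\<^sub>M lborel) ({x1..x2} \<times> {y1..y2} \<times> {t1..t2})"
    by (simp add: lborel_prod)
  also have "\<dots> = emeasure lborel {x1..x2} * emeasure lborel ({y1..y2} \<times> {t1..t2})"
    using b by (subst lborel.emeasure_pair_measure_Times) auto
  also have "emeasure lborel ({y1..y2} \<times> {t1..t2}) = emeasure (lborel \<Otimes>\<^sub>M lborel) ({y1..y2} \<times> {t1..t2})"
    by (simp add: lborel_prod)
  also have "\<dots> = emeasure lborel {y1..y2} * emeasure lborel {t1..t2}"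
    by (subst lborel.emeasure_pair_measure_Times) auto
  finally show "emeasure lborel ({x1..x2} \<times> {y1..y2} \<times> {t1..t2}) = ennreal ((x2 - x1) * (y2 - y1) * (t2 - t1))"
    using assms by (simp add: ennreal_mult mult.assoc)
qed

text \<open>Taylor expansion at (N, sqrt 3 N^2). The value is 4N^3, the \<xi>-derivative 3\<xi>^2 -
  \<mu>^2/\<xi>^2 vanishes, the second \<xi>-derivative is 12N and the \<mu>-derivative 2\<mu>/\<xi>
  is 2 sqrt 3 N. Since N \<gamma>^2 = 1, increments \<gamma> r and \<gamma>^2 q contribute 6 r^2 and
  2 sqrt 3 q; this dictates the sides of the box. The range of r covers both \<open>v\<close>, with
  r near 2, and the product, with r near 4.\<close>

lemma omega_approx:
  assumes \<gamma>: "0 < \<gamma>" "\<gamma> \<le> 1 / 64" and N: "N * \<gamma>\<^sup>2 = 1" and r: "1 \<le> r" "r \<le> 5" and q: "\<bar>q\<bar> \<le> 1"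
  shows "\<bar>omega (N + \<gamma> * r) (sqrt 3 * N\<^sup>2 + \<gamma>\<^sup>2 * q) - (4 * N ^ 3 + 6 * r\<^sup>2 + 2 * sqrt 3 * q)\<bar> \<le> 1 / 4"
proof -
  define x where "x = \<gamma> * r"
  define \<sigma> where "\<sigma> = sqrt 3"
  have \<sigma>: "\<sigma>\<^sup>2 = 3" "0 < \<sigma>" "\<sigma> < 2" unfolding \<sigma>_def by (auto intro: real_less_lsqrt)
  have N1: "N = 1 / \<gamma>\<^sup>2" using N \<gamma> by (simp add: field_simps)
  have "\<gamma>\<^sup>2 \<le> (1 / 64)\<^sup>2" using \<gamma> by (intro power_mono) auto
  then have g2: "\<gamma>\<^sup>2 \<le> 1 / 4096" by (simp add: power2_eq_square)
  then have N2: "N \<ge> 4096" unfolding N1 using \<gamma> by (simp add: field_simps)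
  have x: "0 < x" "x \<le> 5 / 64"
  proof -
    show "0 < x" using \<gamma> r by (simp add: x_def)
    have "\<gamma> * r \<le> 1 / 64 * 5" using \<gamma> r by (intro mult_mono) auto
    then show "x \<le> 5 / 64" by (simp add: x_def)
  qed
  have r2: "r\<^sup>2 = N * x\<^sup>2" using N by (simp add: x_def power_mult_distrib mult.assoc[symmetric])
  have \<xi>: "N + x > 0" using N2 x by simp
  \<comment> \<open>The remainder after multiplication by N + x: the terms of order N^4, N^3 x, N^2
    x^2 and 2 \<sigma> q N cancel exactly. What is left is small against N, the first term because x
    \<le> 5/64 and the others because they are bounded.\<close>
  define e where "e = - 2 * N * x ^ 3 + x ^ 4 + (\<gamma>\<^sup>2)\<^sup>2 * q\<^sup>2 - 2 * \<sigma> * q * x"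
  have Ng: "N\<^sup>2 * \<gamma>\<^sup>2 = N" using N by (simp add: power2_eq_square mult.assoc)
  have "(N + x) ^ 4 + (\<sigma> * N\<^sup>2 + \<gamma>\<^sup>2 * q)\<^sup>2 - (4 * N ^ 3 + 6 * (N * x\<^sup>2) + 2 * \<sigma> * q) * (N + x)
     = e + (\<sigma>\<^sup>2 - 3) * N ^ 4 + 2 * \<sigma> * q * (N\<^sup>2 * \<gamma>\<^sup>2 - N)"
    unfolding e_def by (simp add: algebra_simps power2_eq_square power3_eq_cube power4_eq_xxxx)
  then have "(N + x) ^ 4 + (\<sigma> * N\<^sup>2 + \<gamma>\<^sup>2 * q)\<^sup>2 - (4 * N ^ 3 + 6 * r\<^sup>2 + 2 * \<sigma> * q) * (N + x) = e"
    using \<sigma>(1) Ng r2 by simp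
  moreover have "omega (N + x) (\<sigma> * N\<^sup>2 + \<gamma>\<^sup>2 * q) = ((N + x) ^ 4 + (\<sigma> * N\<^sup>2 + \<gamma>\<^sup>2 * q)\<^sup>2) / (N + x)"
    using \<xi> by (simp add: omega_def add_divide_distrib power4_eq_xxxx power3_eq_cube)
  ultimately have "omega (N + x) (\<sigma> * N\<^sup>2 + \<gamma>\<^sup>2 * q) - (4 * N ^ 3 + 6 * r\<^sup>2 + 2 * \<sigma> * q) = e / (N + x)"
    using \<xi> by (simp add: field_simps)
  moreover have "\<bar>e\<bar> \<le> 1 / 4 * (N + x)"
  proof -
    have "x ^ 3 \<le> (5 / 64) ^ 3" using x by (intro power_mono) auto
    then have "x ^ 3 \<le> 1 / 100" by (simp add: power3_eq_cube)
    then have 1: "0 \<le> 2 * N * x ^ 3" "2 * N * x ^ 3 \<le> 2 * N * (1 / 100)"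
      using N2 x by (auto intro!: mult_left_mono)
    have 2: "0 \<le> x ^ 4" "x ^ 4 \<le> 1" using x by (auto intro: power_le_one)
    have "q\<^sup>2 \<le> 1" using q by (simp add: abs_square_le_1)
    moreover have "(\<gamma>\<^sup>2)\<^sup>2 \<le> 1" using g2 \<gamma> by (intro power_le_one) auto
    ultimately have "(\<gamma>\<^sup>2)\<^sup>2 * q\<^sup>2 \<le> 1 * 1" by (intro mult_mono) simp_all
    then have 3: "0 \<le> (\<gamma>\<^sup>2)\<^sup>2 * q\<^sup>2" "(\<gamma>\<^sup>2)\<^sup>2 * q\<^sup>2 \<le> 1" by simp_all
    have "\<bar>2 * \<sigma> * q * x\<bar> = 2 * \<sigma> * \<bar>q\<bar> * x" using \<sigma> x by (simp add: abs_mult)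
    also have "\<dots> \<le> 2 * 2 * 1 * 1" using \<sigma> x q by (intro mult_mono) auto
    finally have 4: "\<bar>2 * \<sigma> * q * x\<bar> \<le> 4" by simp
    have "\<bar>- A + B + C - D\<bar> \<le> 1 / 4 * (N + x)"
      if "0 \<le> A" "A \<le> 2 * N * (1 / 100)" "0 \<le> B" "B \<le> 1" "0 \<le> C" "C \<le> 1" "D \<le> 4" "- D \<le> 4" for A B C D
    proof (rule abs_leI)
      show "- A + B + C - D \<le> 1 / 4 * (N + x)" using that N2 x by argo
      show "- (- A + B + C - D) \<le> 1 / 4 * (N + x)" using that N2 x by argo
    qed
    from this[OF 1 2 3 abs_le_D1[OF 4] abs_le_D2[OF 4]] show ?thesis by (simp add: e_def)
  qed
  ultimately show ?thesis using \<xi> by (simp add: x_def \<sigma>_def pos_divide_le_eq)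
qed

section \<open>Modulated and rescaled bumps\<close>

text \<open>The coordinates p, q, s rescale the anisotropic box to unit size; \<gamma>^3 is the
  Jacobian \<gamma> \<cdot> \<gamma>^2 \<cdot> 1.\<close>

lemma X_norm_hat_lower_box:
  fixes \<gamma> p1 p2 q1 q2 s1 s2 :: real
  assumes \<gamma>: "0 < \<gamma>" and box: "p1 \<le> p2" "q1 \<le> q2" "s1 \<le> s2"
    and \<sigma>: "0 \<le> \<sigma>" and W: "0 < W" and c: "0 \<le> c"
    and on: "\<And>p q s. \<lbrakk>p1 \<le> p; p \<le> p2; q1 \<le> q; q \<le> q2; s1 \<le> s; s \<le> s2\<rbrakk> \<Longrightarrow>
      chi j (d + s - omega (a + \<gamma> * p) (e + \<gamma>\<^sup>2 * q)) = 1 \<and> rho1 (a + \<gamma> * p) (e + \<gamma>\<^sup>2 * q) = 1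
      \<and> theta m (a + \<gamma> * p) = 1 \<and> W \<le> weight (a + \<gamma> * p) (e + \<gamma>\<^sup>2 * q)
      \<and> c \<le> cmod (g (a + \<gamma> * p, e + \<gamma>\<^sup>2 * q, d + s))"
  shows "ennreal (2 powr (real j * b) * (W powr \<sigma> * c * sqrt (\<gamma> ^ 3 * ((p2 - p1) * (q2 - q1) * (s2 - s1))))) \<le> X_norm_hat \<sigma> b g"
proof -
  have le: "a + \<gamma> * p1 \<le> a + \<gamma> * p2" "e + \<gamma>\<^sup>2 * q1 \<le> e + \<gamma>\<^sup>2 * q2" "d + s1 \<le> d + s2"
    using \<gamma> box by (auto intro!: mult_left_mono)
  note E = emeasure_box3[OF le]
  have V: "(a + \<gamma> * p2 - (a + \<gamma> * p1)) * (e + \<gamma>\<^sup>2 * q2 - (e + \<gamma>\<^sup>2 * q1)) * (d + s2 - (d + s1))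
      = \<gamma> ^ 3 * ((p2 - p1) * (q2 - q1) * (s2 - s1))"
    by (simp add: algebra_simps power2_eq_square power3_eq_cube)
  show ?thesis
  proof (rule X_norm_hat_lower[OF E(1) E(2)[unfolded V] _ \<sigma> W c])
    show "0 \<le> \<gamma> ^ 3 * ((p2 - p1) * (q2 - q1) * (s2 - s1))" using \<gamma> box by simp
    fix \<xi> \<mu> \<tau> assume Q: "(\<xi>, \<mu>, \<tau>) \<in> {a + \<gamma> * p1..a + \<gamma> * p2} \<times> {e + \<gamma>\<^sup>2 * q1..e + \<gamma>\<^sup>2 * q2} \<times> {d + s1..d + s2}"
    define p where "p = (\<xi> - a) / \<gamma>"
    define q where "q = (\<mu> - e) / \<gamma>\<^sup>2"
    define s where "s = \<tau> - d"
    have eqs: "\<xi> = a + \<gamma> * p" "\<mu> = e + \<gamma>\<^sup>2 * q" "\<tau> = d + s"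
      using \<gamma> by (simp_all add: p_def q_def s_def)
    have "p1 \<le> p" "p \<le> p2" "q1 \<le> q" "q \<le> q2" "s1 \<le> s" "s \<le> s2"
      using Q \<gamma> unfolding eqs by auto
    from on[OF this] show "chi j (\<tau> - omega \<xi> \<mu>) = 1 \<and> rho1 \<xi> \<mu> = 1 \<and> theta m \<xi> = 1 \<and> W \<le> weight \<xi> \<mu> \<and> c \<le> cmod (g (\<xi>, \<mu>, \<tau>))"
      unfolding eqs .
  qed
qed

lemma X_norm_hat_upper_box:
  fixes \<gamma> :: real
  assumes \<gamma>: "0 < \<gamma>" and \<sigma>: "0 \<le> \<sigma>" and W: "0 < W" and c: "0 \<le> c"
    and off: "\<And>p q s. 1 < \<bar>p\<bar> \<or> 1 < \<bar>q\<bar> \<or> 1 < \<bar>s\<bar> \<Longrightarrow> g (a + \<gamma> * p, e + \<gamma>\<^sup>2 * q, d + s) = 0"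
    and bound: "\<And>z. cmod (g z) \<le> c"
    and on: "\<And>p q s. \<lbrakk>\<bar>p\<bar> \<le> 1; \<bar>q\<bar> \<le> 1; \<bar>s\<bar> \<le> 1\<rbrakk> \<Longrightarrow>
      (\<forall>j\<ge>J. chi j (d + s - omega (a + \<gamma> * p) (e + \<gamma>\<^sup>2 * q)) = 0) \<and> rho2 (a + \<gamma> * p) (e + \<gamma>\<^sup>2 * q) = 0
      \<and> (\<forall>m'. m' \<noteq> m \<longrightarrow> theta m' (a + \<gamma> * p) = 0) \<and> weight (a + \<gamma> * p) (e + \<gamma>\<^sup>2 * q) \<le> W"
  shows "X_norm_hat \<sigma> b g \<le> ennreal ((\<Sum>j<J. 2 powr (real j * b)) * (W powr \<sigma> * c * sqrt (\<gamma> ^ 3 * 8)))"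
proof -
  have le: "a + \<gamma> * (-1) \<le> a + \<gamma> * 1" "e + \<gamma>\<^sup>2 * (-1) \<le> e + \<gamma>\<^sup>2 * 1" "d + (-1) \<le> d + 1"
    using \<gamma> by auto
  note E = emeasure_box3[OF le]
  have V: "(a + \<gamma> * 1 - (a + \<gamma> * (-1))) * (e + \<gamma>\<^sup>2 * 1 - (e + \<gamma>\<^sup>2 * (-1))) * (d + 1 - (d + (-1))) = \<gamma> ^ 3 * 8"
    by (simp add: algebra_simps power2_eq_square power3_eq_cube)
  have coord: "\<exists>p q s. \<xi> = a + \<gamma> * p \<and> \<mu> = e + \<gamma>\<^sup>2 * q \<and> \<tau> = d + s" for \<xi> \<mu> \<tau>
    by (rule exI[of _ "(\<xi> - a) / \<gamma>"], rule exI[of _ "(\<mu> - e) / \<gamma>\<^sup>2"], rule exI[of _ "\<tau> - d"]) (use \<gamma> in simp)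
  have mem: "(a + \<gamma> * p, e + \<gamma>\<^sup>2 * q, d + s) \<in> {a + \<gamma> * (-1)..a + \<gamma> * 1} \<times> {e + \<gamma>\<^sup>2 * (-1)..e + \<gamma>\<^sup>2 * 1} \<times> {d + (-1)..d + 1}
     \<longleftrightarrow> \<bar>p\<bar> \<le> 1 \<and> \<bar>q\<bar> \<le> 1 \<and> \<bar>s\<bar> \<le> 1" for p q s
  proof -
    have "- \<gamma> \<le> \<gamma> * p \<longleftrightarrow> -1 \<le> p" "- \<gamma>\<^sup>2 \<le> \<gamma>\<^sup>2 * q \<longleftrightarrow> -1 \<le> q"
      using mult_le_cancel_left_pos[OF \<gamma>, of "-1" p] mult_le_cancel_left_pos[of "\<gamma>\<^sup>2" "-1" q] \<gamma> by auto
    then show ?thesis using \<gamma> by (auto simp: abs_le_iff)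
  qed
  show ?thesis
  proof (rule X_norm_hat_upper[OF E(1) E(2)[unfolded V] _ \<sigma> W c])
    show "0 \<le> \<gamma> ^ 3 * 8" using \<gamma> by simp
    fix z assume z: "z \<notin> {a + \<gamma> * (-1)..a + \<gamma> * 1} \<times> {e + \<gamma>\<^sup>2 * (-1)..e + \<gamma>\<^sup>2 * 1} \<times> {d + (-1)..d + 1}"
    obtain p q s where "z = (a + \<gamma> * p, e + \<gamma>\<^sup>2 * q, d + s)" using coord by (cases z) metis
    with z mem off show "g z = 0" by (metis not_le)
  next
    fix \<xi> \<mu> \<tau> assume Q: "(\<xi>, \<mu>, \<tau>) \<in> {a + \<gamma> * (-1)..a + \<gamma> * 1} \<times> {e + \<gamma>\<^sup>2 * (-1)..e + \<gamma>\<^sup>2 * 1} \<times> {d + (-1)..d + 1}"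
    obtain p q s where eqs: "\<xi> = a + \<gamma> * p" "\<mu> = e + \<gamma>\<^sup>2 * q" "\<tau> = d + s" using coord by metis
    have "\<bar>p\<bar> \<le> 1" "\<bar>q\<bar> \<le> 1" "\<bar>s\<bar> \<le> 1" using Q unfolding eqs mem by auto
    from on[OF this] bound show "(\<forall>j\<ge>J. chi j (\<tau> - omega \<xi> \<mu>) = 0) \<and> rho2 \<xi> \<mu> = 0 \<and> (\<forall>m'. m' \<noteq> m \<longrightarrow> theta m' \<xi> = 0)
      \<and> weight \<xi> \<mu> \<le> W \<and> cmod (g (\<xi>, \<mu>, \<tau>)) \<le> c"
      unfolding eqs by blast
  qed
qed

text \<open>A wave packet. In physical space its size does not depend on \<gamma>; its transform is
  centred at (a, e, d), with widths \<gamma>, \<gamma>^2, 1 and height of order \<gamma>^-3.\<close>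

definition wave :: "real \<Rightarrow> real \<Rightarrow> real \<Rightarrow> real \<Rightarrow> (real \<Rightarrow> complex) \<Rightarrow> (real \<Rightarrow> complex) \<Rightarrow> (real \<Rightarrow> complex) \<Rightarrow> R3 \<Rightarrow> complex" where
  "wave \<gamma> a e d f g h = tensor (modscale a \<gamma> f) (modscale e (\<gamma>\<^sup>2) g) (modscale d 1 h)"

lemma wave_integrable:
  assumes "0 < \<gamma>" "integrable lborel f" "integrable lborel g" "integrable lborel h"
  shows "integrable lborel (wave \<gamma> a e d f g h)"
  unfolding wave_def using assms by (intro integrable_tensor modscale_integrable) auto

lemma fourier_wave:
  assumes "0 < \<gamma>" "integrable lborel f" "integrable lborel g" "integrable lborel h"
  shows "fourier (wave \<gamma> a e d f g h) (a + \<gamma> * p, e + \<gamma>\<^sup>2 * q, d + s) = ft f p * ft g q * ft h s / complex_of_real (\<gamma> ^ 3)"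
proof -
  have m: "f \<in> borel_measurable borel" "g \<in> borel_measurable borel" "h \<in> borel_measurable borel"
    using assms by auto
  have "\<gamma>\<^sup>2 > 0" using assms by simp
  then show ?thesis
    unfolding wave_def using assms
    by (subst fourier_tensor) (simp_all add: modscale_integrable ft_modscale[OF m(1)] ft_modscale[OF m(2)] ft_modscale[OF m(3)]
        power2_eq_square power3_eq_cube mult_ac)
qed

text \<open>Both factors have the same scale \<gamma>, so the frequencies add and the profiles
  multiply. The transform of the product thus needs only one-dimensional convolutions.\<close>

lemma wave_mult: "wave \<gamma> a e d f g h z * wave \<gamma> a' e' d' f' g' h' z
    = wave \<gamma> (a + a') (e + e') (d + d') (\<lambda>x. f x * f' x) (\<lambda>x. g x * g' x) (\<lambda>x. h x * h' x) z"
proof -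
  obtain x y t where z: "z = (x, y, t)" by (cases z)
  have "wave \<gamma> a e d f g h z * wave \<gamma> a' e' d' f' g' h' z
    = (modscale a \<gamma> f x * modscale a' \<gamma> f' x) * (modscale e (\<gamma>\<^sup>2) g y * modscale e' (\<gamma>\<^sup>2) g' y) * (modscale d 1 h t * modscale d' 1 h' t)"
    by (simp add: z wave_def tensor_def)
  then show ?thesis unfolding modscale_mult by (simp add: z wave_def tensor_def)
qed

lemma dist_mult_dist_of: "dist_mult a (dist_of u) = dist_of (\<lambda>z. a z * u z)"
  by (simp add: dist_mult_def dist_of_def fun_eq_iff mult_ac)

lemma dist_mult_t_wave: "dist_mult coord_t (dist_of (wave \<gamma> a e d f g kern)) = dist_of (wave \<gamma> a e d f g kern_t)"
  unfolding dist_mult_dist_of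
  by (rule arg_cong[where f = dist_of])
     (auto simp: fun_eq_iff coord_t_def wave_def tensor_def modscale_def kern_t_def mult_ac)

text \<open>The profile in y lives at scale 1/\<gamma>^2, so y is \<gamma>^2 y divided by
  \<gamma>^2. The divisor is the source of the factor N in the Y-norm of the low-frequency
  packet.\<close>

lemma coord_y_wave:
  assumes "0 < \<gamma>"
  shows "coord_y z * wave \<gamma> a e d f kern h z = wave \<gamma> a e d f kern_t h z / complex_of_real (\<gamma>\<^sup>2)"
  using assms by (cases z) (simp add: coord_y_def wave_def tensor_def modscale_def kern_t_def)

text \<open>The common properties of \<open>kern\<close> and \<open>kern_t\<close>. The bound 8 is
  dictated by \<open>bump'\<close>, the transform of \<open>kern_t\<close> up to the factor
  \<i>.\<close>

definition cutoff :: "(real \<Rightarrow> complex) \<Rightarrow> bool" where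
  "cutoff f \<longleftrightarrow> integrable lborel f \<and> (\<forall>s. 1 < \<bar>s\<bar> \<longrightarrow> ft f s = 0) \<and> (\<forall>s. cmod (ft f s) \<le> 8)"

lemma trunc_parabola_bounds: "0 \<le> trunc_parabola k s" "trunc_parabola k s \<le> 1"
  by (auto simp: trunc_parabola_def intro!: power_le_one)

lemma cutoff_kern: "cutoff kern"
  using trunc_parabola_bounds[of 4] unfolding cutoff_def
  by (auto simp: kern_integrable ft_kern bump_def trunc_parabola_eq_0 intro: order_trans[of _ 1])

lemma cutoff_kern_t: "cutoff kern_t"
proof -
  have "\<bar>bump' s\<bar> \<le> 8" for s
  proof (cases "\<bar>s\<bar> \<le> 1")
    case True
    have "\<bar>s\<bar> * \<bar>trunc_parabola 3 s\<bar> \<le> 1 * 1"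
      using trunc_parabola_bounds[of 3 s] True by (intro mult_mono) auto
    then show ?thesis by (simp add: bump'_def abs_mult)
  qed (simp add: bump'_def trunc_parabola_eq_0)
  moreover have "bump' s = 0" if "1 < \<bar>s\<bar>" for s
    using that by (simp add: bump'_def trunc_parabola_eq_0)
  ultimately show ?thesis unfolding cutoff_def
    by (auto simp: kern_t_integrable ft_kern_t norm_mult)
qed

lemma norm_fourier_wave_le:
  assumes "0 < \<gamma>" "cutoff f" "cutoff g" "cutoff h"
  shows "cmod (fourier (wave \<gamma> a e d f g h) z) \<le> 512 / \<gamma> ^ 3"
proof -
  have int: "integrable lborel f" "integrable lborel g" "integrable lborel h" using assms by (auto simp: cutoff_def)
  obtain \<xi> \<mu> \<tau> where z: "z = (\<xi>, \<mu>, \<tau>)" by (cases z)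
  define p where "p = (\<xi> - a) / \<gamma>"
  define q where "q = (\<mu> - e) / \<gamma>\<^sup>2"
  define s where "s = \<tau> - d"
  have eqs: "z = (a + \<gamma> * p, e + \<gamma>\<^sup>2 * q, d + s)"
    using assms(1) by (simp add: z p_def q_def s_def)
  have "cmod (fourier (wave \<gamma> a e d f g h) z) = cmod (ft f p) * cmod (ft g q) * cmod (ft h s) / \<gamma> ^ 3"
    unfolding eqs fourier_wave[OF assms(1) int] using assms(1) by (simp add: norm_mult norm_divide norm_power)
  also have "\<dots> \<le> 8 * 8 * 8 / \<gamma> ^ 3"
    using assms by (intro divide_right_mono mult_mono) (auto simp: cutoff_def)
  finally show ?thesis by simp
qed

text \<open>The factor \<kappa> is there for the 1/\<gamma>^2 produced by y. Eight modulation shells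
  correspond to modulations below 2^7 = 128, and 512 is 8^3 from \<open>cutoff\<close>.\<close>

lemma X_norm_hat_wave_upper:
  assumes \<gamma>: "0 < \<gamma>" and cut: "cutoff f" "cutoff g" "cutoff h" and \<sigma>: "0 \<le> \<sigma>" and W: "0 < W" and \<kappa>: "0 \<le> \<kappa>"
    and F: "\<And>z. cmod (F z) = \<kappa> * cmod (fourier (wave \<gamma> a e d f g h) z)"
    and on: "\<And>p q s. \<lbrakk>\<bar>p\<bar> \<le> 1; \<bar>q\<bar> \<le> 1; \<bar>s\<bar> \<le> 1\<rbrakk> \<Longrightarrow>
      (\<forall>j\<ge>8. chi j (d + s - omega (a + \<gamma> * p) (e + \<gamma>\<^sup>2 * q)) = 0) \<and> rho2 (a + \<gamma> * p) (e + \<gamma>\<^sup>2 * q) = 0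
      \<and> (\<forall>m'. m' \<noteq> m \<longrightarrow> theta m' (a + \<gamma> * p) = 0) \<and> weight (a + \<gamma> * p) (e + \<gamma>\<^sup>2 * q) \<le> W"
  shows "X_norm_hat \<sigma> b F \<le> ennreal ((\<Sum>j<8. 2 powr (real j * b)) * (W powr \<sigma> * (\<kappa> * (512 / \<gamma> ^ 3)) * sqrt (\<gamma> ^ 3 * 8)))"
proof (rule X_norm_hat_upper_box[OF \<gamma> \<sigma> W _ _ _ on])
  show "0 \<le> \<kappa> * (512 / \<gamma> ^ 3)" using \<kappa> \<gamma> by simp
  show "cmod (F z) \<le> \<kappa> * (512 / \<gamma> ^ 3)" for z
    unfolding F by (intro mult_left_mono norm_fourier_wave_le \<gamma> cut \<kappa>)
  fix p q s :: real assume "1 < \<bar>p\<bar> \<or> 1 < \<bar>q\<bar> \<or> 1 < \<bar>s\<bar>"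
  then have "fourier (wave \<gamma> a e d f g h) (a + \<gamma> * p, e + \<gamma>\<^sup>2 * q, d + s) = 0"
    using cut \<gamma> by (subst fourier_wave) (auto simp: cutoff_def)
  then show "F (a + \<gamma> * p, e + \<gamma>\<^sup>2 * q, d + s) = 0"
    using F[of "(a + \<gamma> * p, e + \<gamma>\<^sup>2 * q, d + s)"] by simp
qed

section \<open>Weights and cutoffs on the low and high frequency boxes\<close>

lemma chi_eq_0: "\<bar>s\<bar> < 128 \<Longrightarrow> 8 \<le> j \<Longrightarrow> chi j s = 0"
proof -
  assume s: "\<bar>s\<bar> < 128" and j: "8 \<le> j"
  have "(2::real) ^ 7 \<le> 2 ^ (j - 1)" using j by (intro power_increasing) auto
  then show ?thesis using s j by (auto simp: chi_def indicator_def)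
qed

text \<open>Centring the box at 2\<gamma> instead of 0 keeps it off the singular line \<xi> = 0:
  there \<gamma> \<le> \<xi> \<le> 3\<gamma> and |\<mu>| \<le> \<gamma>^2, so the slope
  |\<mu>|/|\<xi>| is at most \<gamma>. Everything else follows from these bounds.\<close>

lemma low_region:
  assumes \<gamma>: "0 < \<gamma>" "\<gamma> \<le> 1 / 64" and p: "\<bar>p\<bar> \<le> 1" and q: "\<bar>q\<bar> \<le> 1"
  shows "\<bar>omega (2 * \<gamma> + \<gamma> * p) (0 + \<gamma>\<^sup>2 * q)\<bar> \<le> 1 / 4"
    "rho1 (2 * \<gamma> + \<gamma> * p) (0 + \<gamma>\<^sup>2 * q) = 1" "rho2 (2 * \<gamma> + \<gamma> * p) (0 + \<gamma>\<^sup>2 * q) = 0"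
    "theta 0 (2 * \<gamma> + \<gamma> * p) = 1" "m \<noteq> 0 \<Longrightarrow> theta m (2 * \<gamma> + \<gamma> * p) = 0"
    "weight (2 * \<gamma> + \<gamma> * p) (0 + \<gamma>\<^sup>2 * q) \<le> 2"
proof -
  define \<xi> where "\<xi> = 2 * \<gamma> + \<gamma> * p"
  define \<mu> where "\<mu> = 0 + \<gamma>\<^sup>2 * q"
  have "\<gamma> * (-1) \<le> \<gamma> * p" "\<gamma> * p \<le> \<gamma> * 1" using p \<gamma> by (intro mult_left_mono; simp)+
  then have \<xi>: "\<gamma> \<le> \<xi>" "\<xi> \<le> 3 * \<gamma>" unfolding \<xi>_def by linarith+
  have \<mu>: "\<bar>\<mu>\<bar> \<le> \<gamma>\<^sup>2" using q by (simp add: \<mu>_def abs_mult mult_left_le)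
  have \<xi>0: "\<xi> > 0" "\<bar>\<xi>\<bar> = \<xi>" using \<xi> \<gamma> by linarith+
  have slope: "\<bar>\<mu>\<bar> / \<bar>\<xi>\<bar> \<le> \<gamma>"
  proof -
    have "\<gamma> * \<gamma> \<le> \<gamma> * \<xi>" using \<xi>(1) \<gamma>(1) by (intro mult_left_mono) auto
    then have "\<bar>\<mu>\<bar> \<le> \<gamma> * \<xi>" using \<mu> by (simp add: power2_eq_square)
    then show ?thesis using \<xi>0 by (simp add: pos_divide_le_eq)
  qed
  have "1 / 2 * (\<bar>\<mu>\<bar> / \<bar>\<xi>\<bar>) \<le> \<bar>\<xi>\<bar>" using slope \<xi> \<xi>0 \<gamma> by linarith
  then show "rho1 (2 * \<gamma> + \<gamma> * p) (0 + \<gamma>\<^sup>2 * q) = 1" "rho2 (2 * \<gamma> + \<gamma> * p) (0 + \<gamma>\<^sup>2 * q) = 0"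
    unfolding \<xi>_def[symmetric] \<mu>_def[symmetric] by (simp_all add: rho1_def rho2_def)
  have lt1: "\<xi> < 1" using \<xi> \<gamma> by linarith
  show "theta 0 (2 * \<gamma> + \<gamma> * p) = 1"
    unfolding \<xi>_def[symmetric] using lt1 \<xi>0 by (simp add: theta_def indicator_def)
  show "theta m (2 * \<gamma> + \<gamma> * p) = 0" if "m \<noteq> 0"
  proof -
    have "(1::real) \<le> 2 ^ (m - 1)" by simp
    then have "\<bar>\<xi>\<bar> < 2 ^ (m - 1)" using lt1 \<xi>0 by linarith
    then show ?thesis unfolding \<xi>_def[symmetric] using that by (simp add: theta_def indicator_def)
  qed
  show "weight (2 * \<gamma> + \<gamma> * p) (0 + \<gamma>\<^sup>2 * q) \<le> 2"
    unfolding \<xi>_def[symmetric] \<mu>_def[symmetric] weight_def using slope \<xi> \<xi>0 \<gamma> by linarith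
  have "\<bar>omega \<xi> \<mu>\<bar> \<le> 1 / 4"
  proof -
    have "\<xi> ^ 3 \<le> (3 / 64) ^ 3" using \<xi> \<xi>0 \<gamma> by (intro power_mono) auto
    then have 1: "0 \<le> \<xi> ^ 3" "\<xi> ^ 3 \<le> 1 / 8" using \<xi>0 by (simp_all add: power3_eq_cube)
    have "\<bar>\<mu>\<bar> \<le> 1"
    proof -
      have "\<gamma>\<^sup>2 \<le> 1" using \<gamma> by (intro power_le_one) auto
      then show ?thesis using \<mu> by linarith
    qed
    then have "\<bar>\<mu>\<bar> * (\<bar>\<mu>\<bar> / \<bar>\<xi>\<bar>) \<le> 1 * \<gamma>" using slope \<gamma> \<xi>0 by (intro mult_mono) auto
    then have 2: "0 \<le> \<mu>\<^sup>2 / \<xi>" "\<mu>\<^sup>2 / \<xi> \<le> \<gamma>" using \<xi>0 by (simp_all add: power2_eq_square)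
    show ?thesis unfolding omega_def using 1 2 \<gamma> by (simp add: abs_le_iff)
  qed
  then show "\<bar>omega (2 * \<gamma> + \<gamma> * p) (0 + \<gamma>\<^sup>2 * q)\<bar> \<le> 1 / 4" by (simp add: \<xi>_def \<mu>_def)
qed

lemma sqrt3_bounds: "17 / 10 \<le> sqrt 3" "sqrt 3 \<le> 9 / 5"
proof -
  show "17 / 10 \<le> sqrt 3" by (rule real_le_rsqrt) (simp add: power2_eq_square)
  show "sqrt 3 \<le> 9 / 5" by (rule real_le_lsqrt) (simp_all add: power2_eq_square)
qed

text \<open>The slope |\<mu>|/|\<xi>| is about sqrt 3 N, below 2N < 2\<xi>, which puts the box into
  the \<rho>1-region. As N = 2^(2k) and \<xi> lies slightly but strictly above N, only the shell 2k
  + 1 contains \<xi>, although adjacent shells of \<open>theta\<close> share an endpoint; this is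
  why N is a power of 4.\<close>

lemma high_region:
  assumes N: "N = 4 ^ k" "N \<ge> 4096" and \<gamma>: "0 < \<gamma>" "\<gamma> \<le> 1 / 64" and r: "1 \<le> r" "r \<le> 5" and q: "\<bar>q\<bar> \<le> 1"
  shows "rho1 (N + \<gamma> * r) (sqrt 3 * N\<^sup>2 + \<gamma>\<^sup>2 * q) = 1" "rho2 (N + \<gamma> * r) (sqrt 3 * N\<^sup>2 + \<gamma>\<^sup>2 * q) = 0"
    "theta (2 * k + 1) (N + \<gamma> * r) = 1" "m \<noteq> 2 * k + 1 \<Longrightarrow> theta m (N + \<gamma> * r) = 0"
    "N \<le> weight (N + \<gamma> * r) (sqrt 3 * N\<^sup>2 + \<gamma>\<^sup>2 * q)"
    "weight (N + \<gamma> * r) (sqrt 3 * N\<^sup>2 + \<gamma>\<^sup>2 * q) \<le> 5 * N"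
proof -
  define \<xi> where "\<xi> = N + \<gamma> * r"
  define \<mu> where "\<mu> = sqrt 3 * N\<^sup>2 + \<gamma>\<^sup>2 * q"
  have "0 < \<gamma> * r" using \<gamma> r by simp
  moreover have "\<gamma> * r \<le> 1 / 64 * 5" using \<gamma> r by (intro mult_mono) auto
  ultimately have \<xi>: "N < \<xi>" "\<xi> \<le> N + 1" by (auto simp: \<xi>_def)
  have \<xi>0: "\<xi> > 0" "\<bar>\<xi>\<bar> = \<xi>" using \<xi> N by linarith+
  have "\<gamma>\<^sup>2 \<le> 1" using \<gamma> by (intro power_le_one) auto
  then have "\<bar>\<gamma>\<^sup>2 * q\<bar> \<le> 1 * 1" unfolding abs_mult using q by (intro mult_mono) auto
  moreover have "sqrt 3 * N\<^sup>2 \<le> 9 / 5 * N\<^sup>2" "17 / 10 * N\<^sup>2 \<le> sqrt 3 * N\<^sup>2"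
    using sqrt3_bounds by (intro mult_right_mono; simp)+
  moreover have N2: "4096 * N \<le> N\<^sup>2" using N by (simp add: power2_eq_square)
  ultimately have "\<bar>\<mu>\<bar> \<le> 2 * N\<^sup>2" unfolding \<mu>_def using N by linarith
  also have "\<dots> \<le> 2 * N * \<xi>" using \<xi> N by (simp add: power2_eq_square)
  finally have slope: "\<bar>\<mu>\<bar> / \<bar>\<xi>\<bar> \<le> 2 * N" using \<xi>0 by (simp add: pos_divide_le_eq)
  have "1 / 2 * (\<bar>\<mu>\<bar> / \<bar>\<xi>\<bar>) \<le> \<bar>\<xi>\<bar>" using slope \<xi> \<xi>0 by linarith
  then show "rho1 (N + \<gamma> * r) (sqrt 3 * N\<^sup>2 + \<gamma>\<^sup>2 * q) = 1" "rho2 (N + \<gamma> * r) (sqrt 3 * N\<^sup>2 + \<gamma>\<^sup>2 * q) = 0"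
    unfolding \<xi>_def[symmetric] \<mu>_def[symmetric] by (simp_all add: rho1_def rho2_def)
  have Nk: "N = 2 ^ (2 * k)" by (simp add: N(1) power_mult)
  have lt: "2 ^ (2 * k) < \<xi>" "\<xi> < 2 ^ (2 * k + 1)" using \<xi> N(2) by (simp_all add: Nk[symmetric])
  show "theta (2 * k + 1) (N + \<gamma> * r) = 1"
    unfolding \<xi>_def[symmetric] using lt \<xi>0 by (simp add: theta_def indicator_def)
  show "theta m (N + \<gamma> * r) = 0" if m: "m \<noteq> 2 * k + 1"
  proof (cases "m \<le> 2 * k")
    case True
    then have "(2::real) ^ m \<le> 2 ^ (2 * k)" by (intro power_increasing) auto
    then have "2 ^ m < \<xi>" using lt by linarith
    moreover have "1 < \<xi>" using \<xi> N by linarith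
    ultimately show ?thesis unfolding \<xi>_def[symmetric] using lt \<xi>0 by (auto simp: theta_def indicator_def)
  next
    case False
    then have "(2::real) ^ (2 * k + 1) \<le> 2 ^ (m - 1)" using m by (intro power_increasing) auto
    then show ?thesis unfolding \<xi>_def[symmetric] using lt \<xi>0 False by (auto simp: theta_def indicator_def)
  qed
  show "N \<le> weight (N + \<gamma> * r) (sqrt 3 * N\<^sup>2 + \<gamma>\<^sup>2 * q)"
    unfolding \<xi>_def[symmetric] \<mu>_def[symmetric] weight_def using \<xi> \<xi>0 divide_nonneg_nonneg[of "\<bar>\<mu>\<bar>" "\<bar>\<xi>\<bar>"] by linarith
  show "weight (N + \<gamma> * r) (sqrt 3 * N\<^sup>2 + \<gamma>\<^sup>2 * q) \<le> 5 * N"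
    unfolding \<xi>_def[symmetric] \<mu>_def[symmetric] weight_def using slope \<xi> \<xi>0 N by linarith
qed

section \<open>The counterexample\<close>

lemma bump_ge:
  assumes "\<bar>s\<bar> \<le> c" "c \<le> 1"
  shows "(1 - c\<^sup>2) ^ 4 \<le> bump s"
proof -
  have "s\<^sup>2 \<le> c\<^sup>2" using assms by (simp add: abs_le_square_iff[symmetric])
  moreover have "c\<^sup>2 \<le> 1" using assms by (simp add: abs_square_le_1)
  ultimately show ?thesis unfolding bump_def trunc_parabola_def by (intro power_mono) auto
qed

lemma bump_ge_half: "\<bar>s\<bar> \<le> 1 / 10 \<Longrightarrow> 1 / 2 \<le> bump s"
  using bump_ge[of s "1 / 10"] by (simp add: power2_eq_square power4_eq_xxxx)

lemma bump_ge_quarter: "\<bar>s\<bar> \<le> 1 / 2 \<Longrightarrow> 1 / 4 \<le> bump s"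
  using bump_ge[of s "1 / 2"] by (simp add: power2_eq_square power4_eq_xxxx)

lemma bump_nonneg: "0 \<le> bump s"
  by (simp add: bump_def trunc_parabola_bounds)

lemma abs_bump'_ge_half:
  assumes "1 / 4 \<le> s" "s \<le> 1 / 2"
  shows "1 / 2 \<le> \<bar>bump' s\<bar>"
proof -
  have "s\<^sup>2 \<le> (1 / 2)\<^sup>2" using assms by (intro power_mono) auto
  then have "(3 / 4) ^ 3 \<le> trunc_parabola 3 s"
    unfolding trunc_parabola_def by (intro power_mono) (auto simp: power2_eq_square)
  then have "8 * (1 / 4) * (3 / 4) ^ 3 \<le> 8 * s * trunc_parabola 3 s"
    using assms by (intro mult_mono) auto
  then show ?thesis using assms by (simp add: bump'_def abs_mult trunc_parabola_bounds power3_eq_cube)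
qed

definition kern_sq :: "real \<Rightarrow> complex" where "kern_sq t = kern t * kern t"

lemma kern_sq_integrable: "integrable lborel kern_sq"
  using ift_square_integrable[OF bump_fun_bump(1)] kern_integrable by (simp add: kern_sq_def[abs_def] kern_def)

text \<open>The transform is the convolution of two nonnegative bumps divided by 2 pi. For
  |\<sigma>| \<le> 1/4 both factors are at least 1/4, so the integral is at least 1/16 \<cdot> 1/2 =
  1/32, and 2 pi < 8.\<close>

lemma ft_kern_sq_ge:
  assumes "\<bar>\<tau>\<bar> \<le> 1 / 4"
  shows "1 / 256 \<le> cmod (ft kern_sq \<tau>)"
proof -
  let ?f = "\<lambda>\<sigma>. bump \<sigma> * bump (\<tau> - \<sigma>)"
  have cont: "continuous_on UNIV bump"
    unfolding bump_def trunc_parabola_def[abs_def] by (intro continuous_intros)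
  have int_bump: "integrable lborel bump"
    using integrable_Re[OF bump_fun_integrable[OF bump_fun_bump(1)]] by simp
  have int: "integrable lborel ?f"
  proof (rule Bochner_Integration.integrable_bound[OF int_bump])
    have "continuous_on UNIV ?f"
      by (intro continuous_intros cont continuous_on_compose2[OF cont]) auto
    then have "?f \<in> borel_measurable borel" by (rule borel_measurable_continuous_onI)
    then show "?f \<in> borel_measurable lborel" by simp
    show "AE \<sigma> in lborel. norm (?f \<sigma>) \<le> norm (bump \<sigma>)"
      using trunc_parabola_bounds[of 4] by (auto simp: bump_def abs_mult intro!: mult_left_le)
  qed
  have "ft kern_sq \<tau> = (\<integral>\<sigma>. complex_of_real (?f \<sigma>) \<partial>lborel) / complex_of_real (2 * pi)"
    using ft_ift_square[OF bump_fun_bump(1)] kern_integrable by (simp add: kern_sq_def[abs_def] kern_def)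
  also have "\<dots> = complex_of_real ((\<integral>\<sigma>. ?f \<sigma> \<partial>lborel) / (2 * pi))"
    by (simp only: integral_complex_of_real of_real_divide)
  finally have eq: "ft kern_sq \<tau> = complex_of_real ((\<integral>\<sigma>. ?f \<sigma> \<partial>lborel) / (2 * pi))" .
  have "(\<integral>\<sigma>. indicator {-1/4..1/4::real} \<sigma> * (1 / 16) \<partial>lborel) \<le> (\<integral>\<sigma>. ?f \<sigma> \<partial>lborel)"
  proof (rule integral_mono[OF _ int])
    show "integrable lborel (\<lambda>\<sigma>. indicator {-1/4..1/4::real} \<sigma> * (1 / 16 :: real))"
      by (intro integrable_mult_left integrable_real_indicator emeasure_bounded_finite) auto
    fix \<sigma> :: real
    show "indicator {-1/4..1/4} \<sigma> * (1 / 16) \<le> ?f \<sigma>"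
    proof (cases "\<sigma> \<in> {-1/4..1/4}")
      case True
      then have "- (1 / 4) \<le> \<sigma>" "\<sigma> \<le> 1 / 4" by auto
      then have "\<bar>\<sigma>\<bar> \<le> 1 / 2" "\<bar>\<tau> - \<sigma>\<bar> \<le> 1 / 2" using assms by linarith+
      then have "1 / 4 * (1 / 4) \<le> ?f \<sigma>" by (intro mult_mono bump_ge_quarter) (auto simp: bump_nonneg)
      then show ?thesis using True by simp
    qed (simp add: bump_nonneg)
  qed
  then have I: "1 / 32 \<le> (\<integral>\<sigma>. ?f \<sigma> \<partial>lborel)" by simp
  have "1 / 32 / 8 \<le> (\<integral>\<sigma>. ?f \<sigma> \<partial>lborel) / (2 * pi)"
    using I pi_less_4 by (intro frac_le) auto
  also have "\<dots> \<le> cmod (ft kern_sq \<tau>)" unfolding eq norm_of_real by (rule abs_ge_self)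
  finally show ?thesis by simp
qed

text \<open>The modulation weights of eight shells, the bound 512 on the transform and the volume 8
  of the cube [-1, 1]^3 under the square root.\<close>

definition wave_const :: real where
  "wave_const = (\<Sum>j<8. 2 powr (real j * (1 / 2))) * (512 * sqrt 8)"

lemma wave_const_pos: "0 < wave_const"
  unfolding wave_const_def by (intro mult_pos_pos sum_pos) (auto simp: lessThan_empty_iff)

lemma cube_div_sqrt:
  assumes "0 < (\<gamma>::real)"
  shows "sqrt (\<gamma> ^ 3) / \<gamma> ^ 3 = 1 / sqrt (\<gamma> ^ 3)"
  using assms by (simp add: divide_simps)

lemma kern_bounded: "\<exists>B. \<forall>t. cmod (kern t) \<le> B"
  unfolding kern_def using norm_ift_le by blast

text \<open>Multiplication by t keeps the weight W and changes the profile only; the y-part has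
  index 0, so W disappears but 1/\<gamma>^2 enters. The last two conclusions are recorded for
  \<open>wave_Y_lower\<close>.\<close>

lemma wave_bounds:
  fixes \<gamma> a e d :: real
  defines "u \<equiv> wave \<gamma> a e d kern kern kern"
  assumes \<gamma>: "0 < \<gamma>" and W: "0 < W"
    and on: "\<And>p q s. \<lbrakk>\<bar>p\<bar> \<le> 1; \<bar>q\<bar> \<le> 1; \<bar>s\<bar> \<le> 1\<rbrakk> \<Longrightarrow>
      (\<forall>j\<ge>8. chi j (d + s - omega (a + \<gamma> * p) (e + \<gamma>\<^sup>2 * q)) = 0) \<and> rho2 (a + \<gamma> * p) (e + \<gamma>\<^sup>2 * q) = 0
      \<and> (\<forall>m'. m' \<noteq> m \<longrightarrow> theta m' (a + \<gamma> * p) = 0) \<and> weight (a + \<gamma> * p) (e + \<gamma>\<^sup>2 * q) \<le> W"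
  shows "admissible u" "X_real u \<le> wave_const * (W / sqrt (\<gamma> ^ 3))"
    "Y_real u \<le> wave_const * ((W + 1 / \<gamma>\<^sup>2) / sqrt (\<gamma> ^ 3))"
    "Y_norm 1 0 (1/2) (dist_of u) < \<infinity>"
    "X_norm 1 (1/2) (dist_mult coord_t (dist_of u)) = X_norm_hat 1 (1/2) (fourier (wave \<gamma> a e d kern kern kern_t))"
proof -
  let ?S = "sqrt (\<gamma> ^ 3)"
  have upper: "X_norm \<sigma> (1/2) (dist_of w) \<le> ennreal (wave_const * (W powr \<sigma> * \<kappa> / ?S))"
    if cut: "cutoff f" "cutoff g" "cutoff h" and w: "integrable lborel w" "\<And>z. fourier w z = complex_of_real \<kappa> * fourier (wave \<gamma> a e d f g h) z"
      and \<sigma>: "0 \<le> \<sigma>" "0 \<le> \<kappa>" for \<sigma> \<kappa> f g h w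
  proof -
    have "X_norm \<sigma> (1/2) (dist_of w) = X_norm_hat \<sigma> (1/2) (fourier w)"
      by (rule X_norm_eq[OF has_fourier_fun_dist_of[OF w(1)]])
    also have "\<dots> \<le> ennreal ((\<Sum>j<8. 2 powr (real j * (1/2))) * (W powr \<sigma> * (\<kappa> * (512 / \<gamma> ^ 3)) * sqrt (\<gamma> ^ 3 * 8)))"
    proof (rule X_norm_hat_wave_upper[OF \<gamma> cut \<sigma>(1) W \<sigma>(2) _ on])
      show "cmod (fourier w z) = \<kappa> * cmod (fourier (wave \<gamma> a e d f g h) z)" for z
        using \<sigma>(2) unfolding w(2) by (simp add: norm_mult)
    qed
    also have "(\<Sum>j<8. 2 powr (real j * (1/2))) * (W powr \<sigma> * (\<kappa> * (512 / \<gamma> ^ 3)) * sqrt (\<gamma> ^ 3 * 8))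
      = wave_const * (W powr \<sigma> * \<kappa> * (?S / \<gamma> ^ 3))"
      unfolding wave_const_def real_sqrt_mult by simp
    also have "\<dots> = wave_const * (W powr \<sigma> * \<kappa> / ?S)" unfolding cube_div_sqrt[OF \<gamma>] by simp
    finally show ?thesis .
  qed
  have int: "integrable lborel (wave \<gamma> a e d f g h)" if "cutoff f" "cutoff g" "cutoff h" for f g h
    using that \<gamma> by (intro wave_integrable) (auto simp: cutoff_def)
  note intu = int[OF cutoff_kern cutoff_kern cutoff_kern]
  have Xu: "X_norm 1 (1/2) (dist_of u) \<le> ennreal (wave_const * (W / ?S))"
    using upper[OF cutoff_kern cutoff_kern cutoff_kern intu, of 1 1] W by (simp add: u_def)
  have tu: "dist_mult coord_t (dist_of u) = dist_of (wave \<gamma> a e d kern kern kern_t)"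
    by (simp add: u_def dist_mult_t_wave)
  note intt = int[OF cutoff_kern cutoff_kern cutoff_kern_t]
  have Xt: "X_norm 1 (1/2) (dist_mult coord_t (dist_of u)) \<le> ennreal (wave_const * (W / ?S))"
    using upper[OF cutoff_kern cutoff_kern cutoff_kern_t intt, of 1 1] W by (simp add: tu)
  show "X_norm 1 (1/2) (dist_mult coord_t (dist_of u)) = X_norm_hat 1 (1/2) (fourier (wave \<gamma> a e d kern kern kern_t))"
    unfolding tu by (rule X_norm_eq[OF has_fourier_fun_dist_of[OF intt]])
  let ?w = "\<lambda>z. complex_of_real (1 / \<gamma>\<^sup>2) * wave \<gamma> a e d kern kern_t kern z"
  have yu: "dist_mult coord_y (dist_of u) = dist_of ?w"
    unfolding dist_mult_dist_of u_def coord_y_wave[OF \<gamma>] by simp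
  note inty = int[OF cutoff_kern cutoff_kern_t cutoff_kern]
  have Xy: "X_norm 0 (1/2) (dist_mult coord_y (dist_of u)) \<le> ennreal (wave_const * (1 / \<gamma>\<^sup>2 / ?S))"
  proof -
    have "fourier ?w z = complex_of_real (1 / \<gamma>\<^sup>2) * fourier (wave \<gamma> a e d kern kern_t kern) z" for z
      unfolding fourier_def integral_mult_right_zero[symmetric]
      by (intro Bochner_Integration.integral_cong refl) (simp only: mult.left_commute)
    from upper[OF cutoff_kern cutoff_kern_t cutoff_kern integrable_mult_right[OF inty] this, of 0] show ?thesis
      using W \<gamma> by (simp add: yu)
  qed
  have pos: "0 \<le> wave_const * (W / ?S)" "0 \<le> wave_const * (1 / \<gamma>\<^sup>2 / ?S)"
    using wave_const_pos W \<gamma> by simp_all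
  have "Y_norm 1 0 (1/2) (dist_of u) \<le> ennreal (wave_const * (W / ?S)) + ennreal (wave_const * (1 / \<gamma>\<^sup>2 / ?S))"
    unfolding Y_norm_def by (intro add_mono Xt Xy)
  also have "\<dots> = ennreal (wave_const * ((W + 1 / \<gamma>\<^sup>2) / ?S))"
    using pos by (simp add: ennreal_plus[symmetric] add_divide_distrib distrib_left del: ennreal_plus)
  finally have Yu: "Y_norm 1 0 (1/2) (dist_of u) \<le> ennreal (wave_const * ((W + 1 / \<gamma>\<^sup>2) / ?S))" .
  show "Y_norm 1 0 (1/2) (dist_of u) < \<infinity>" using Yu by (rule order_le_less_trans) simp
  show "X_real u \<le> wave_const * (W / ?S)"
    unfolding X_real_def by (rule enn2real_leI[OF pos(1) Xu])
  have "0 \<le> wave_const * ((W + 1 / \<gamma>\<^sup>2) / ?S)" using wave_const_pos W \<gamma> by simp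
  then show "Y_real u \<le> wave_const * ((W + 1 / \<gamma>\<^sup>2) / ?S)"
    unfolding Y_real_def by (intro enn2real_leI Yu)
  show "admissible u" unfolding admissible_def
  proof (intro conjI)
    obtain B where B: "\<And>t. cmod (kern t) \<le> B" using kern_bounded by blast
    have B0: "0 \<le> B" by (rule order_trans[OF norm_ge_zero B[of 0]])
    show "tempered_fun u"
    proof (rule tempered_fun_bounded[where B = "B * B * B"])
      show "u \<in> borel_measurable borel" using borel_measurable_integrable[OF intu] by (simp add: u_def)
      fix z :: R3
      obtain x y t where z: "z = (x, y, t)" by (cases z)
      have "cmod (u z) = cmod (kern (\<gamma> * x)) * cmod (kern (\<gamma>\<^sup>2 * y)) * cmod (kern (1 * t))"
        by (simp add: z u_def wave_def tensor_def modscale_def norm_mult)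
      also have "\<dots> \<le> B * B * B" using B B0 by (intro mult_mono) auto
      finally show "cmod (u z) \<le> B * B * B" .
    qed
    show "\<not> (AE z in lborel. u z = 0)"
    proof
      assume AE: "AE z in lborel. u z = 0"
      \<comment> \<open>If u vanished almost everywhere, so would its transform everywhere; at the
        centre of the box that transform is a nonzero multiple of the cube of
        \<open>bump 0\<close>.\<close>
      let ?\<zeta> = "(a + \<gamma> * 0, e + \<gamma>\<^sup>2 * 0, d + 0)"
      have "AE z in lborel. exp (- \<i> * complex_of_real (z \<bullet> ?\<zeta>)) * u z = 0"
        by (rule AE_mp[OF AE]) simp
      then have "fourier u ?\<zeta> = 0" unfolding fourier_def by (rule integral_eq_zero_AE)
      moreover have "fourier u ?\<zeta> = ft kern 0 * ft kern 0 * ft kern 0 / complex_of_real (\<gamma> ^ 3)"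
        unfolding u_def by (rule fourier_wave[OF \<gamma> kern_integrable kern_integrable kern_integrable])
      ultimately have "bump 0 = 0" using \<gamma> by (simp add: ft_kern)
      then show False using bump_ge_half[of 0] by simp
    qed
    show "dist_of u \<in> X_space 1 (1/2) \<inter> Y_space 1 0 (1/2)"
      unfolding X_space_def Y_space_def using Xu Xt Xy by (auto intro: order_le_less_trans)
  qed
qed

text \<open>This matters for negative \<epsilon>; the t-part of the norm is enough. The transform of
  \<open>kern_t\<close> is a multiple of \<open>bump'\<close>, which vanishes at 0, hence the
  off-centre range of s. Finiteness is assumed because \<open>enn2real\<close> sends infinity to 0.
  The constant is 160 = 8 \<cdot> 20: three factors 1/2 from the bumps, and the root of the rescaled
  volume 1/400; the modulation weight is bounded below by 1.\<close>

lemma wave_Y_lower: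
  fixes \<gamma> a e d :: real
  defines "u \<equiv> wave \<gamma> a e d kern kern kern"
  assumes \<gamma>: "0 < \<gamma>" and W: "0 < W"
    and fin: "Y_norm 1 0 (1/2) (dist_of u) < \<infinity>"
    and t: "X_norm 1 (1/2) (dist_mult coord_t (dist_of u)) = X_norm_hat 1 (1/2) (fourier (wave \<gamma> a e d kern kern kern_t))"
    and on: "\<And>p q s. \<lbrakk>0 \<le> p; p \<le> 1 / 10; 0 \<le> q; q \<le> 1 / 10; 1 / 4 \<le> s; s \<le> 1 / 2\<rbrakk> \<Longrightarrow>
      chi j (d + s - omega (a + \<gamma> * p) (e + \<gamma>\<^sup>2 * q)) = 1 \<and> rho1 (a + \<gamma> * p) (e + \<gamma>\<^sup>2 * q) = 1
      \<and> theta m (a + \<gamma> * p) = 1 \<and> W \<le> weight (a + \<gamma> * p) (e + \<gamma>\<^sup>2 * q)"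
  shows "W / (160 * sqrt (\<gamma> ^ 3)) \<le> Y_real u"
proof -
  let ?S = "sqrt (\<gamma> ^ 3)"
  have S: "0 < ?S" using \<gamma> by simp
  have "ennreal (2 powr (real j * (1/2)) * (W powr 1 * (1 / 8 / \<gamma> ^ 3) * sqrt (\<gamma> ^ 3 * ((1 / 10 - 0) * (1 / 10 - 0) * (1 / 2 - 1 / 4)))))
     \<le> X_norm_hat 1 (1/2) (fourier (wave \<gamma> a e d kern kern kern_t))"
  proof (rule X_norm_hat_lower_box[OF \<gamma> _ _ _ _ W])
    fix p q s :: real
    assume pqs: "0 \<le> p" "p \<le> 1 / 10" "0 \<le> q" "q \<le> 1 / 10" "1 / 4 \<le> s" "s \<le> 1 / 2"
    have "1 / 2 * (1 / 2) * (1 / 2) / \<gamma> ^ 3 \<le> \<bar>bump p\<bar> * \<bar>bump q\<bar> * \<bar>bump' s\<bar> / \<gamma> ^ 3"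
      using pqs \<gamma> bump_ge_half[of p] bump_ge_half[of q] abs_bump'_ge_half[of s] by (intro divide_right_mono mult_mono) auto
    also have "\<dots> = cmod (fourier (wave \<gamma> a e d kern kern kern_t) (a + \<gamma> * p, e + \<gamma>\<^sup>2 * q, d + s))"
      using \<gamma> by (subst fourier_wave[OF \<gamma> kern_integrable kern_integrable kern_t_integrable])
        (simp add: ft_kern ft_kern_t norm_mult norm_divide norm_power)
    finally have "1 / 8 / \<gamma> ^ 3 \<le> cmod (fourier (wave \<gamma> a e d kern kern kern_t) (a + \<gamma> * p, e + \<gamma>\<^sup>2 * q, d + s))" by simp
    with on[OF pqs] show "chi j (d + s - omega (a + \<gamma> * p) (e + \<gamma>\<^sup>2 * q)) = 1 \<and> rho1 (a + \<gamma> * p) (e + \<gamma>\<^sup>2 * q) = 1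
      \<and> theta m (a + \<gamma> * p) = 1 \<and> W \<le> weight (a + \<gamma> * p) (e + \<gamma>\<^sup>2 * q)
      \<and> 1 / 8 / \<gamma> ^ 3 \<le> cmod (fourier (wave \<gamma> a e d kern kern kern_t) (a + \<gamma> * p, e + \<gamma>\<^sup>2 * q, d + s))" by blast
  qed (use \<gamma> in auto)
  also have "\<dots> \<le> Y_norm 1 0 (1/2) (dist_of u)" unfolding Y_norm_def t by simp
  finally have h1: "2 powr (real j * (1/2)) * (W powr 1 * (1 / 8 / \<gamma> ^ 3) * sqrt (\<gamma> ^ 3 * ((1 / 10 - 0) * (1 / 10 - 0) * (1 / 2 - 1 / 4)))) \<le> Y_real u"
    unfolding Y_real_def using fin enn2real_mono[of "ennreal _" "Y_norm 1 0 (1/2) (dist_of u)"] W \<gamma> by fastforce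
  have h2: "sqrt (\<gamma> ^ 3 * ((1 / 10 - 0) * (1 / 10 - 0) * (1 / 2 - 1 / 4))) = ?S / 20"
  proof -
    have "sqrt (1 / 400) = 1 / 20" by (rule real_sqrt_unique) (simp_all add: power2_eq_square)
    then show ?thesis by (simp add: real_sqrt_mult real_sqrt_divide)
  qed
  have h3: "1 * (W / (160 * ?S)) \<le> 2 powr (real j * (1/2)) * (W / (160 * ?S))"
    using W S by (intro mult_right_mono ge_one_powr_ge_zero) auto
  have h4: "W powr 1 * (1 / 8 / \<gamma> ^ 3) * (?S / 20) = W / (160 * ?S)"
  proof -
    have "W powr 1 * (1 / 8 / \<gamma> ^ 3) * (?S / 20) = W / 160 * (?S / \<gamma> ^ 3)" using W by simp
    then show ?thesis unfolding cube_div_sqrt[OF \<gamma>] by simp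
  qed
  show ?thesis using order_trans[OF h3 h1[unfolded h2 h4]] by simp
qed

text \<open>The map y \<mapsto> \<open>y powr \<epsilon>\<close> is increasing for \<epsilon> \<ge>
  0, where the upper bound on y is used, and decreasing for \<epsilon> < 0, where the lower one is.
  The sum of the two powers serves both cases, and \<open>max \<epsilon> 0\<close> records that only
  a positive exponent costs a power of q/p.\<close>

lemma powr_interpolation:
  fixes x y A a p q \<epsilon> :: real
  assumes x: "0 \<le> x" "x \<le> A * p" and y: "a * p \<le> y" "y \<le> A * q" and "0 < a" "0 < A" "0 < p" "0 < q" "\<epsilon> < 1"
  shows "x powr (1 - \<epsilon>) * y powr \<epsilon> \<le> A powr (1 - \<epsilon>) * (A powr \<epsilon> + a powr \<epsilon>) * p * (q / p) powr max \<epsilon> 0"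
proof -
  have xb: "x powr (1 - \<epsilon>) \<le> A powr (1 - \<epsilon>) * p powr (1 - \<epsilon>)"
    using assms by (subst powr_mult[symmetric]) (auto intro!: powr_mono2)
  have y0: "0 < y" using y(1) assms by (auto intro: less_le_trans[OF mult_pos_pos])
  show ?thesis
  proof (cases "0 \<le> \<epsilon>")
    case True
    have "y powr \<epsilon> \<le> A powr \<epsilon> * q powr \<epsilon>"
      using assms True y0 by (subst powr_mult[symmetric]) (auto intro!: powr_mono2)
    then have "x powr (1 - \<epsilon>) * y powr \<epsilon> \<le> (A powr (1 - \<epsilon>) * p powr (1 - \<epsilon>)) * (A powr \<epsilon> * q powr \<epsilon>)"
      by (intro mult_mono xb) auto
    also have "\<dots> = A powr (1 - \<epsilon>) * A powr \<epsilon> * p * (q / p) powr max \<epsilon> 0"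
      using assms True by (simp add: powr_divide powr_diff divide_simps)
    also have "\<dots> \<le> A powr (1 - \<epsilon>) * (A powr \<epsilon> + a powr \<epsilon>) * p * (q / p) powr max \<epsilon> 0"
      using assms by (intro mult_right_mono mult_left_mono) auto
    finally show ?thesis .
  next
    case False
    have "y powr \<epsilon> \<le> a powr \<epsilon> * p powr \<epsilon>"
      using assms False by (subst powr_mult[symmetric]) (auto intro!: powr_mono2')
    then have "x powr (1 - \<epsilon>) * y powr \<epsilon> \<le> (A powr (1 - \<epsilon>) * p powr (1 - \<epsilon>)) * (a powr \<epsilon> * p powr \<epsilon>)"
      by (intro mult_mono xb) auto
    also have "\<dots> = A powr (1 - \<epsilon>) * a powr \<epsilon> * p * (q / p) powr max \<epsilon> 0"
      using assms False by (simp add: powr_diff divide_simps)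
    also have "\<dots> \<le> A powr (1 - \<epsilon>) * (A powr \<epsilon> + a powr \<epsilon>) * p * (q / p) powr max \<epsilon> 0"
      using assms by (intro mult_right_mono mult_left_mono) auto
    finally show ?thesis .
  qed
qed

text \<open>Besides beating the constant M, k must be at least 6, so that 4^k \<ge> 4096 and 1/2^k
  \<le> 1/64 as the region lemmas require.\<close>

lemma unbounded_powr:
  fixes \<eta> M :: real
  assumes "0 < \<eta>"
  shows "\<exists>k\<ge>6. M < (4 ^ k) powr \<eta>"
proof -
  have "filterlim (\<lambda>k::nat. exp (\<eta> * ln 4 * real k)) at_top sequentially"
    using assms
    by (intro filterlim_compose[OF exp_at_top] filterlim_tendsto_pos_mult_at_top[OF tendsto_const] filterlim_real_sequentially) simp
  then have "\<forall>\<^sub>F k in sequentially. M < exp (\<eta> * ln 4 * real k)"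
    by (simp add: filterlim_at_top_dense)
  then obtain K where K: "\<And>k. k \<ge> K \<Longrightarrow> M < exp (\<eta> * ln 4 * real k)"
    unfolding eventually_sequentially by blast
  have "M < (4 ^ max K 6) powr \<eta>"
    using K[of "max K 6"] by (simp add: powr_def ln_realpow mult_ac)
  then show ?thesis by (intro exI[of _ "max K 6"]) simp
qed

text \<open>One factor N comes from the x-derivative and one from the weight. The resonance enters
  as the hypothesis on \<open>chi 0\<close>: with modulation below 1 the negative exponent -1/2
  costs nothing. The constants are 1/256^3 from \<open>ft_kern_sq_ge\<close> and the root 1/1000 of
  the rescaled volume.\<close>

lemma product_lower:
  fixes \<gamma> a a' e e' d d' N :: real
  defines "u \<equiv> wave \<gamma> a e d kern kern kern" and "v \<equiv> wave \<gamma> a' e' d' kern kern kern"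
  assumes \<gamma>: "0 < \<gamma>" and N: "0 < N"
    and on: "\<And>p q s. \<lbrakk>0 \<le> p; p \<le> 1 / 100; 0 \<le> q; q \<le> 1 / 100; 0 \<le> s; s \<le> 1 / 100\<rbrakk> \<Longrightarrow>
      chi 0 (d + d' + s - omega (a + a' + \<gamma> * p) (e + e' + \<gamma>\<^sup>2 * q)) = 1 \<and> rho1 (a + a' + \<gamma> * p) (e + e' + \<gamma>\<^sup>2 * q) = 1
      \<and> theta m (a + a' + \<gamma> * p) = 1 \<and> N \<le> weight (a + a' + \<gamma> * p) (e + e' + \<gamma>\<^sup>2 * q) \<and> N \<le> a + a' + \<gamma> * p"
  shows "ennreal (N\<^sup>2 / (256 ^ 3 * 1000 * sqrt (\<gamma> ^ 3))) \<le> X_norm 1 (-1/2) (dist_dx (dist_of (\<lambda>z. u z * v z)))"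
proof -
  let ?S = "sqrt (\<gamma> ^ 3)"
  let ?w = "wave \<gamma> (a + a') (e + e') (d + d') kern_sq kern_sq kern_sq"
  have uv: "(\<lambda>z. u z * v z) = ?w"
    unfolding u_def v_def wave_mult kern_sq_def[abs_def] ..
  have int: "integrable lborel ?w" by (rule wave_integrable[OF \<gamma> kern_sq_integrable kern_sq_integrable kern_sq_integrable])
  let ?g = "\<lambda>\<zeta>. \<i> * complex_of_real (fst \<zeta>) * fourier ?w \<zeta>"
  have "ennreal (2 powr (real 0 * (-1/2)) * (N powr 1 * (N * (1 / 256 ^ 3 / \<gamma> ^ 3)) * sqrt (\<gamma> ^ 3 * ((1 / 100 - 0) * (1 / 100 - 0) * (1 / 100 - 0)))))
      \<le> X_norm_hat 1 (-1/2) ?g"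
  proof (rule X_norm_hat_lower_box[OF \<gamma> _ _ _ _ N])
    fix p q s :: real
    assume pqs: "0 \<le> p" "p \<le> 1 / 100" "0 \<le> q" "q \<le> 1 / 100" "0 \<le> s" "s \<le> 1 / 100"
    let ?z = "(a + a' + \<gamma> * p, e + e' + \<gamma>\<^sup>2 * q, d + d' + s)"
    have "1 / 256 * (1 / 256) * (1 / 256) / \<gamma> ^ 3 \<le> cmod (ft kern_sq p) * cmod (ft kern_sq q) * cmod (ft kern_sq s) / \<gamma> ^ 3"
      using pqs \<gamma> by (intro divide_right_mono mult_mono ft_kern_sq_ge) auto
    also have "\<dots> = cmod (fourier ?w ?z)"
      using \<gamma> by (subst fourier_wave[OF \<gamma> kern_sq_integrable kern_sq_integrable kern_sq_integrable])
        (simp add: norm_mult norm_divide norm_power)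
    finally have "1 / 256 ^ 3 / \<gamma> ^ 3 \<le> cmod (fourier ?w ?z)" by (simp add: power3_eq_cube)
    moreover have "N \<le> \<bar>a + a' + \<gamma> * p\<bar>" using on[OF pqs] by linarith
    ultimately have "N * (1 / 256 ^ 3 / \<gamma> ^ 3) \<le> \<bar>a + a' + \<gamma> * p\<bar> * cmod (fourier ?w ?z)"
      using N \<gamma> by (intro mult_mono) auto
    then have "N * (1 / 256 ^ 3 / \<gamma> ^ 3) \<le> cmod (?g ?z)" by (simp only: norm_mult norm_of_real fst_conv norm_ii mult_1_left)
    with on[OF pqs] show "chi 0 (d + d' + s - omega (a + a' + \<gamma> * p) (e + e' + \<gamma>\<^sup>2 * q)) = 1 \<and> rho1 (a + a' + \<gamma> * p) (e + e' + \<gamma>\<^sup>2 * q) = 1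
      \<and> theta m (a + a' + \<gamma> * p) = 1 \<and> N \<le> weight (a + a' + \<gamma> * p) (e + e' + \<gamma>\<^sup>2 * q) \<and> N * (1 / 256 ^ 3 / \<gamma> ^ 3) \<le> cmod (?g ?z)"
      by blast
  qed (use \<gamma> N in auto)
  also have "\<dots> = X_norm 1 (-1/2) (dist_dx (dist_of (\<lambda>z. u z * v z)))"
    unfolding uv by (rule X_norm_eq[OF has_fourier_fun_dist_dx[OF int], symmetric])
  also have "2 powr (real 0 * (-1/2)) * (N powr 1 * (N * (1 / 256 ^ 3 / \<gamma> ^ 3)) * sqrt (\<gamma> ^ 3 * ((1 / 100 - 0) * (1 / 100 - 0) * (1 / 100 - 0))))
      = N\<^sup>2 / (256 ^ 3 * 1000) * (?S / \<gamma> ^ 3)"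
  proof -
    have "sqrt (1 / 1000000) = 1 / 1000" by (rule real_sqrt_unique) (simp_all add: power2_eq_square)
    then have "sqrt (\<gamma> ^ 3 * ((1 / 100 - 0) * (1 / 100 - 0) * (1 / 100 - 0))) = ?S / 1000"
      using real_sqrt_mult[of "\<gamma> ^ 3" "1 / 1000000"] by simp
    moreover have "2 powr (real 0 * (-1/2)) = 1" by simp
    moreover have "N powr 1 = N" using N by simp
    ultimately show ?thesis by (simp only: power2_eq_square) simp
  qed
  finally show ?thesis unfolding cube_div_sqrt[OF \<gamma>] by simp
qed

theorem proposition7:
  fixes \<epsilon> :: real
  assumes "\<epsilon> < 1 / 4"
  shows "\<not> (\<exists>C>0. \<forall>u v. admissible u \<and> admissible v \<longrightarrow>
     X_norm 1 (-1/2) (dist_dx (dist_of (\<lambda>z. u z * v z)))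
     \<le> ennreal
        (C * X_real u * (X_real v + X_real v powr (1 - \<epsilon>) * Y_real v powr \<epsilon>) +
         C * X_real v * (X_real u + X_real u powr (1 - \<epsilon>) * Y_real u powr \<epsilon>)))"
proof
  assume "\<exists>C>0. \<forall>u v. admissible u \<and> admissible v \<longrightarrow>
     X_norm 1 (-1/2) (dist_dx (dist_of (\<lambda>z. u z * v z)))
     \<le> ennreal
        (C * X_real u * (X_real v + X_real v powr (1 - \<epsilon>) * Y_real v powr \<epsilon>) +
         C * X_real v * (X_real u + X_real u powr (1 - \<epsilon>) * Y_real u powr \<epsilon>))"
  then obtain C where C: "C > 0" and est: "\<And>u v. admissible u \<Longrightarrow> admissible v \<Longrightarrow>
     X_norm 1 (-1/2) (dist_dx (dist_of (\<lambda>z. u z * v z)))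
     \<le> ennreal
        (C * X_real u * (X_real v + X_real v powr (1 - \<epsilon>) * Y_real v powr \<epsilon>) +
         C * X_real v * (X_real u + X_real u powr (1 - \<epsilon>) * Y_real u powr \<epsilon>))"
    by blast
  define \<delta> where "\<delta> = max \<epsilon> 0"
  have \<delta>: "0 \<le> \<delta>" "\<delta> < 1 / 4" using assms by (auto simp: \<delta>_def)
  \<comment> \<open>The factor 6 covers all upper bounds below: the largest is 5N + N, the weight of
    \<open>v\<close> plus the 1/\<gamma>^2 = N caused by y.\<close>
  define A where "A = 6 * wave_const"
  have A: "0 < A" using wave_const_pos by (simp add: A_def)
  \<comment> \<open>The constant of \<open>powr_interpolation\<close>, with 1/160 from
    \<open>wave_Y_lower\<close>.\<close>
  define L where "L = A powr (1 - \<epsilon>) * (A powr \<epsilon> + (1 / 160) powr \<epsilon>)"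
  have L: "0 \<le> L" using A by (simp add: L_def)
  \<comment> \<open>Each of the two symmetric terms of the right-hand side contributes C A (A + L).
    The factor 256^3 \<cdot> 1000 in the choice of k is that of
    \<open>product_lower\<close>.\<close>
  define M where "M = 2 * (C * A * (A + L))"
  have M: "0 \<le> M" using C A L by (simp add: M_def)
  obtain k :: nat where k: "6 \<le> k" "M * (256 ^ 3 * 1000) < (4 ^ k) powr (1 / 4 - \<delta>)"
    using unbounded_powr[of "1 / 4 - \<delta>" "M * (256 ^ 3 * 1000)"] \<delta> by auto
  define N :: real where "N = 4 ^ k"
  define \<gamma> :: real where "\<gamma> = 1 / 2 ^ k"
  define S where "S = sqrt (\<gamma> ^ 3)"
  have "(4::real) ^ 6 \<le> N" unfolding N_def using k by (intro power_increasing) auto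
  then have N: "N = 4 ^ k" "4096 \<le> N" by (simp_all add: N_def)
  have "(2::real) ^ 6 \<le> 2 ^ k" using k by (intro power_increasing) auto
  then have \<gamma>: "0 < \<gamma>" "\<gamma> \<le> 1 / 64" by (simp_all add: \<gamma>_def divide_simps)
  have "(4::real) ^ k = 2 ^ k * 2 ^ k" unfolding power_mult_distrib[symmetric] by simp
  then have N\<gamma>: "N * \<gamma>\<^sup>2 = 1"
    by (simp add: N_def \<gamma>_def power_divide power2_eq_square)
  then have inv: "1 / \<gamma>\<^sup>2 = N" using \<gamma> by (simp add: field_simps)
  have S: "0 < S" using \<gamma> by (simp add: S_def)
  have SN: "S = N powr (- (3 / 4))"
  proof -
    have "S = (\<gamma> powr 3) powr (1 / 2)" using \<gamma> by (simp add: S_def powr_half_sqrt powr_realpow)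
    also have "\<gamma> = N powr (- (1 / 2))"
    proof -
      have "\<gamma> = sqrt (1 / N)" by (rule real_sqrt_unique[symmetric]) (use \<gamma> inv N in \<open>simp_all add: field_simps\<close>)
      then show ?thesis using N by (simp add: powr_minus powr_half_sqrt real_sqrt_divide inverse_eq_divide)
    qed
    finally show ?thesis by (simp add: powr_powr)
  qed
  define u where "u = wave \<gamma> (2 * \<gamma>) 0 0 kern kern kern"
  \<comment> \<open>The constant 96 is 6 \<cdot> 4^2: the frequencies 2\<gamma> and N + 2\<gamma>
    add up to r = 4 in \<open>omega_approx\<close>, so \<open>u v\<close> sits on the surface \<tau>
    = \<omega>. The packet \<open>v\<close> itself has r = 2, where \<omega> is about 4N^3 + 24; its
    modulation is about 72, inside the shell 64 to 128 with index 7, and stays below 128 on its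
    whole box.\<close>
  define v where "v = wave \<gamma> (N + 2 * \<gamma>) (sqrt 3 * N\<^sup>2) (4 * N ^ 3 + 96) kern kern kern"
  have shift: "N + 2 * \<gamma> + \<gamma> * p = N + \<gamma> * (2 + p)" for p by (simp add: algebra_simps)
  have shift4: "2 * \<gamma> + (N + 2 * \<gamma>) + \<gamma> * p = N + \<gamma> * (4 + p)" for p by (simp add: algebra_simps)

  have u: "admissible u" "X_real u \<le> wave_const * (2 / S)" "Y_real u \<le> wave_const * ((2 + N) / S)"
      "1 / (160 * S) \<le> Y_real u"
  proof -
    have on: "(\<forall>j\<ge>8. chi j (0 + s - omega (2 * \<gamma> + \<gamma> * p) (0 + \<gamma>\<^sup>2 * q)) = 0) \<and> rho2 (2 * \<gamma> + \<gamma> * p) (0 + \<gamma>\<^sup>2 * q) = 0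
      \<and> (\<forall>m'. m' \<noteq> 0 \<longrightarrow> theta m' (2 * \<gamma> + \<gamma> * p) = 0) \<and> weight (2 * \<gamma> + \<gamma> * p) (0 + \<gamma>\<^sup>2 * q) \<le> 2"
      if pqs: "\<bar>p\<bar> \<le> 1" "\<bar>q\<bar> \<le> 1" "\<bar>s\<bar> \<le> 1" for p q s
    proof -
      note l = low_region[OF \<gamma> pqs(1,2)]
      have "\<bar>0 + s - omega (2 * \<gamma> + \<gamma> * p) (0 + \<gamma>\<^sup>2 * q)\<bar> < 128" using l(1) pqs(3) by linarith
      then show ?thesis using chi_eq_0 l by blast
    qed
    note b = wave_bounds[of \<gamma> 2 0 "2 * \<gamma>" 0, OF \<gamma>(1) _ on, folded u_def S_def, unfolded inv]
    show "admissible u" "X_real u \<le> wave_const * (2 / S)" "Y_real u \<le> wave_const * ((2 + N) / S)"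
      by (rule b; simp)+
    show "1 / (160 * S) \<le> Y_real u"
      unfolding u_def S_def
    proof (rule wave_Y_lower[OF \<gamma>(1) _ b(4)[unfolded u_def] b(5)[unfolded u_def]])
      fix p q s :: real
      assume pqs: "0 \<le> p" "p \<le> 1 / 10" "0 \<le> q" "q \<le> 1 / 10" "1 / 4 \<le> s" "s \<le> 1 / 2"
      then have "\<bar>p\<bar> \<le> 1" "\<bar>q\<bar> \<le> 1" by auto
      note l = low_region[OF \<gamma> this]
      have "\<bar>0 + s - omega (2 * \<gamma> + \<gamma> * p) (0 + \<gamma>\<^sup>2 * q)\<bar> < 1" using l(1) pqs by linarith
      then show "chi 0 (0 + s - omega (2 * \<gamma> + \<gamma> * p) (0 + \<gamma>\<^sup>2 * q)) = 1 \<and> rho1 (2 * \<gamma> + \<gamma> * p) (0 + \<gamma>\<^sup>2 * q) = 1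
        \<and> theta 0 (2 * \<gamma> + \<gamma> * p) = 1 \<and> 1 \<le> weight (2 * \<gamma> + \<gamma> * p) (0 + \<gamma>\<^sup>2 * q)"
        using l weight_ge_1 by (simp add: chi_def)
    qed simp_all
  qed

  have v: "admissible v" "X_real v \<le> wave_const * (5 * N / S)" "Y_real v \<le> wave_const * ((5 * N + N) / S)"
      "N / (160 * S) \<le> Y_real v"
  proof -
    let ?\<xi> = "\<lambda>p. N + 2 * \<gamma> + \<gamma> * p" and ?\<mu> = "\<lambda>q. sqrt 3 * N\<^sup>2 + \<gamma>\<^sup>2 * q"
    have on: "(\<forall>j\<ge>8. chi j (4 * N ^ 3 + 96 + s - omega (?\<xi> p) (?\<mu> q)) = 0) \<and> rho2 (?\<xi> p) (?\<mu> q) = 0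
      \<and> (\<forall>m'. m' \<noteq> 2 * k + 1 \<longrightarrow> theta m' (?\<xi> p) = 0) \<and> weight (?\<xi> p) (?\<mu> q) \<le> 5 * N"
      if pqs: "\<bar>p\<bar> \<le> 1" "\<bar>q\<bar> \<le> 1" "\<bar>s\<bar> \<le> 1" for p q s
    proof -
      have r: "1 \<le> 2 + p" "2 + p \<le> 5" "2 + p \<le> 3" using pqs by auto
      note h = high_region[OF N \<gamma> r(1,2) pqs(2), folded shift]
      have o: "\<bar>omega (?\<xi> p) (?\<mu> q) - (4 * N ^ 3 + 6 * (2 + p)\<^sup>2 + 2 * sqrt 3 * q)\<bar> \<le> 1 / 4"
        unfolding shift by (rule omega_approx[OF \<gamma> N\<gamma> r(1,2) pqs(2)])
      have "(2 + p)\<^sup>2 \<le> 3\<^sup>2" using r by (intro power_mono) auto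
      then have r2: "0 \<le> (2 + p)\<^sup>2" "(2 + p)\<^sup>2 \<le> 9" by auto
      have "\<bar>2 * sqrt 3 * q\<bar> \<le> 2 * (9 / 5) * 1"
        unfolding abs_mult using sqrt3_bounds pqs by (intro mult_mono) auto
      then have "\<bar>4 * N ^ 3 + 96 + s - omega (?\<xi> p) (?\<mu> q)\<bar> < 128" using o r2 pqs(3) by linarith
      then show ?thesis using chi_eq_0 h by blast
    qed
    have N0: "0 < 5 * N" using N by simp
    note b = wave_bounds[of \<gamma> "5 * N" "4 * N ^ 3 + 96" "N + 2 * \<gamma>" "sqrt 3 * N\<^sup>2", OF \<gamma>(1) N0 on, folded v_def S_def, unfolded inv]
    show "admissible v" "X_real v \<le> wave_const * (5 * N / S)" "Y_real v \<le> wave_const * ((5 * N + N) / S)"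
      by (rule b; assumption)+
    show "N / (160 * S) \<le> Y_real v"
      unfolding v_def S_def
    proof (rule wave_Y_lower[OF \<gamma>(1) _ b(4)[unfolded v_def] b(5)[unfolded v_def]])
      fix p q s :: real
      assume pqs: "0 \<le> p" "p \<le> 1 / 10" "0 \<le> q" "q \<le> 1 / 10" "1 / 4 \<le> s" "s \<le> 1 / 2"
      then have r: "1 \<le> 2 + p" "2 + p \<le> 5" "2 + p \<le> 21 / 10" and q: "\<bar>q\<bar> \<le> 1" by auto
      note h = high_region[OF N \<gamma> r(1,2) q, folded shift]
      have o: "\<bar>omega (?\<xi> p) (?\<mu> q) - (4 * N ^ 3 + 6 * (2 + p)\<^sup>2 + 2 * sqrt 3 * q)\<bar> \<le> 1 / 4"
        unfolding shift by (rule omega_approx[OF \<gamma> N\<gamma> r(1,2) q])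
      have "2\<^sup>2 \<le> (2 + p)\<^sup>2" "(2 + p)\<^sup>2 \<le> (21 / 10)\<^sup>2" using pqs r by (intro power_mono; simp)+
      then have r2: "4 \<le> (2 + p)\<^sup>2" "(2 + p)\<^sup>2 \<le> 441 / 100" by (auto simp: power2_eq_square)
      have "2 * sqrt 3 * q \<le> 2 * (9 / 5) * (1 / 10)"
        using sqrt3_bounds pqs by (intro mult_mono) auto
      moreover have "0 \<le> 2 * sqrt 3 * q" using pqs by simp
      ultimately have "64 \<le> 4 * N ^ 3 + 96 + s - omega (?\<xi> p) (?\<mu> q)" "4 * N ^ 3 + 96 + s - omega (?\<xi> p) (?\<mu> q) < 128"
        using o r2 pqs by linarith+
      then have "chi 7 (4 * N ^ 3 + 96 + s - omega (?\<xi> p) (?\<mu> q)) = 1" by (simp add: chi_def)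
      then show "chi 7 (4 * N ^ 3 + 96 + s - omega (?\<xi> p) (?\<mu> q)) = 1 \<and> rho1 (?\<xi> p) (?\<mu> q) = 1
        \<and> theta (2 * k + 1) (?\<xi> p) = 1 \<and> N \<le> weight (?\<xi> p) (?\<mu> q)"
        using h by blast
    qed (use N in simp_all)
  qed

  have lower: "ennreal (N\<^sup>2 / (256 ^ 3 * 1000 * S)) \<le> X_norm 1 (-1/2) (dist_dx (dist_of (\<lambda>z. u z * v z)))"
    unfolding u_def v_def S_def
  proof (rule product_lower[OF \<gamma>(1)])
    let ?\<xi> = "\<lambda>p. 2 * \<gamma> + (N + 2 * \<gamma>) + \<gamma> * p" and ?\<mu> = "\<lambda>q. 0 + sqrt 3 * N\<^sup>2 + \<gamma>\<^sup>2 * q"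
    fix p q s :: real
    assume pqs: "0 \<le> p" "p \<le> 1 / 100" "0 \<le> q" "q \<le> 1 / 100" "0 \<le> s" "s \<le> 1 / 100"
    then have r: "1 \<le> 4 + p" "4 + p \<le> 5" "4 + p \<le> 401 / 100" and q: "\<bar>q\<bar> \<le> 1" by auto
    have \<mu>: "?\<mu> q = sqrt 3 * N\<^sup>2 + \<gamma>\<^sup>2 * q" by simp
    note h = high_region[OF N \<gamma> r(1,2) q, folded shift4 \<mu>]
    have o: "\<bar>omega (?\<xi> p) (?\<mu> q) - (4 * N ^ 3 + 6 * (4 + p)\<^sup>2 + 2 * sqrt 3 * q)\<bar> \<le> 1 / 4"
      unfolding shift4 \<mu> by (rule omega_approx[OF \<gamma> N\<gamma> r(1,2) q])
    have "4\<^sup>2 \<le> (4 + p)\<^sup>2" "(4 + p)\<^sup>2 \<le> (401 / 100)\<^sup>2" using pqs r by (intro power_mono; simp)+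
    then have r2: "16 \<le> (4 + p)\<^sup>2" "(4 + p)\<^sup>2 \<le> 160801 / 10000" by (auto simp: power2_eq_square)
    have "2 * sqrt 3 * q \<le> 2 * (9 / 5) * (1 / 100)"
      using sqrt3_bounds pqs by (intro mult_mono) auto
    moreover have "0 \<le> 2 * sqrt 3 * q" using pqs by simp
    \<comment> \<open>With p \<le> 1/100, 6(4+p)^2 exceeds 96 by less than 1/2; together with the
      error 1/4 and the small q and s this stays below 1.\<close>
    ultimately have "\<bar>0 + (4 * N ^ 3 + 96) + s - omega (?\<xi> p) (?\<mu> q)\<bar> < 1"
      using o r2 pqs by linarith
    then have "chi 0 (0 + (4 * N ^ 3 + 96) + s - omega (?\<xi> p) (?\<mu> q)) = 1" by (simp add: chi_def)
    moreover have "N \<le> ?\<xi> p" using \<gamma> pqs by simp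
    ultimately show "chi 0 (0 + (4 * N ^ 3 + 96) + s - omega (?\<xi> p) (?\<mu> q)) = 1 \<and> rho1 (?\<xi> p) (?\<mu> q) = 1
      \<and> theta (2 * k + 1) (?\<xi> p) = 1 \<and> N \<le> weight (?\<xi> p) (?\<mu> q) \<and> N \<le> ?\<xi> p"
      using h by blast
  qed (use N in simp)

  define R where "R = C * X_real u * (X_real v + X_real v powr (1 - \<epsilon>) * Y_real v powr \<epsilon>) +
         C * X_real v * (X_real u + X_real u powr (1 - \<epsilon>) * Y_real u powr \<epsilon>)"
  have "ennreal (N\<^sup>2 / (256 ^ 3 * 1000 * S)) \<le> ennreal R"
    using order_trans[OF lower est[OF u(1) v(1)]] by (simp only: R_def)
  \<comment> \<open>Strict positivity allows the passage to real numbers, since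
    \<open>ennreal R\<close> would be 0 for negative R.\<close>
  moreover have "0 < N\<^sup>2 / (256 ^ 3 * 1000 * S)" using N S by simp
  ultimately have NR: "N\<^sup>2 / (256 ^ 3 * 1000 * S) \<le> R"
    by (metis ennreal_le_iff2 not_le)
  have pos: "0 \<le> X_real u" "0 \<le> X_real v" by (simp_all add: X_real_def)
  have Xu: "X_real u \<le> A * (1 / S)"
    using u(2) wave_const_pos S by (simp add: A_def divide_simps)
  have Xv: "X_real v \<le> A * (N / S)"
  proof -
    have "wave_const * (5 * N / S) \<le> wave_const * (6 * N / S)"
      using wave_const_pos S N by (intro mult_left_mono divide_right_mono) auto
    then show ?thesis using v(2) by (simp add: A_def)
  qed
  have Yu: "Y_real u \<le> A * (N / S)"
  proof -
    have "wave_const * ((2 + N) / S) \<le> wave_const * (6 * N / S)"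
      using wave_const_pos S N by (intro mult_left_mono divide_right_mono) auto
    then show ?thesis using u(3) by (simp add: A_def)
  qed
  have Yv: "Y_real v \<le> A * (N / S)" using v(3) by (simp add: A_def mult_ac)
  \<comment> \<open>Here the upper bounds for the two norms differ by the ratio N.\<close>
  have Iu: "X_real u powr (1 - \<epsilon>) * Y_real u powr \<epsilon> \<le> L * (1 / S) * N powr \<delta>"
    using powr_interpolation[OF pos(1) Xu _ Yu, of "1 / 160" \<epsilon>] u(4) A S N assms by (simp add: L_def \<delta>_def)
  \<comment> \<open>Here both norms have the same size N/S, so the ratio is 1 and no power of N is
    lost.\<close>
  have Iv: "X_real v powr (1 - \<epsilon>) * Y_real v powr \<epsilon> \<le> L * (N / S)"
    using powr_interpolation[OF pos(2) Xv _ Yv, of "1 / 160" \<epsilon>] v(4) A S N assms by (simp add: L_def)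
  have N\<delta>: "1 \<le> N powr \<delta>" using N \<delta> by (intro ge_one_powr_ge_zero) auto
  have "R \<le> C * (A * (1 / S)) * (A * (N / S) + L * (N / S)) + C * (A * (N / S)) * (A * (1 / S) + L * (1 / S) * N powr \<delta>)"
    unfolding R_def using C A L S N pos by (intro add_mono mult_mono Xu Xv Iu Iv order_refl) auto
  \<comment> \<open>The terms without \<open>N powr \<delta>\<close> are enlarged by this factor,
    which is at least 1, so that it can be taken out of the whole sum.\<close>
  also have "\<dots> \<le> C * (A * (1 / S)) * (A * (N / S) + L * (N / S)) * N powr \<delta> + C * (A * (N / S)) * (A * (1 / S) * N powr \<delta> + L * (1 / S) * N powr \<delta>)"
  proof -
    have grow: "x \<le> x * N powr \<delta>" if "0 \<le> x" for x
      using mult_left_mono[OF N\<delta> that] by simp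
    show ?thesis using C A L S N by (intro add_mono mult_left_mono grow order_refl) auto
  qed
  also have "\<dots> = M * N * N powr \<delta> / S\<^sup>2"
    using S by (simp add: M_def field_simps power2_eq_square)
  finally have "N\<^sup>2 / (256 ^ 3 * 1000 * S) \<le> M * N * N powr \<delta> / S\<^sup>2" using NR by linarith
  then have "N * S \<le> M * (256 ^ 3 * 1000) * N powr \<delta>"
    using S N by (simp add: field_simps power2_eq_square)
  moreover have "N * S = N powr (1 / 4 - \<delta>) * N powr \<delta>"
    unfolding SN powr_add[symmetric] using N powr_mult_base[of N "- (3 / 4)"] by simp
  ultimately have "N powr (1 / 4 - \<delta>) * N powr \<delta> \<le> M * (256 ^ 3 * 1000) * N powr \<delta>"
    by (simp only:)
  moreover have "0 < N powr \<delta>" using N\<delta> by linarith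
  ultimately have "N powr (1 / 4 - \<delta>) \<le> M * (256 ^ 3 * 1000)"
    by (rule mult_right_le_imp_le)
  with k(2) show False by (simp add: N_def)
qed

end
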